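(* Let $V\subset\mathbf{P}^N(\mathbf{C})$ be a complex projective algebraic variety of dimension $n$, and let $D_1,\ldots,D_n$ be $n=\dim V$ hypersurfaces in $\mathbf{P}^N(\mathbf{C})$ located in general position in $V$. Then the mean dimension in the sense of Gromov of the space of Brody curves in $V\setminus\bigcup_{i=1}^n\mathrm{Supp}\,D_i$ is zero.
   Context: A hypersurface $D$ in $\mathbf{P}^N(\mathbf{C})$ is given by a nonconstant homogeneous polynomial $Q$, and $\mathrm{Supp}\,D=\{Q=0\}$. Hypersurfaces $D_1,\ldots,D_q$ are in $m$-subgeneral position in $V$ (where $m\ge\dim V$) if for every nonempty subset $I\subset\{1,\ldots,q\}$ with $\sharp I\le m+1$ one has $\dim\big(\bigcap_{i\in I}\mathrm{Supp}\,D_i\cap V\big)\le m-\sharp I$ (a set of negative dimension being empty); they are in general position in $V$ if they are in $(\dim V)$-subgeneral position. For a holomorphic curve $f=[f_0:\cdots:f_N]:\mathbf{C}\to\mathbf{P}^N(\mathbf{C})$ (entire $f_j$ without common zeros), the Fubini-Study derivative is given by $\|f'\|^2=\sum_{i<j}|f_i'f_j-f_if_j'|^2/\big(\sum_j|f_j|^2\big)^2$; $f$ is a Brody curve if $\|f'\|$ is bounded on $\mathbf{C}$. The space of Brody curves in $U=V\setminus\bigcup_i\mathrm{Supp}\,D_i$ is, with the usual normalization, the space $\mathcal{M}$ of holomorphic $f:\mathbf{C}\to U$ with $\|f'\|\le1$ on $\mathbf{C}$, with the topology of locally uniform convergence and the action of $\mathbf{C}$ by translations $f(z)\mapsto f(z+a)$.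 Mean dimension: for a metric space $(X,d)$ and $\varepsilon>0$, $\mathrm{Widim}_\varepsilon(X,d)$ is the smallest integer $k$ such that there is a $k$-dimensional polyhedron $P$ (simplicial complex) and a continuous map $\phi:X\to P$ all of whose fibers have $d$-diameter at most $\varepsilon$. With $\mathrm{dist}$ the Fubini-Study distance on $\mathbf{P}^N(\mathbf{C})$ and $d_R(f,g)=\sup_{|z|\le R}\mathrm{dist}(f(z),g(z))$, the mean dimension of $\mathcal{M}$ is $$\lim_{\varepsilon\to0}\ \limsup_{R\to\infty}\frac{\mathrm{Widim}_\varepsilon(\mathcal{M},d_R)}{\pi R^2}.$$ *)

theory Defs
  imports "HOL-Analysis.Analysis" "HOL-Library.Poly_Mapping"
begin

unbundle no fps_syntax

section \<open>Complex projective space\<close>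

text \<open>
  The projective space of dimension \<open>N = CARD('k) - 1\<close>; the index type \<open>'k\<close> plays the role of
  \<open>{0, \<dots>, N}\<close>.
\<close>

definition proportional :: "complex ^ 'k \<Rightarrow> complex ^ 'k \<Rightarrow> bool" where
  "proportional x y \<longleftrightarrow> x \<noteq> 0 \<and> y \<noteq> 0 \<and> (\<exists>c. c \<noteq> 0 \<and> y = c *s x)"

lemma part_equivp_proportional: "part_equivp (proportional :: complex ^ 'k::finite \<Rightarrow> _)"
proof (rule part_equivpI)
  show "\<exists>x::complex ^ 'k. proportional x x"
    by (rule exI[of _ "vec 1"]) (auto simp: proportional_def vec_eq_iff intro!: exI[of _ 1])
  show "symp (proportional :: complex ^ 'k \<Rightarrow> _)"
  proof (rule sympI)
    fix x y :: "complex ^ 'k"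
    assume "proportional x y"
    then obtain c where c: "x \<noteq> 0" "y \<noteq> 0" "c \<noteq> 0" "y = c *s x"
      by (auto simp: proportional_def)
    then have "x = inverse c *s y"
      by (simp add: vec_eq_iff)
    with c show "proportional y x"
      unfolding proportional_def by (metis nonzero_imp_inverse_nonzero)
  qed
  show "transp (proportional :: complex ^ 'k \<Rightarrow> _)"
  proof (rule transpI)
    fix x y z :: "complex ^ 'k"
    assume "proportional x y" "proportional y z"
    then obtain c d where c: "x \<noteq> 0" "c \<noteq> 0" "y = c *s x" "z \<noteq> 0" "d \<noteq> 0" "z = d *s y"
      by (auto simp: proportional_def)
    then have "z = (d * c) *s x" "d * c \<noteq> 0"
      by (simp_all add: vec_eq_iff)
    with c show "proportional x z"
      unfolding proportional_def by blast
  qed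
qed

quotient_type 'k proj_space = "complex ^ 'k::finite" / partial: proportional
  morphisms rep_proj proj
  by (rule part_equivp_proportional)

lemma proj_eq_iff:
  assumes "x \<noteq> 0" "y \<noteq> 0"
  shows "proj x = proj y \<longleftrightarrow> (\<exists>c. c \<noteq> 0 \<and> y = c *s x)"
proof -
  have "proportional x x" "proportional y y"
    using assms by (auto simp: proportional_def intro!: exI[of _ 1])
  then have "proj x = proj y \<longleftrightarrow> proportional x y"
    using Quotient_rel[OF Quotient_proj_space] by metis
  with assms show ?thesis
    by (auto simp: proportional_def)
qed

text \<open>
  The Fubini--Study distance, normalised so that it is the geodesic distance of the metric whose
  norm is used for \<open>fs_derivative\<close> below (so the projective line is a sphere of diameter \<open>\<pi>/2\<close>).
\<close>

lift_definition fs_dist :: "'k::finite proj_space \<Rightarrow> 'k proj_space \<Rightarrow> real"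
  is "\<lambda>x y. arccos (cmod (\<Sum>i\<in>UNIV. x $ i * cnj (y $ i)) / (norm x * norm y))"
proof -
  fix x x' y y' :: "complex ^ 'k"
  assume "proportional x x'" "proportional y y'"
  then obtain c d where cd: "c \<noteq> 0" "x' = c *s x" "d \<noteq> 0" "y' = d *s y"
    by (auto simp: proportional_def)
  have nrm: "norm (a *s v) = cmod a * norm v" for a and v :: "complex ^ 'k"
    by (simp add: norm_vec_def L2_set_def norm_mult power_mult_distrib
        sum_distrib_left[symmetric] real_sqrt_mult)
  have "(\<Sum>i\<in>UNIV. x' $ i * cnj (y' $ i)) = c * cnj d * (\<Sum>i\<in>UNIV. x $ i * cnj (y $ i))"
    by (simp add: cd sum_distrib_left mult_ac)
  then show "arccos (cmod (\<Sum>i\<in>UNIV. x $ i * cnj (y $ i)) / (norm x * norm y)) =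
      arccos (cmod (\<Sum>i\<in>UNIV. x' $ i * cnj (y' $ i)) / (norm x' * norm y'))"
    using cd by (simp add: nrm norm_mult)
qed


section \<open>Projective algebraic sets\<close>

type_synonym 'k polynomial = "('k \<Rightarrow>\<^sub>0 nat) \<Rightarrow>\<^sub>0 complex"

definition eval_poly :: "'k::finite polynomial \<Rightarrow> complex ^ 'k \<Rightarrow> complex" where
  "eval_poly Q x = (\<Sum>m\<in>Poly_Mapping.keys Q.
     Poly_Mapping.lookup Q m * (\<Prod>i\<in>UNIV. (x $ i) ^ Poly_Mapping.lookup m i))"

definition homogeneous :: "nat \<Rightarrow> 'k::finite polynomial \<Rightarrow> bool" where
  "homogeneous d Q \<longleftrightarrow> (\<forall>m\<in>Poly_Mapping.keys Q. (\<Sum>i\<in>UNIV. Poly_Mapping.lookup m i) = d)"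

text \<open>Only used for homogeneous \<open>Q\<close>, where vanishing does not depend on the representative.\<close>

definition zeros :: "'k::finite polynomial \<Rightarrow> 'k proj_space set" where
  "zeros Q = {proj x | x. x \<noteq> 0 \<and> eval_poly Q x = 0}"

definition zariski_closed :: "'k::finite proj_space set \<Rightarrow> bool" where
  "zariski_closed Z \<longleftrightarrow>
     (\<exists>S. (\<forall>Q\<in>S. \<exists>d. homogeneous d Q) \<and> Z = (\<Inter>Q\<in>S. zeros Q))"

definition projective_variety :: "'k::finite proj_space set \<Rightarrow> bool" where
  "projective_variety Z \<longleftrightarrow> zariski_closed Z \<and> Z \<noteq> {} \<and>
     (\<forall>A B. zariski_closed A \<and> zariski_closed B \<and> Z = A \<union> B \<longrightarrow> A = Z \<or> B = Z)"

text \<open>Krull dimension; the empty set has dimension \<open>-\<infinity>\<close>.\<close>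

definition proj_dim :: "'k::finite proj_space set \<Rightarrow> ereal" where
  "proj_dim Z = (SUP k \<in> {k. \<exists>C. (\<forall>i\<le>k. projective_variety (C i) \<and> C i \<subseteq> Z) \<and>
                                (\<forall>i<k. C i \<subset> C (Suc i))}. ereal (real k))"

definition hypersurface :: "'k::finite polynomial \<Rightarrow> bool" where
  "hypersurface Q \<longleftrightarrow> Q \<noteq> 0 \<and> (\<exists>d\<ge>1. homogeneous d Q)"

definition subgeneral_position ::
  "nat \<Rightarrow> 'k::finite proj_space set \<Rightarrow> nat \<Rightarrow> (nat \<Rightarrow> 'k polynomial) \<Rightarrow> bool" where
  "subgeneral_position m V q D \<longleftrightarrow> proj_dim V \<le> ereal (real m) \<and>
     (\<forall>I. I \<subseteq> {1..q} \<and> I \<noteq> {} \<and> card I \<le> m + 1 \<longrightarrow>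
        proj_dim ((\<Inter>i\<in>I. zeros (D i)) \<inter> V) \<le> ereal (real m - real (card I)))"

definition general_position ::
  "'k::finite proj_space set \<Rightarrow> nat \<Rightarrow> (nat \<Rightarrow> 'k polynomial) \<Rightarrow> bool" where
  "general_position V q D \<longleftrightarrow>
     (\<exists>m. proj_dim V = ereal (real m) \<and> subgeneral_position m V q D)"


section \<open>Brody curves\<close>

definition reduced_rep :: "(complex \<Rightarrow> complex ^ 'k) \<Rightarrow> (complex \<Rightarrow> 'k::finite proj_space) \<Rightarrow> bool"
  where "reduced_rep F f \<longleftrightarrow>
     (\<forall>i. (\<lambda>z. F z $ i) holomorphic_on UNIV) \<and> (\<forall>z. F z \<noteq> 0) \<and> (\<forall>z. f z = proj (F z))"

definition holomorphic_curve :: "(complex \<Rightarrow> 'k::finite proj_space) \<Rightarrow> bool" where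
  "holomorphic_curve f \<longleftrightarrow> (\<exists>F. reduced_rep F f)"

definition fs_derivative_rep ::
  "(complex \<Rightarrow> complex ^ 'k::{finite,linorder}) \<Rightarrow> complex \<Rightarrow> real" where
  "fs_derivative_rep F z =
     sqrt ((\<Sum>(i, j)\<in>{(i, j). i < j}.
              (cmod (deriv (\<lambda>w. F w $ i) z * F z $ j - F z $ i * deriv (\<lambda>w. F w $ j) z))\<^sup>2) /
           (\<Sum>j\<in>UNIV. (cmod (F z $ j))\<^sup>2)\<^sup>2)"

definition fs_derivative ::
  "(complex \<Rightarrow> 'k::{finite,linorder} proj_space) \<Rightarrow> complex \<Rightarrow> real" where
  "fs_derivative f = fs_derivative_rep (SOME F. reduced_rep F f)"

lemma fs_derivative_rep_unique:
  assumes F: "reduced_rep F f" and G: "reduced_rep G f"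
  shows "fs_derivative_rep F z = fs_derivative_rep G z"
proof -
  have holF: "(\<lambda>w. F w $ i) holomorphic_on UNIV" and holG: "(\<lambda>w. G w $ i) holomorphic_on UNIV" for i
    using F G by (auto simp: reduced_rep_def)
  have "\<exists>c. c \<noteq> 0 \<and> G w = c *s F w" for w
    using F G proj_eq_iff[of "F w" "G w"] by (auto simp: reduced_rep_def)
  then obtain c where c: "c w \<noteq> 0" "G w = c w *s F w" for w
    by metis
  from F obtain l where l: "F z $ l \<noteq> 0"
    unfolding reduced_rep_def by (metis vec_eq_iff zero_index)
  define h where "h = (\<lambda>w. G w $ l / F w $ l)"
  have DF: "((\<lambda>w. F w $ i) has_field_derivative deriv (\<lambda>w. F w $ i) z) (at z)" for i
    using holF holomorphic_derivI by blast
  have DG: "((\<lambda>w. G w $ i) has_field_derivative deriv (\<lambda>w. G w $ i) z) (at z)" for i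
    using holG holomorphic_derivI by blast
  obtain h' where h': "(h has_field_derivative h') (at z)"
    unfolding h_def using DERIV_divide[OF DG DF l] by blast
  have "open {w. F w $ l \<noteq> 0}"
    by (intro open_Collect_neq holomorphic_on_imp_continuous_on holF continuous_on_const)
  then have ev: "\<forall>\<^sub>F w in nhds z. F w $ l \<noteq> 0"
    using l eventually_nhds_in_open[of "{w. F w $ l \<noteq> 0}" z] by simp
  have hz: "h w = c w" if "F w $ l \<noteq> 0" for w
    using that c(2)[of w] by (simp add: h_def)
  have derivG: "deriv (\<lambda>w. G w $ i) z = h' * F z $ i + c z * deriv (\<lambda>w. F w $ i) z" for i
  proof -
    have "((\<lambda>w. h w * F w $ i) has_field_derivative
        h' * F z $ i + deriv (\<lambda>w. F w $ i) z * h z) (at z)"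
      by (rule DERIV_mult[OF h' DF])
    moreover have "\<forall>\<^sub>F w in nhds z. h w * F w $ i = G w $ i"
      using ev by eventually_elim (simp add: hz c(2))
    ultimately have "((\<lambda>w. G w $ i) has_field_derivative
        h' * F z $ i + deriv (\<lambda>w. F w $ i) z * h z) (at z)"
      by (subst (asm) DERIV_cong_ev[OF refl _ refl])
    then show ?thesis
      by (simp add: DERIV_imp_deriv hz[OF l] mult.commute)
  qed
  have Gz: "G z $ i = c z * F z $ i" for i
    by (simp add: c(2))
  have wronskian: "deriv (\<lambda>w. G w $ i) z * G z $ j - G z $ i * deriv (\<lambda>w. G w $ j) z =
      (c z)\<^sup>2 * (deriv (\<lambda>w. F w $ i) z * F z $ j - F z $ i * deriv (\<lambda>w. F w $ j) z)" for i j
    unfolding derivG Gz by (simp add: power2_eq_square algebra_simps)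
  have "cmod (c ^ 2 * w) ^ 2 = cmod c ^ 4 * cmod w ^ 2" for c w
    by (simp add: norm_mult norm_power power_mult_distrib flip: power_mult)
  then have num: "(\<Sum>(i, j)\<in>{(i, j). i < j}.
        (cmod (deriv (\<lambda>w. G w $ i) z * G z $ j - G z $ i * deriv (\<lambda>w. G w $ j) z))\<^sup>2) =
      cmod (c z) ^ 4 * (\<Sum>(i, j)\<in>{(i, j). i < j}.
        (cmod (deriv (\<lambda>w. F w $ i) z * F z $ j - F z $ i * deriv (\<lambda>w. F w $ j) z))\<^sup>2)"
    unfolding wronskian sum_distrib_left by (intro sum.cong) auto
  have "(\<Sum>j\<in>UNIV. (cmod (G z $ j))\<^sup>2) = (cmod (c z))\<^sup>2 * (\<Sum>j\<in>UNIV. (cmod (F z $ j))\<^sup>2)"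
    by (simp add: c(2) norm_mult power_mult_distrib sum_distrib_left)
  then have den: "(\<Sum>j\<in>UNIV. (cmod (G z $ j))\<^sup>2)\<^sup>2 =
      cmod (c z) ^ 4 * (\<Sum>j\<in>UNIV. (cmod (F z $ j))\<^sup>2)\<^sup>2"
    by (simp add: power_mult_distrib flip: power_mult)
  have "cmod (c z) ^ 4 \<noteq> 0"
    using c(1)[of z] by simp
  then show ?thesis
    unfolding fs_derivative_rep_def num den by (subst mult_divide_mult_cancel_left) auto
qed

lemma fs_derivative_eq: "reduced_rep F f \<Longrightarrow> fs_derivative f z = fs_derivative_rep F z"
  unfolding fs_derivative_def by (metis fs_derivative_rep_unique someI_ex)

definition brody_space ::
  "'k::{finite,linorder} proj_space set \<Rightarrow> (complex \<Rightarrow> 'k proj_space) set" where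
  "brody_space U = {f. holomorphic_curve f \<and> range f \<subseteq> U \<and> (\<forall>z. fs_derivative f z \<le> 1)}"

definition disc_dist ::
  "real \<Rightarrow> (complex \<Rightarrow> 'k::finite proj_space) \<Rightarrow> (complex \<Rightarrow> 'k proj_space) \<Rightarrow> real" where
  "disc_dist R f g = (SUP z \<in> cball 0 R. fs_dist (f z) (g z))"


section \<open>Mean dimension\<close>

text \<open>
  The library's \<open>simplicial_complex\<close> is finite and lives in a fixed Euclidean space, so its
  dimension is bounded by the type. Hence abstract complexes and their geometric realisation in
  barycentric coordinates, with the weak topology.
\<close>

definition abstract_complex :: "'v set set \<Rightarrow> bool" where
  "abstract_complex K \<longleftrightarrow> (\<forall>\<sigma>\<in>K. finite \<sigma> \<and> \<sigma> \<noteq> {} \<and> (\<forall>\<tau>. \<tau> \<subseteq> \<sigma> \<and> \<tau> \<noteq> {} \<longrightarrow> \<tau> \<in> K))"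

definition complex_dim :: "'v set set \<Rightarrow> nat \<Rightarrow> bool" where
  "complex_dim K k \<longleftrightarrow> (\<forall>\<sigma>\<in>K. card \<sigma> \<le> k + 1) \<and> (\<exists>\<sigma>\<in>K. card \<sigma> = k + 1)"

definition geom_simplex :: "'v set \<Rightarrow> ('v \<Rightarrow> real) set" where
  "geom_simplex \<sigma> = {t. (\<forall>v. 0 \<le> t v) \<and> (\<forall>v. v \<notin> \<sigma> \<longrightarrow> t v = 0) \<and> (\<Sum>v\<in>\<sigma>. t v) = 1}"

definition realization :: "'v set set \<Rightarrow> ('v \<Rightarrow> real) topology" where
  "realization K = topology (\<lambda>U. U \<subseteq> (\<Union>\<sigma>\<in>K. geom_simplex \<sigma>) \<and>
     (\<forall>\<sigma>\<in>K. openin (top_of_set (geom_simplex \<sigma>)) (U \<inter> geom_simplex \<sigma>)))"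

lemma openin_realization:
  "openin (realization K) U \<longleftrightarrow> U \<subseteq> (\<Union>\<sigma>\<in>K. geom_simplex \<sigma>) \<and>
     (\<forall>\<sigma>\<in>K. openin (top_of_set (geom_simplex \<sigma>)) (U \<inter> geom_simplex \<sigma>))"
proof -
  have *: "S \<inter> T \<inter> A = (S \<inter> A) \<inter> (T \<inter> A)" "\<Union>\<U> \<inter> A = (\<Union>U\<in>\<U>. U \<inter> A)"
    for S T A :: "('a \<Rightarrow> real) set" and \<U> by auto
  have "istopology (\<lambda>U. U \<subseteq> (\<Union>\<sigma>\<in>K. geom_simplex \<sigma>) \<and>
     (\<forall>\<sigma>\<in>K. openin (top_of_set (geom_simplex \<sigma>)) (U \<inter> geom_simplex \<sigma>)))"
    unfolding istopology_def
  proof (intro conjI allI impI ballI)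
    fix S T \<sigma>
    assume S: "S \<subseteq> (\<Union>\<sigma>\<in>K. geom_simplex \<sigma>) \<and>
        (\<forall>\<sigma>\<in>K. openin (top_of_set (geom_simplex \<sigma>)) (S \<inter> geom_simplex \<sigma>))"
      and T: "T \<subseteq> (\<Union>\<sigma>\<in>K. geom_simplex \<sigma>) \<and>
        (\<forall>\<sigma>\<in>K. openin (top_of_set (geom_simplex \<sigma>)) (T \<inter> geom_simplex \<sigma>))"
    show "S \<inter> T \<subseteq> (\<Union>\<sigma>\<in>K. geom_simplex \<sigma>)"
      using S by blast
    show "openin (top_of_set (geom_simplex \<sigma>)) (S \<inter> T \<inter> geom_simplex \<sigma>)" if "\<sigma> \<in> K"
      by (subst *(1), rule openin_Int) (use S T that in auto)
  next
    fix \<U> \<sigma>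
    assume U: "\<forall>U\<in>\<U>. U \<subseteq> (\<Union>\<sigma>\<in>K. geom_simplex \<sigma>) \<and>
        (\<forall>\<sigma>\<in>K. openin (top_of_set (geom_simplex \<sigma>)) (U \<inter> geom_simplex \<sigma>))"
    show "\<Union>\<U> \<subseteq> (\<Union>\<sigma>\<in>K. geom_simplex \<sigma>)"
      using U by blast
    show "openin (top_of_set (geom_simplex \<sigma>)) (\<Union>\<U> \<inter> geom_simplex \<sigma>)" if "\<sigma> \<in> K"
      unfolding *(2) using U that by (intro openin_Union) auto
  qed
  then show ?thesis
    by (simp add: realization_def topology_inverse')
qed

text \<open>
  Taking the vertices in the type of the space itself is no restriction: the image of \<open>X\<close> meets
  the interiors of at most \<open>|X|\<close> simplices, and a finite \<open>X\<close> maps injectively to a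
  zero-dimensional complex. The value is \<open>\<infinity>\<close> if there is no suitable map to a
  finite-dimensional complex.
\<close>

definition widim :: "real \<Rightarrow> 'a set \<Rightarrow> ('a \<Rightarrow> 'a \<Rightarrow> real) \<Rightarrow> enat" where
  "widim \<epsilon> X d = (INF k \<in> {k. \<exists>(K :: 'a set set) \<phi>.
      abstract_complex K \<and> complex_dim K k \<and>
      continuous_map (Metric_space.mtopology X d) (realization K) \<phi> \<and>
      (\<forall>x\<in>X. \<forall>y\<in>X. \<phi> x = \<phi> y \<longrightarrow> d x y \<le> \<epsilon>)}. enat k)"

definition widim_growth :: "(complex \<Rightarrow> 'k::finite proj_space) set \<Rightarrow> real \<Rightarrow> ereal" where
  "widim_growth M \<epsilon> =
     Limsup at_top (\<lambda>R. ereal_of_enat (widim \<epsilon> M (disc_dist R)) / ereal (pi * R\<^sup>2))"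

definition mean_dimension :: "(complex \<Rightarrow> 'k::finite proj_space) set \<Rightarrow> ereal" where
  "mean_dimension M = Lim (at_right 0) (widim_growth M)"

lemma widim_antimono: "\<epsilon> \<le> \<delta> \<Longrightarrow> widim \<delta> X d \<le> widim \<epsilon> X d"
  unfolding widim_def by (rule INF_superset_mono) (auto, meson order_trans)

lemma widim_growth_antimono:
  assumes "\<epsilon> \<le> \<delta>"
  shows "widim_growth M \<delta> \<le> widim_growth M \<epsilon>"
  unfolding widim_growth_def
proof (rule Limsup_mono)
  show "\<forall>\<^sub>F R in at_top. ereal_of_enat (widim \<delta> M (disc_dist R)) / ereal (pi * R\<^sup>2)
      \<le> ereal_of_enat (widim \<epsilon> M (disc_dist R)) / ereal (pi * R\<^sup>2)"
    using eventually_gt_at_top[of 0]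
    by eventually_elim (intro ereal_divide_right_mono, simp_all add: widim_antimono assms)
qed

text \<open>The limit in \<open>mean_dimension\<close> always exists.\<close>

lemma tendsto_mean_dimension: "(widim_growth M \<longlongrightarrow> mean_dimension M) (at_right 0)"
proof -
  have "(widim_growth M \<longlongrightarrow> (SUP \<epsilon>\<in>{0<..}. widim_growth M \<epsilon>)) (at_right 0)"
  proof (rule order_tendstoI)
    fix a assume "a < (SUP \<epsilon>\<in>{0<..}. widim_growth M \<epsilon>)"
    then obtain \<epsilon> where \<epsilon>: "\<epsilon> > 0" "a < widim_growth M \<epsilon>"
      by (auto simp: less_SUP_iff)
    have less: "a < widim_growth M \<delta>" if "\<delta> \<in> {0<..<\<epsilon>}" for \<delta>
      using less_le_trans[OF \<epsilon>(2) widim_growth_antimono[of \<delta> \<epsilon> M]] that by simp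
    show "\<forall>\<^sub>F \<delta> in at_right 0. a < widim_growth M \<delta>"
      using eventually_at_right_real[OF \<epsilon>(1)] by (rule eventually_mono) (rule less)
  next
    fix a assume a: "(SUP \<epsilon>\<in>{0<..}. widim_growth M \<epsilon>) < a"
    have less: "widim_growth M \<delta> < a" if "\<delta> \<in> {0<..<1}" for \<delta> :: real
      using le_less_trans[OF SUP_upper a, of \<delta>] that by simp
    show "\<forall>\<^sub>F \<delta> in at_right 0. widim_growth M \<delta> < a"
      using eventually_at_right_real[OF zero_less_one] by (rule eventually_mono) (rule less)
  qed
  then show ?thesis
    unfolding mean_dimension_def
    by (subst tendsto_Lim[OF trivial_limit_at_right_real]) assumption+
qed

end

theory Submission
  imports Defs "HOL-Complex_Analysis.Complex_Analysis" "HOL-Library.Function_Algebras"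
begin

unbundle no Formal_Power_Series.fps_syntax

text \<open>
  Only finitely many points of \<open>V\<close> lie on all the \<open>n\<close> hypersurfaces. Normalise a homogeneous
  representation \<open>G\<^sub>i\<close> of a Brody curve \<open>f\<close> by \<open>Q\<^sub>i(G\<^sub>i) = 1\<close>. Then \<open>w\<^sub>i = ln \<parallel>G\<^sub>i\<parallel>\<close> is bounded below and
  \<open>\<Delta>w\<^sub>i = 2\<parallel>f'\<parallel>\<^sup>2 \<le> 2\<close>. On a square where all the \<open>w\<^sub>i\<close> are large, \<open>f\<close> stays close to one of those finitely
  many points, so \<open>f\<close> can oscillate only on squares where some \<open>w\<^sub>i\<close> is at most a constant \<open>T\<close>. If such
  oscillating squares had positive density, some large box of side \<open>r\<close> would have a positive density of
  them and would also meet \<open>{w\<^sub>i \<le> T}\<close> in each of its subboxes of side \<open>r / k\<close>. As \<open>\<Delta>w\<^sub>i \<le> 2\<close>, the mean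
  of \<open>w\<^sub>i\<close> over the box is then \<open>O(T + r\<^sup>2 / k\<^sup>2)\<close>; testing \<open>\<Delta>w\<^sub>i\<close> against a bump function bounds the energy of
  \<open>f\<close> in the box by the same quantity, contradicting the energy \<open>\<ge> c r\<^sup>2\<close> of the oscillating squares for
  large \<open>k\<close> and \<open>r\<close>. Hence all but \<open>o(R\<^sup>2)\<close> squares of side \<open>L\<close> in the disc of radius \<open>R\<close> carry small
  oscillation, uniformly in \<open>f\<close>. One value of \<open>f\<close> per square, together with its values on a fine grid in
  the few oscillating squares, determines \<open>f\<close> up to \<open>\<epsilon>\<close>, so the width dimension is \<open>O(R\<^sup>2 / L\<^sup>2)\<close>
  with \<open>L\<close> arbitrary.
\<close>

section \<open>Noetherian subrings and the dimension zero case\<close>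

text \<open>The obstacle is that the oscillating squares vary with \<open>f\<close>, while
  \<open>widim\<close> asks for a single complex that receives all curves. So every grid value in
  every square becomes a coordinate, as a soft-thresholded difference from the value at a reference
  point of the square; it is 0 unless the square oscillates. In the Kuhn complex an integral
  coordinate costs no dimension, so the dimension is governed by the active coordinates of one curve
  at a time, not by their union over all curves. The coordinates are entries of the orthogonal
  projector onto the line \<open>f z\<close>: they do not depend on a homogeneous representation and
  are 2-Lipschitz along a Brody curve, so they serve the energy estimate and the map to the complex
  alike. All \<open>w\<^sub>i\<close> have the same Laplacian, since representations of
  \<open>f\<close> differ by a zero-free entire factor; the density argument runs for one
  \<open>i\<close> at a time, with constants independent of \<open>f\<close>. Dimension is defined
  by chains of irreducible closed sets; that dimension at most 0 means finitely many points rests on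
  the descending chain condition, hence on Hilbert's basis theorem.\<close>

definition subring_of :: "'a::comm_ring_1 set \<Rightarrow> bool" where
  "subring_of R \<longleftrightarrow> 0 \<in> R \<and> 1 \<in> R \<and> (\<forall>x\<in>R. \<forall>y\<in>R. x + y \<in> R \<and> x * y \<in> R \<and> - x \<in> R)"

definition lin_span :: "'a::comm_ring_1 set \<Rightarrow> (nat \<Rightarrow> 'a) \<Rightarrow> nat \<Rightarrow> 'a set" where
  "lin_span R a n = {\<Sum>j<n. r j * a j | r. \<forall>j<n. r j \<in> R}"

text \<open>This is the ascending chain condition on ideals, phrased for generators: a sequence
  violating it would generate strictly growing ideals. Rings are subsets of an ambient ring because
  coordinate functions will be adjoined one at a time inside one fixed ring of functions.\<close>

definition noetherian_subring :: "'a::comm_ring_1 set \<Rightarrow> bool" where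
  "noetherian_subring R \<longleftrightarrow> (\<forall>a. range a \<subseteq> R \<longrightarrow> (\<exists>n. a n \<in> lin_span R a n))"

lemma subring_of_sum: "subring_of R \<Longrightarrow> (\<And>i. i \<in> A \<Longrightarrow> f i \<in> R) \<Longrightarrow> sum f A \<in> R"
  by (induction A rule: infinite_finite_induct) (auto simp: subring_of_def)

lemma subring_of_power: "subring_of R \<Longrightarrow> x \<in> R \<Longrightarrow> x ^ n \<in> R"
  by (induction n) (auto simp: subring_of_def)

lemma lin_span_add:
  assumes "subring_of R" "x \<in> lin_span R a n" "y \<in> lin_span R a n"
  shows "x + y \<in> lin_span R a n"
proof -
  obtain r s where "x = (\<Sum>j<n. r j * a j)" "\<forall>j<n. r j \<in> R" "y = (\<Sum>j<n. s j * a j)" "\<forall>j<n. s j \<in> R"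
    using assms by (auto simp: lin_span_def)
  then show ?thesis
    using assms(1) unfolding lin_span_def
    by (auto simp: subring_of_def sum.distrib[symmetric] distrib_right[symmetric]
        intro!: exI[of _ "\<lambda>j. r j + s j"])
qed

lemma lin_span_mult:
  assumes "subring_of R" "x \<in> lin_span R a n" "c \<in> R"
  shows "c * x \<in> lin_span R a n"
proof -
  obtain r where "x = (\<Sum>j<n. r j * a j)" "\<forall>j<n. r j \<in> R"
    using assms by (auto simp: lin_span_def)
  then show ?thesis
    using assms(1,3) unfolding lin_span_def
    by (auto simp: subring_of_def sum_distrib_left mult.assoc intro!: exI[of _ "\<lambda>j. c * r j"])
qed

lemma lin_span_zero: "subring_of R \<Longrightarrow> 0 \<in> lin_span R a n"
  unfolding lin_span_def by (auto intro!: exI[of _ "\<lambda>_. 0"] simp: subring_of_def)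

lemma lin_span_diff:
  assumes "subring_of R" "x \<in> lin_span R a n" "y \<in> lin_span R a n"
  shows "x - y \<in> lin_span R a n"
proof -
  have "(-1) * y \<in> lin_span R a n"
    using assms by (intro lin_span_mult) (auto simp: subring_of_def)
  then show ?thesis
    using lin_span_add[OF assms(1,2)] by force
qed

lemma lin_span_sum:
  "subring_of R \<Longrightarrow> (\<And>i. i \<in> A \<Longrightarrow> f i \<in> lin_span R a n) \<Longrightarrow> sum f A \<in> lin_span R a n"
  by (induction A rule: infinite_finite_induct) (auto intro: lin_span_zero lin_span_add)

lemma lin_span_base:
  assumes "subring_of R" "j < n"
  shows "a j \<in> lin_span R a n"
  unfolding lin_span_def
  using assms by (auto intro!: exI[of _ "\<lambda>i. if i = j then 1 else 0"] simp: subring_of_def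
      if_distrib[of "\<lambda>x. x * _"] cong: if_cong)

lemma lin_span_subset:
  assumes "subring_of R" "\<And>j. j < n \<Longrightarrow> b j \<in> lin_span R a m"
  shows "lin_span R b n \<subseteq> lin_span R a m"
proof
  fix x assume "x \<in> lin_span R b n"
  then obtain r where r: "x = (\<Sum>j<n. r j * b j)" "\<forall>j<n. r j \<in> R"
    by (auto simp: lin_span_def)
  show "x \<in> lin_span R a m"
    unfolding r(1) using r(2) assms by (intro lin_span_sum lin_span_mult) auto
qed

lemma lin_span_mono: "subring_of R \<Longrightarrow> n \<le> m \<Longrightarrow> lin_span R a n \<subseteq> lin_span R a m"
  by (rule lin_span_subset) (auto intro: lin_span_base)

lemma subring_of_poly:
  assumes "subring_of R"
  shows "subring_of {p. \<forall>i. coeff p i \<in> R}"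
  unfolding subring_of_def
proof (intro conjI ballI)
  show "0 \<in> {p. \<forall>i. coeff p i \<in> R}" "1 \<in> {p. \<forall>i. coeff p i \<in> R}"
    using assms by (auto simp: subring_of_def coeff_pCons one_pCons split: nat.split)
  fix p q assume "p \<in> {p. \<forall>i. coeff p i \<in> R}" "q \<in> {p. \<forall>i. coeff p i \<in> R}"
  then have pq: "coeff p i \<in> R" "coeff q i \<in> R" for i by auto
  show "p + q \<in> {p. \<forall>i. coeff p i \<in> R}" "- p \<in> {p. \<forall>i. coeff p i \<in> R}"
    using assms pq by (auto simp: subring_of_def)
  have "coeff p i * coeff q j \<in> R" for i j
    using assms pq by (auto simp: subring_of_def)
  then show "p * q \<in> {p. \<forall>i. coeff p i \<in> R}"
    by (auto simp: coeff_mult intro!: subring_of_sum[OF assms])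
qed

text \<open>Hilbert's basis theorem: when generators are chosen successively of minimal degree, a relation between
  their leading coefficients yields a further element of smaller degree.\<close>

lemma noetherian_subring_poly:
  fixes R :: "'a::comm_ring_1 set"
  assumes R: "subring_of R" and N: "noetherian_subring R"
  shows "noetherian_subring {p. \<forall>i. coeff p i \<in> R}"
proof (rule ccontr)
  define S where "S = {p. \<forall>i. coeff p i \<in> R}"
  note S = subring_of_poly[OF R, folded S_def]
  assume "\<not> noetherian_subring {p. \<forall>i. coeff p i \<in> R}"
  then obtain f where f: "range f \<subseteq> S" "\<And>n. f n \<notin> lin_span S f n"
    by (auto simp: noetherian_subring_def S_def)
  \<comment> \<open>The ideal generated by a counterexample. No \<open>lin_span S f m\<close>
    exhausts it, since \<open>f m\<close> lies outside, so a further generator can always be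
    found.\<close>
  define I where "I = (\<Union>m. lin_span S f m)"
  have I_ex: "\<exists>m. \<forall>x\<in>A. x \<in> lin_span S f m" if "finite A" "A \<subseteq> I" for A
    using that
  proof (induction A)
    case (insert x A)
    then obtain m m' where "\<forall>x\<in>A. x \<in> lin_span S f m" "x \<in> lin_span S f m'"
      by (auto simp: I_def)
    then show ?case
      using lin_span_mono[OF S, of m "max m m'" f] lin_span_mono[OF S, of m' "max m m'" f]
      by (auto intro!: exI[of _ "max m m'"])
  qed auto
  have IS: "I \<subseteq> S"
  proof -
    have "(\<Sum>j<m. r j * f j) \<in> S" if "\<forall>j<m. r j \<in> S" for m r
      using that f(1) S by (intro subring_of_sum[OF S]) (auto simp: subring_of_def)
    then show ?thesis by (auto simp: I_def lin_span_def)
  qed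
  \<comment> \<open>The generators are chosen anew from \<open>I\<close>, because the given sequence
    \<open>f\<close> need not be ordered by degree.\<close>
  define P where "P g m r \<longleftrightarrow> r \<in> I - lin_span S g m \<and>
      (\<forall>r'\<in>I - lin_span S g m. degree r \<le> degree r')" for g m r
  have "\<exists>g. \<forall>m. P g m (g m)"
  proof (rule dependent_wellorder_choice)
    fix r :: "'a poly" and g h :: "nat \<Rightarrow> 'a poly" and m assume gh: "\<And>y. y < m \<Longrightarrow> g y = h y"
    have "lin_span S g m = lin_span S h m"
      unfolding lin_span_def using gh by (metis (no_types, lifting) lessThan_iff sum.cong)
    then show "P g m r = P h m r" by (simp add: P_def)
  next
    fix m and g :: "nat \<Rightarrow> 'a poly" assume g: "\<And>y. y < m \<Longrightarrow> P g y (g y)"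
    then have "g ` {..<m} \<subseteq> I" by (auto simp: P_def)
    then obtain M where M: "\<forall>x\<in>g ` {..<m}. x \<in> lin_span S f M"
      using I_ex[of "g ` {..<m}"] by auto
    then have "lin_span S g m \<subseteq> lin_span S f M"
      by (intro lin_span_subset[OF S]) auto
    then have "f M \<notin> lin_span S g m" using f(2) by auto
    moreover have "f M \<in> I"
      unfolding I_def using lin_span_base[OF S, of M "Suc M" f] by auto
    ultimately have "f M \<in> I - lin_span S g m" by auto
    then show "\<exists>r. P g m r"
      unfolding P_def using ex_has_least_nat[of "\<lambda>r. r \<in> I - lin_span S g m" "f M" degree] by blast
  qed
  then obtain g where g: "\<And>m. P g m (g m)" by auto
  have gI: "g m \<in> I" "g m \<notin> lin_span S g m" for m using g[of m] by (auto simp: P_def)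
  have deg: "degree (g j) \<le> degree (g m)" if "j \<le> m" for j m
    using g[of j] gI[of m] lin_span_mono[OF S that, of g] by (auto simp: P_def)
  have "range (\<lambda>m. lead_coeff (g m)) \<subseteq> R"
    using gI(1) IS by (auto simp: S_def)
  then obtain m where "lead_coeff (g m) \<in> lin_span R (\<lambda>m. lead_coeff (g m)) m"
    using N unfolding noetherian_subring_def by blast
  then obtain r where r: "lead_coeff (g m) = (\<Sum>j<m. r j * lead_coeff (g j))" "\<And>j. j < m \<Longrightarrow> r j \<in> R"
    by (auto simp: lin_span_def)
  define t where "t = (\<Sum>j<m. monom (r j) (degree (g m) - degree (g j)) * g j)"
  define h where "h = g m - t"
  have monS: "monom (r j) i \<in> S" if "j < m" for i j
    using r(2)[OF that] R by (auto simp: S_def subring_of_def)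
  have t1: "t \<in> lin_span S g m"
    unfolding t_def using monS by (intro lin_span_sum[OF S] lin_span_mult[OF S] lin_span_base[OF S]) auto
  obtain M where M: "\<forall>x\<in>g ` {..m}. x \<in> lin_span S f M"
    using I_ex[of "g ` {..m}"] gI by auto
  have "t \<in> lin_span S f M"
    using t1 lin_span_subset[OF S, of m g f M] M by auto
  then have "h \<in> lin_span S f M"
    unfolding h_def using M by (intro lin_span_diff[OF S]) auto
  then have hI: "h \<in> I" by (auto simp: I_def)
  have hn: "h \<notin> lin_span S g m"
  proof
    assume "h \<in> lin_span S g m"
    then have "h + t \<in> lin_span S g m" using t1 by (rule lin_span_add[OF S])
    then show False using gI(2)[of m] by (simp add: h_def)
  qed
  have le: "degree (g m) \<le> degree h"
    using g[of m] hI hn by (auto simp: P_def)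
  have ct: "coeff t (degree (g m)) = lead_coeff (g m)"
    unfolding t_def r(1) coeff_sum
  proof (rule sum.cong[OF refl])
    fix j assume "j \<in> {..<m}"
    then have "degree (g j) \<le> degree (g m)" using deg by auto
    then show "coeff (monom (r j) (degree (g m) - degree (g j)) * g j) (degree (g m)) =
        r j * lead_coeff (g j)"
      by (simp add: coeff_monom_mult)
  qed
  have dt: "degree t \<le> degree (g m)"
    unfolding t_def
  proof (rule degree_sum_le)
    fix j assume "j \<in> {..<m}"
    then have "degree (g j) \<le> degree (g m)" using deg by auto
    then show "degree (monom (r j) (degree (g m) - degree (g j)) * g j) \<le> degree (g m)"
      using degree_mult_le[of "monom (r j) (degree (g m) - degree (g j))" "g j"]
        degree_monom_le[of "r j" "degree (g m) - degree (g j)"] by linarith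
  qed auto
  have "degree h \<le> degree (g m)"
    unfolding h_def using dt by (intro degree_diff_le) auto
  with le have "degree h = degree (g m)" by simp
  moreover have "coeff h (degree (g m)) = 0"
    by (simp add: h_def ct)
  ultimately have "h = 0" by (metis leading_coeff_0_iff)
  then show False using hn lin_span_zero[OF S] by auto
qed

lemma noetherian_subring_image:
  assumes N: "noetherian_subring S"
    and h0: "h 0 = 0" and h: "\<And>x y. h (x + y) = h x + h y" "\<And>x y. h (x * y) = h x * h y"
  shows "noetherian_subring (h ` S)"
  unfolding noetherian_subring_def
proof (intro allI impI)
  fix a :: "nat \<Rightarrow> _" assume "range a \<subseteq> h ` S"
  then have "\<forall>n. \<exists>b. b \<in> S \<and> a n = h b" by auto
  then obtain b where b: "\<And>n. b n \<in> S" "\<And>n. a n = h (b n)" by metis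
  then obtain n r where r: "b n = (\<Sum>j<n. r j * b j)" "\<forall>j<n. r j \<in> S"
    using N unfolding noetherian_subring_def lin_span_def by blast
  have hs: "h (sum f A) = (\<Sum>j\<in>A. h (f j))" for f and A :: "nat set"
    by (induction A rule: infinite_finite_induct) (auto simp: h0 h)
  have "a n = (\<Sum>j<n. h (r j) * a j)"
    unfolding b(2) r(1) hs h(2) ..
  then show "\<exists>n. a n \<in> lin_span (h ` S) a n"
    unfolding lin_span_def using r(2)
    by (intro exI[of _ n] CollectI exI[of _ "\<lambda>j. h (r j)"]) auto
qed

lemma subring_of_image:
  assumes S: "subring_of S"
    and h0: "h 0 = 0" "h 1 = 1" and h: "\<And>x y. h (x + y) = h x + h y" "\<And>x y. h (x * y) = h x * h y"
  shows "subring_of (h ` S)"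
proof -
  have "h (- x) = - h x" for x
    using h(1)[of x "- x"] h0(1) by (simp add: eq_neg_iff_add_eq_0 add.commute)
  then have "- h x \<in> h ` S" if "x \<in> S" for x
    using that S unfolding subring_of_def by (metis imageI)
  moreover have "0 \<in> h ` S" "1 \<in> h ` S"
    using S h0 unfolding subring_of_def by (metis imageI)+
  moreover have "h x + h y \<in> h ` S" "h x * h y \<in> h ` S" if "x \<in> S" "y \<in> S" for x y
    using that S h unfolding subring_of_def by (metis imageI)+
  ultimately show ?thesis by (auto simp: subring_of_def)
qed

text \<open>\<open>S\<close> is the ring generated by \<open>R\<close> and \<open>t\<close>, the
  image of the polynomials over \<open>R\<close> under evaluation at \<open>t\<close>; both
  properties pass along this homomorphism.\<close>

lemma noetherian_adjoin:
  fixes R :: "'a::comm_ring_1 set"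
  assumes R: "subring_of R" and N: "noetherian_subring R"
  obtains S where "subring_of S" "noetherian_subring S" "R \<subseteq> S" "t \<in> S"
proof
  let ?P = "{p. \<forall>i. coeff p i \<in> R}"
  let ?h = "\<lambda>p. poly p t"
  show "subring_of (?h ` ?P)"
    by (rule subring_of_image[OF subring_of_poly[OF R]]) auto
  show "noetherian_subring (?h ` ?P)"
    by (rule noetherian_subring_image[OF noetherian_subring_poly[OF R N]]) auto
  show "R \<subseteq> ?h ` ?P"
  proof
    fix x assume "x \<in> R"
    then show "x \<in> ?h ` ?P"
      using R by (intro image_eqI[of _ _ "[:x:]"]) (auto simp: subring_of_def coeff_pCons split: nat.split)
  qed
  show "t \<in> ?h ` ?P"
    using R by (intro image_eqI[of _ _ "[:0, 1:]"]) (auto simp: subring_of_def coeff_pCons split: nat.split)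
qed

text \<open>Adjoining the coordinates one by one to the constant functions reduces polynomials in
  several variables to repeated use of the one-variable basis theorem.\<close>

lemma noetherian_coordinates:
  obtains S :: "(complex ^ 'k::finite \<Rightarrow> complex) set"
  where "subring_of S" "noetherian_subring S" "\<And>c. (\<lambda>_. c) \<in> S" "\<And>i. (\<lambda>x. x $ i) \<in> S"
proof -
  have "\<exists>S :: (complex ^ 'k::finite \<Rightarrow> complex) set. subring_of S \<and> noetherian_subring S \<and>
      (\<forall>c. (\<lambda>_. c) \<in> S) \<and> (\<forall>i\<in>A. (\<lambda>x. x $ i) \<in> S)" if "finite A" for A :: "'k set"
    using that
  proof (induction A)
    case empty
    let ?C = "{\<lambda>_::complex ^ 'k. c | c::complex. True}"
    have "subring_of ?C"
      unfolding subring_of_def by (auto simp: func_plus func_times func_zero func_one fun_Compl_def)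
    moreover have "noetherian_subring ?C"
      unfolding noetherian_subring_def
    proof (intro allI impI)
      fix a :: "nat \<Rightarrow> complex ^ 'k \<Rightarrow> complex" assume a: "range a \<subseteq> ?C"
      then have "\<forall>n. \<exists>c. a n = (\<lambda>_. c)" by blast
      then obtain c where c: "\<And>n. a n = (\<lambda>_. c n)" by metis
      \<comment> \<open>The constants form a field: a zero first member lies in the empty span, and
        a nonzero one divides the second member.\<close>
      show "\<exists>n. a n \<in> lin_span ?C a n"
      proof (cases "c 0 = 0")
        case True
        then show ?thesis
          by (intro exI[of _ 0]) (auto simp: lin_span_def c func_zero)
      next
        case False
        then show ?thesis
          by (intro exI[of _ 1])
            (auto simp: lin_span_def c func_times intro!: exI[of _ "\<lambda>_ _. c 1 / c 0"])
      qed
    qed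
    ultimately show ?case by (intro exI[of _ ?C]) auto
  next
    case (insert i A)
    then obtain S :: "(complex ^ 'k \<Rightarrow> complex) set" where S: "subring_of S" "noetherian_subring S"
      "\<forall>c. (\<lambda>_. c) \<in> S" "\<forall>i\<in>A. (\<lambda>x. x $ i) \<in> S" by auto
    obtain S' where "subring_of S'" "noetherian_subring S'" "S \<subseteq> S'" "(\<lambda>x. x $ i) \<in> S'"
      using noetherian_adjoin[OF S(1,2), of "\<lambda>x. x $ i"] by blast
    then show ?case using S by (intro exI[of _ S']) auto
  qed
  from this[of UNIV] obtain S :: "(complex ^ 'k \<Rightarrow> complex) set" where "subring_of S"
    "noetherian_subring S" "\<forall>c. (\<lambda>_. c) \<in> S" "\<forall>i\<in>UNIV. (\<lambda>x. x $ i) \<in> S" by auto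
  then show ?thesis using that[of S] by simp
qed

text \<open>The multipliers \<open>r j\<close> are kept as plain functions: the relation is used
  pointwise, to see that a common zero of the earlier polynomials is a zero of
  \<open>Q n\<close>.\<close>

lemma eval_poly_noetherian:
  fixes Q :: "nat \<Rightarrow> 'k::finite polynomial"
  shows "\<exists>n. \<exists>r. \<forall>x. eval_poly (Q n) x = (\<Sum>j<n. r j x * eval_poly (Q j) x)"
proof -
  obtain S :: "(complex ^ 'k::finite \<Rightarrow> complex) set" where
    S: "subring_of S" "noetherian_subring S" "\<And>c. (\<lambda>_. c) \<in> S" "\<And>i. (\<lambda>x. x $ i) \<in> S"
    using noetherian_coordinates by blast
  have mul: "f * g \<in> S" if "f \<in> S" "g \<in> S" for f g
    using S(1) that by (auto simp: subring_of_def)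
  have prd: "prod f A \<in> S" if "\<And>i. i \<in> A \<Longrightarrow> f i \<in> S" for f and A :: "'k set"
    using that
  proof (induction A rule: infinite_finite_induct)
    case (insert x F)
    then show ?case using mul[of "f x" "prod f F"] by (subst prod.insert) auto
  qed (use S in \<open>auto simp: subring_of_def\<close>)
  have sf: "sum f A = (\<lambda>x. \<Sum>i\<in>A. f i x)" for f :: "'i \<Rightarrow> complex ^ 'k \<Rightarrow> complex" and A
    by (induction A rule: infinite_finite_induct) (auto simp: func_plus func_zero)
  have pf: "prod f A = (\<lambda>x. \<Prod>i\<in>A. f i x)" for f :: "'k \<Rightarrow> complex ^ 'k \<Rightarrow> complex" and A
    by (induction A rule: infinite_finite_induct) (auto simp: func_times func_one)
  have pw: "f ^ n = (\<lambda>x. f x ^ n)" for f :: "complex ^ 'k \<Rightarrow> complex" and n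
    by (induction n) (auto simp: func_times func_one)
  have "eval_poly (Q n) \<in> S" for n
  proof -
    have "(\<Sum>m\<in>Poly_Mapping.keys (Q n). (\<lambda>_. Poly_Mapping.lookup (Q n) m) *
       (\<Prod>i\<in>UNIV. (\<lambda>x. x $ i) ^ Poly_Mapping.lookup m i)) \<in> S"
      by (intro subring_of_sum[OF S(1)] mul prd subring_of_power[OF S(1)] S)
    then show ?thesis
      by (simp add: eval_poly_def[abs_def] sf pf pw func_times)
  qed
  then have "range (\<lambda>n. eval_poly (Q n)) \<subseteq> S" by auto
  then obtain n where "eval_poly (Q n) \<in> lin_span S (\<lambda>n. eval_poly (Q n)) n"
    using S(2) unfolding noetherian_subring_def by blast
  then obtain r where "eval_poly (Q n) = (\<Sum>j<n. r j * eval_poly (Q j))"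
    by (auto simp: lin_span_def)
  then show ?thesis
    by (intro exI[of _ n] exI[of _ r]) (simp add: sf func_times)
qed


section \<open>Forms and Zariski closed sets in projective space\<close>

lemma proj_cases:
  obtains x where "x \<noteq> 0" "p = proj x"
  by (induction p rule: proj_space.abs_induct) (auto simp: proportional_def)

lemma eval_poly_superset:
  assumes "finite A" "Poly_Mapping.keys Q \<subseteq> A"
  shows "eval_poly Q x = (\<Sum>m\<in>A. Poly_Mapping.lookup Q m * (\<Prod>i\<in>UNIV. (x $ i) ^ Poly_Mapping.lookup m i))"
  unfolding eval_poly_def using assms
  by (intro sum.mono_neutral_left) (auto simp: in_keys_iff)

lemma eval_poly_diff: "eval_poly (P - Q) x = eval_poly P x - eval_poly Q x"
proof -
  let ?A = "Poly_Mapping.keys P \<union> Poly_Mapping.keys Q"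
  have "Poly_Mapping.keys (P - Q) \<subseteq> ?A"
    by (auto simp: in_keys_iff lookup_minus)
  then show ?thesis
    by (simp add: eval_poly_superset[of ?A] lookup_minus left_diff_distrib sum_subtractf)
qed

lemma eval_poly_linear:
  fixes x :: "complex ^ 'k::finite"
  shows "eval_poly (Poly_Mapping.single (Poly_Mapping.single i 1) c) x = c * x $ i"
proof -
  have "(\<Prod>j\<in>UNIV. (x $ j) ^ Poly_Mapping.lookup (Poly_Mapping.single i 1) j) =
      (\<Prod>j\<in>UNIV. if j = i then x $ j else 1)"
    by (intro prod.cong) (auto simp: lookup_single when_def)
  then show ?thesis
    by (subst eval_poly_superset[of "{Poly_Mapping.single i 1}"]) (auto simp: lookup_single when_def split: if_splits)
qed

lemma homogeneous_diff:
  assumes "homogeneous d P" "homogeneous d Q"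
  shows "homogeneous d (P - Q)"
proof -
  have "Poly_Mapping.keys (P - Q) \<subseteq> Poly_Mapping.keys P \<union> Poly_Mapping.keys Q"
    by (auto simp: in_keys_iff lookup_minus)
  then show ?thesis using assms unfolding homogeneous_def by blast
qed

lemma homogeneous_linear:
  "homogeneous 1 (Poly_Mapping.single (Poly_Mapping.single (i :: 'k::finite) 1) c)"
  by (auto simp: homogeneous_def lookup_single when_def)

lemma eval_poly_scale:
  assumes "homogeneous d Q"
  shows "eval_poly Q (c *s x) = c ^ d * eval_poly Q x"
proof -
  have "(\<Prod>i\<in>UNIV. ((c *s x) $ i) ^ Poly_Mapping.lookup m i) =
      c ^ d * (\<Prod>i\<in>UNIV. (x $ i) ^ Poly_Mapping.lookup m i)" if "m \<in> Poly_Mapping.keys Q" for m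
    using assms that by (auto simp: homogeneous_def power_mult_distrib prod.distrib power_sum)
  then show ?thesis
    unfolding eval_poly_def sum_distrib_left by (intro sum.cong) auto
qed

lemma proj_in_zeros_iff:
  assumes "homogeneous d Q" "x \<noteq> 0"
  shows "proj x \<in> zeros Q \<longleftrightarrow> eval_poly Q x = 0"
proof
  assume "proj x \<in> zeros Q"
  then obtain y where y: "y \<noteq> 0" "proj y = proj x" "eval_poly Q y = 0"
    by (auto simp: zeros_def)
  then obtain c where "x = c *s y"
    using proj_eq_iff[of y x] assms by auto
  then show "eval_poly Q x = 0"
    using y by (simp add: eval_poly_scale[OF assms(1)])
qed (use assms in \<open>auto simp: zeros_def\<close>)

text \<open>The linear forms \<open>L i j\<close>, that is $a_j x_i - a_i x_j$, vanish together
  exactly on the multiples of \<open>a\<close>. A one-element set has no proper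
  decomposition.\<close>

lemma projective_variety_point: "projective_variety {p}"
proof -
  obtain a where a: "a \<noteq> 0" "p = proj a" by (rule proj_cases)
  define L where "L i j = Poly_Mapping.single (Poly_Mapping.single i (1::nat)) (a $ j) -
      Poly_Mapping.single (Poly_Mapping.single j 1) (a $ i)" for i j
  have L: "homogeneous 1 (L i j)" "eval_poly (L i j) x = a $ j * x $ i - a $ i * x $ j" for i j x
    unfolding L_def by (rule homogeneous_diff[OF homogeneous_linear homogeneous_linear],
        simp only: eval_poly_diff eval_poly_linear)
  have "{p} = (\<Inter>Q\<in>range (\<lambda>(i, j). L i j). zeros Q)"
  proof (intro equalityI subsetI)
    fix q assume q: "q \<in> (\<Inter>Q\<in>range (\<lambda>(i, j). L i j). zeros Q)"
    obtain x where x: "x \<noteq> 0" "q = proj x" by (rule proj_cases)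
    have e: "a $ j * x $ i = a $ i * x $ j" for i j
      using q proj_in_zeros_iff[OF L(1)[of i j] x(1)] x(2) L(2)[of i j x] by auto
    obtain l where l: "a $ l \<noteq> 0" using a by (metis vec_eq_iff zero_index)
    have "x = (x $ l / a $ l) *s a"
      using e[of l] l by (simp add: vec_eq_iff field_simps)
    moreover from this x(1) have "x $ l / a $ l \<noteq> 0" by (metis vector_smult_lzero)
    ultimately have "proj a = proj x" using proj_eq_iff[OF a(1) x(1)] by blast
    then show "q \<in> {p}" using a x by simp
  next
    fix q assume "q \<in> {p}"
    then show "q \<in> (\<Inter>Q\<in>range (\<lambda>(i, j). L i j). zeros Q)"
      using a proj_in_zeros_iff[OF L(1) a(1)] by (auto simp: L(2))
  qed
  then have "zariski_closed {p}"
    unfolding zariski_closed_def using L(1)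
    by (intro exI[of _ "range (\<lambda>(i, j). L i j)"]) (auto intro!: exI[of _ 1] simp del: One_nat_def)
  moreover have "A = {p} \<or> B = {p}" if "{p} = A \<union> B" for A B
    using that by (metis Un_empty insert_not_empty subset_singletonD sup_ge1 sup_ge2)
  ultimately show ?thesis by (auto simp: projective_variety_def)
qed

text \<open>Each strict inclusion supplies a form \<open>Q n\<close> that vanishes on
  \<open>Z (Suc n)\<close> but not on \<open>Z n\<close>. By Noetherianity some \<open>Q n\<close>
  vanishes wherever all earlier ones do, and \<open>Z n\<close> is such a place.\<close>

lemma no_descending_zariski_chain:
  fixes Z :: "nat \<Rightarrow> 'k::finite proj_space set"
  assumes "\<And>n. zariski_closed (Z n)" "\<And>n. Z (Suc n) \<subset> Z n"
  shows False
proof -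
  have "\<exists>Q. (\<exists>d. homogeneous d Q) \<and> Z (Suc n) \<subseteq> zeros Q \<and> \<not> Z n \<subseteq> zeros Q" for n
  proof -
    obtain S where S: "\<forall>Q\<in>S. \<exists>d. homogeneous d Q" "Z (Suc n) = (\<Inter>Q\<in>S. zeros Q)"
      using assms(1)[of "Suc n"] by (auto simp: zariski_closed_def)
    obtain p where p: "p \<in> Z n" "p \<notin> Z (Suc n)" using assms(2) by blast
    then obtain Q where "Q \<in> S" "p \<notin> zeros Q" using S by auto
    then show ?thesis using S p by (intro exI[of _ Q]) auto
  qed
  then obtain Q where Q: "\<And>n. \<exists>d. homogeneous d (Q n)" "\<And>n. Z (Suc n) \<subseteq> zeros (Q n)"
    "\<And>n. \<not> Z n \<subseteq> zeros (Q n)" by metis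
  obtain n r where r: "\<And>x. eval_poly (Q n) x = (\<Sum>j<n. r j x * eval_poly (Q j) x)"
    using eval_poly_noetherian[of Q] by blast
  obtain p where p: "p \<in> Z n" "p \<notin> zeros (Q n)" using Q(3) by blast
  obtain x where x: "x \<noteq> 0" "p = proj x" by (rule proj_cases)
  have "eval_poly (Q j) x = 0" if "j < n" for j
  proof -
    have "Z n \<subseteq> Z (Suc j)"
      by (rule lift_Suc_antimono_le[of Z]) (use that assms(2) in auto)
    then have "proj x \<in> zeros (Q j)" using Q(2)[of j] p(1) x(2) by blast
    then show ?thesis using Q(1)[of j] proj_in_zeros_iff[of _ "Q j" x] x(1) by blast
  qed
  then have "eval_poly (Q n) x = 0" by (simp add: r)
  then show False using p x by (auto simp: zeros_def)
qed

text \<open>A minimal infinite closed subset is irreducible: if it is a union of two closed sets,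
  one of them is infinite and so is everything. Together with one of its points it forms a chain of
  length 1.\<close>

theorem finite_if_proj_dim_le_0:
  assumes P: "zariski_closed P" and dim: "proj_dim P \<le> 0"
  shows "finite P"
proof (rule ccontr)
  assume inf: "infinite P"
  define good where "good Z \<longleftrightarrow> zariski_closed Z \<and> Z \<subseteq> P \<and> infinite Z" for Z
  have "\<exists>Z. good Z \<and> (\<forall>Y. good Y \<longrightarrow> \<not> Y \<subset> Z)"
  proof (rule ccontr)
    assume "\<not> ?thesis"
    then have *: "\<exists>Y. good Y \<and> Y \<subset> Z" if "good Z" for Z using that by blast
    have "\<exists>Z. \<forall>n. good (Z n) \<and> Z (Suc n) \<subset> Z n"
    proof (rule dependent_nat_choice)
      show "\<exists>Z. good Z" using inf P by (auto simp: good_def)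
    qed (use * in blast)
    then obtain Z where Z: "\<forall>n. good (Z n) \<and> Z (Suc n) \<subset> Z n" by (rule exE)
    show False
      by (rule no_descending_zariski_chain[of Z]) (use Z in \<open>simp_all add: good_def\<close>)
  qed
  then obtain Z where Z: "zariski_closed Z" "Z \<subseteq> P" "infinite Z"
    and min: "\<And>Y. zariski_closed Y \<Longrightarrow> Y \<subseteq> P \<Longrightarrow> infinite Y \<Longrightarrow> \<not> Y \<subset> Z"
    by (auto simp: good_def)
  have "projective_variety Z"
    unfolding projective_variety_def
  proof (intro conjI allI impI)
    fix A B assume AB: "zariski_closed A \<and> zariski_closed B \<and> Z = A \<union> B"
    then have "infinite A \<or> infinite B" using Z by auto
    then show "A = Z \<or> B = Z" using min[of A] min[of B] AB Z by blast
  qed (use Z in auto)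
  obtain p where p: "p \<in> Z" using Z by fastforce
  define C where "C i = (if i = 0 then {p} else Z)" for i :: nat
  have "{p} \<noteq> Z" using Z(3) by (metis finite.emptyI finite_insert)
  then have "{p} \<subset> Z" using p by blast
  then have "(\<forall>i\<le>1. projective_variety (C i) \<and> C i \<subseteq> P) \<and> (\<forall>i<1. C i \<subset> C (Suc i))"
    using projective_variety_point[of p] \<open>projective_variety Z\<close> Z p by (auto simp: C_def)
  then have "ereal (real 1) \<le> proj_dim P"
    unfolding proj_dim_def by (intro SUP_upper CollectI exI[of _ C]) auto
  then have "ereal (real 1) \<le> 0" using dim by (rule order_trans)
  then show False by simp
qed

section \<open>Small maps into polyhedra\<close>

lemma closed_geom_simplex:
  assumes "finite \<sigma>"
  shows "closed (geom_simplex \<sigma>)"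
proof -
  have "geom_simplex \<sigma> = (\<Inter>v. {t. 0 \<le> t v}) \<inter> (\<Inter>v\<in>- \<sigma>. {t. t v = 0}) \<inter> {t. (\<Sum>v\<in>\<sigma>. t v) = 1}"
    by (auto simp: geom_simplex_def)
  moreover have "continuous_on UNIV (\<lambda>t::'a \<Rightarrow> real. t v)" for v
    by (rule continuous_on_product_coordinates)
  ultimately show ?thesis
    by (auto intro!: closed_Int closed_INT closed_Collect_le closed_Collect_eq continuous_intros)
qed

lemma topspace_realization: "topspace (realization K) = (\<Union>\<sigma>\<in>K. geom_simplex \<sigma>)"
proof -
  have "openin (realization K) (\<Union>\<sigma>\<in>K. geom_simplex \<sigma>)"
    unfolding openin_realization by (auto simp: Int_absorb1 SUP_upper)
  then show ?thesis
    by (metis openin_realization openin_subset openin_topspace subset_antisym)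
qed

text \<open>In a finite complex the complement of a weakly open set is a finite union of closed
  subsets of simplices, hence closed in the product topology. So continuity can be tested on
  barycentric coordinates.\<close>

lemma continuous_map_realization:
  assumes "finite K" "\<And>\<sigma>. \<sigma> \<in> K \<Longrightarrow> finite \<sigma>"
    and "f \<in> topspace T \<rightarrow> (\<Union>\<sigma>\<in>K. geom_simplex \<sigma>)"
    and "\<And>v. continuous_map T euclideanreal (\<lambda>x. f x v)"
  shows "continuous_map T (realization K) f"
  unfolding continuous_map_def
proof (intro conjI allI impI)
  show "f \<in> topspace T \<rightarrow> topspace (realization K)"
    using assms(3) by (simp add: topspace_realization)
  have cont: "continuous_map T euclidean f"
    unfolding euclidean_product_topology[symmetric]
    using assms(4) by (simp add: continuous_map_componentwise_UNIV)
  fix U assume U: "openin (realization K) U"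
  define C where "C \<sigma> = geom_simplex \<sigma> - U" for \<sigma>
  have "closed (C \<sigma>)" if "\<sigma> \<in> K" for \<sigma>
  proof -
    have "openin (top_of_set (geom_simplex \<sigma>)) (U \<inter> geom_simplex \<sigma>)"
      using U that by (auto simp: openin_realization)
    then have "closedin (top_of_set (geom_simplex \<sigma>)) (geom_simplex \<sigma> - U \<inter> geom_simplex \<sigma>)"
      by (metis closedin_diff closedin_topspace topspace_euclidean_subtopology)
    moreover have "geom_simplex \<sigma> - U \<inter> geom_simplex \<sigma> = C \<sigma>" by (auto simp: C_def)
    ultimately show ?thesis
      using closed_geom_simplex assms(2)[OF that] closedin_closed_trans by metis
  qed
  then have "open (- (\<Union>\<sigma>\<in>K. C \<sigma>))"
    using assms(1) by (intro open_Compl closed_UN) auto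
  then have "openin T {x \<in> topspace T. f x \<in> - (\<Union>\<sigma>\<in>K. C \<sigma>)}"
    using cont by (auto simp: continuous_map_def)
  moreover have "{x \<in> topspace T. f x \<in> - (\<Union>\<sigma>\<in>K. C \<sigma>)} = {x \<in> topspace T. f x \<in> U}"
    using assms(3) by (fastforce simp: C_def)
  ultimately show "openin T {x \<in> topspace T. f x \<in> U}" by simp
qed

lemma widim_0:
  assumes "\<And>x y. x \<in> X \<Longrightarrow> y \<in> X \<Longrightarrow> d x y \<le> \<epsilon>"
  shows "widim \<epsilon> X d = 0"
proof -
  define K :: "'a set set" where "K = {{undefined}}"
  define t :: "'a \<Rightarrow> real" where "t = (\<lambda>v. if v = undefined then 1 else 0)"
  have "abstract_complex K" "complex_dim K 0"
    by (auto simp: abstract_complex_def complex_dim_def K_def subset_singleton_iff)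
  moreover have "continuous_map (Metric_space.mtopology X d) (realization K) (\<lambda>_. t)"
    by (subst continuous_map_const) (auto simp: topspace_realization K_def geom_simplex_def t_def)
  ultimately have "widim \<epsilon> X d \<le> enat 0"
    unfolding widim_def using assms by (intro INF_lower CollectI exI[of _ K] exI[of _ "\<lambda>_. t"]) auto
  then show ?thesis by (simp add: zero_enat_def[symmetric])
qed

text \<open>
  The Kuhn triangulation of \<open>\<real>\<^sup>I\<close> into lattice simplices: the barycentric coordinate of \<open>x\<close> at the
  lattice point \<open>v\<close> is the measure of the set of shifts \<open>\<theta> \<in> [0, 1)\<close> with \<open>\<lfloor>x\<^sub>i + \<theta>\<rfloor> = v\<^sub>i\<close> for all \<open>i\<close>.
\<close>

definition kuhn_shifts :: "'i set \<Rightarrow> ('i \<Rightarrow> real) \<Rightarrow> ('i \<Rightarrow> int) \<Rightarrow> real set" where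
  "kuhn_shifts I x v = {\<theta> \<in> {0..<1}. \<forall>i\<in>I. \<lfloor>x i + \<theta>\<rfloor> = v i}"

definition kuhn_vertex :: "'i set \<Rightarrow> ('i \<Rightarrow> real) \<Rightarrow> real \<Rightarrow> 'i \<Rightarrow> int" where
  "kuhn_vertex I x \<theta> = (\<lambda>i. if i \<in> I then \<lfloor>x i + \<theta>\<rfloor> else 0)"

definition kuhn_coord :: "'i set \<Rightarrow> ('i \<Rightarrow> real) \<Rightarrow> ('i \<Rightarrow> int) \<Rightarrow> real" where
  "kuhn_coord I x v = measure lborel (kuhn_shifts I x v)"

lemma kuhn_shifts_eq:
  assumes "finite I"
  shows "kuhn_shifts I x v =
    {Max (insert 0 ((\<lambda>i. v i - x i) ` I)) ..< Min (insert 1 ((\<lambda>i. v i - x i + 1) ` I))}"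
proof -
  have "\<lfloor>x i + \<theta>\<rfloor> = v i \<longleftrightarrow> v i - x i \<le> \<theta> \<and> \<theta> < v i - x i + 1" for i \<theta>
    by (auto simp: floor_eq_iff)
  then show ?thesis using assms by (auto simp: kuhn_shifts_def)
qed

lemma kuhn_coord_eq:
  assumes "finite I"
  shows "kuhn_coord I x v =
    max 0 (Min (insert 1 ((\<lambda>i. v i - x i + 1) ` I)) - Max (insert 0 ((\<lambda>i. v i - x i) ` I)))"
  by (simp add: kuhn_coord_def kuhn_shifts_eq[OF assms] max_def)

lemma Max_image_close:
  fixes f g :: "'i \<Rightarrow> real"
  assumes "finite I" "\<And>i. i \<in> I \<Longrightarrow> \<bar>f i - g i\<bar> \<le> e" "0 \<le> e"
  shows "\<bar>Max (insert c (f ` I)) - Max (insert c (g ` I))\<bar> \<le> e"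
proof -
  have *: "Max (insert c (f ` I)) \<le> Max (insert c (g ` I)) + e"
    if fg: "\<And>i. i \<in> I \<Longrightarrow> \<bar>f i - g i\<bar> \<le> e" for f g :: "'i \<Rightarrow> real"
  proof (rule Max.boundedI)
    have M: "a \<le> Max (insert c (g ` I))" if "a \<in> insert c (g ` I)" for a
      using assms(1) that by (intro Max_ge) auto
    show "a \<le> Max (insert c (g ` I)) + e" if a: "a \<in> insert c (f ` I)" for a
    proof (cases "a = c")
      case True
      then show ?thesis using M[of c] assms(3) by simp
    next
      case False
      then obtain i where "i \<in> I" "a = f i" using a by auto
      then show ?thesis using M[of "g i"] fg[of i] by auto
    qed
  qed (use assms in auto)
  show ?thesis
    using *[of f g] *[of g f] assms(2) by (auto simp: abs_minus_commute abs_le_iff)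
qed

lemma Min_image_close:
  fixes f g :: "'i \<Rightarrow> real"
  assumes "finite I" "\<And>i. i \<in> I \<Longrightarrow> \<bar>f i - g i\<bar> \<le> e" "0 \<le> e"
  shows "\<bar>Min (insert c (f ` I)) - Min (insert c (g ` I))\<bar> \<le> e"
proof -
  have *: "Min (insert c (f ` I)) - e \<le> Min (insert c (g ` I))"
    if fg: "\<And>i. i \<in> I \<Longrightarrow> \<bar>f i - g i\<bar> \<le> e" for f g :: "'i \<Rightarrow> real"
  proof (rule Min.boundedI)
    have M: "Min (insert c (f ` I)) \<le> a" if "a \<in> insert c (f ` I)" for a
      using assms(1) that by (intro Min_le) auto
    show "Min (insert c (f ` I)) - e \<le> a" if a: "a \<in> insert c (g ` I)" for a
    proof (cases "a = c")
      case True
      then show ?thesis using M[of c] assms(3) by simp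
    next
      case False
      then obtain i where "i \<in> I" "a = g i" using a by auto
      then show ?thesis using M[of "f i"] fg[of i] by auto
    qed
  qed (use assms in auto)
  show ?thesis
    using *[of f g] *[of g f] assms(2) by (auto simp: abs_minus_commute abs_le_iff)
qed

text \<open>The coordinate is the length of an interval whose two endpoints each move by at most
  \<open>e\<close>.\<close>

lemma kuhn_coord_close:
  assumes "finite I" "\<And>i. i \<in> I \<Longrightarrow> \<bar>x i - y i\<bar> \<le> e" "0 \<le> e"
  shows "\<bar>kuhn_coord I x v - kuhn_coord I y v\<bar> \<le> 2 * e"
  using Max_image_close[OF assms(1), of "\<lambda>i. v i - x i" "\<lambda>i. v i - y i" e 0]
    Min_image_close[OF assms(1), of "\<lambda>i. v i - x i + 1" "\<lambda>i. v i - y i + 1" e 1] assms(2,3)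
  unfolding kuhn_coord_eq[OF assms(1)] by (auto simp: abs_minus_commute)

lemma kuhn_coord_posD:
  assumes "kuhn_coord I x v > 0"
  obtains \<theta> where "0 \<le> \<theta>" "\<theta> < 1" "\<And>i. i \<in> I \<Longrightarrow> v i = \<lfloor>x i + \<theta>\<rfloor>"
proof -
  have "kuhn_shifts I x v \<noteq> {}"
    using assms by (auto simp: kuhn_coord_def)
  then show ?thesis using that by (auto simp: kuhn_shifts_def)
qed

text \<open>The vertex for the shift \<theta> is determined by the set \<open>J \<theta>\<close> of
  coordinates it pushes past the next integer. These sets grow with \<theta> and never contain an
  integral coordinate, so they form a chain of subsets of \<open>N\<close>, and such a chain has at
  most \<open>card N + 1\<close> members.\<close>

lemma card_kuhn_vertices:
  assumes "finite I"
  shows "finite (kuhn_vertex I x ` {0..<1})"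
    "card (kuhn_vertex I x ` {0..<1}) \<le> card {i \<in> I. x i \<notin> \<int>} + 1"
proof -
  define N where "N = {i \<in> I. x i \<notin> \<int>}"
  define J where "J \<theta> = {i \<in> I. frac (x i) + \<theta> \<ge> 1}" for \<theta>
  have fN: "finite N" using assms by (auto simp: N_def)
  have fl: "\<lfloor>x i + \<theta>\<rfloor> = (if frac (x i) + \<theta> \<ge> 1 then \<lfloor>x i\<rfloor> + 1 else \<lfloor>x i\<rfloor>)" if "\<theta> \<in> {0..<1}" for \<theta> i
  proof (cases "frac (x i) + \<theta> \<ge> 1")
    case True
    then have "x i + \<theta> \<ge> of_int (\<lfloor>x i\<rfloor> + 1)" "x i + \<theta> < of_int (\<lfloor>x i\<rfloor> + 1) + 1"
      using that frac_lt_1[of "x i"] True unfolding frac_def atLeastLessThan_iff by auto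
    then have "\<lfloor>x i + \<theta>\<rfloor> = \<lfloor>x i\<rfloor> + 1" by (rule floor_unique)
    then show ?thesis using True by simp
  next
    case False
    then have "x i + \<theta> \<ge> of_int \<lfloor>x i\<rfloor>" "x i + \<theta> < of_int \<lfloor>x i\<rfloor> + 1"
      using that of_int_floor_le[of "x i"] False unfolding frac_def atLeastLessThan_iff by linarith+
    then have "\<lfloor>x i + \<theta>\<rfloor> = \<lfloor>x i\<rfloor>" by (rule floor_unique)
    then show ?thesis using False by simp
  qed
  define \<V> where "\<V> = kuhn_vertex I x ` {0..<1}"
  define h where "h S = (\<lambda>i. if i \<in> I then (if i \<in> S then \<lfloor>x i\<rfloor> + 1 else \<lfloor>x i\<rfloor>) else 0)" for S
  have "kuhn_vertex I x \<theta> = h (J \<theta>)" if "\<theta> \<in> {0..<1}" for \<theta>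
    using fl[OF that] by (intro ext) (simp only: kuhn_vertex_def h_def J_def mem_Collect_eq split: if_split; blast)
  then have V: "\<V> = h ` J ` {0..<1}"
    unfolding \<V>_def image_image by (rule image_cong[OF refl])
  have JN: "J \<theta> \<subseteq> N" if "\<theta> \<in> {0..<1}" for \<theta>
  proof
    fix i assume "i \<in> J \<theta>"
    then have "i \<in> I" "frac (x i) + \<theta> \<ge> 1" by (auto simp: J_def)
    moreover from this that have "frac (x i) > 0" unfolding atLeastLessThan_iff by linarith
    ultimately show "i \<in> N" unfolding N_def using frac_gt_0_iff[of "x i"] by blast
  qed
  have fin: "finite (J ` {0..<1})"
    by (rule finite_subset[of _ "Pow N"]) (use JN fN in blast, use fN in simp)
  have inj: "inj_on card (J ` {0..<1})"
  proof (rule inj_onI)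
    fix A B assume A: "A \<in> J ` {0..<1}" and B: "B \<in> J ` {0..<1}" and c: "card A = card B"
    have "A \<subseteq> B \<or> B \<subseteq> A"
    proof -
      obtain s t where st: "A = J s" "B = J t" using A B by auto
      have mono: "J a \<subseteq> J b" if "a \<le> b" for a b
      proof
        fix i assume "i \<in> J a"
        then have "i \<in> I" "frac (x i) + a \<ge> 1" by (simp_all add: J_def)
        then show "i \<in> J b" using that by (simp add: J_def)
      qed
      show ?thesis unfolding st using linear[of s t] mono[of s t] mono[of t s] by argo
    qed
    moreover have "finite C" if "C \<in> J ` {0..<1}" for C
      using that JN fN by (metis finite_subset imageE)
    then have "finite A" "finite B" using A B by blast+
    ultimately show "A = B" using c card_subset_eq by metis
  qed
  have "card ` J ` {0..<1} \<subseteq> {..card N}"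
  proof
    fix c assume "c \<in> card ` J ` {0..<1}"
    then obtain \<theta> where "\<theta> \<in> {0..<1}" "c = card (J \<theta>)" by blast
    then show "c \<in> {..card N}" using card_mono[OF fN JN] by simp
  qed
  then have "card (J ` {0..<1}) \<le> card N + 1"
    using card_inj_on_le[OF inj] by (metis Suc_eq_plus1 card_atMost finite_atMost)
  then show "finite (kuhn_vertex I x ` {0..<1})"
    "card (kuhn_vertex I x ` {0..<1}) \<le> card {i \<in> I. x i \<notin> \<int>} + 1"
    using fin card_image_le[OF fin, of h] unfolding \<V>_def[symmetric] V N_def[symmetric] by auto
qed

text \<open>The shift sets of the vertices partition the unit interval. They are disjoint because
  distinct members of \<open>W\<close>, being 0 off \<open>I\<close>, differ at an index in
  \<open>I\<close>.\<close>

lemma sum_kuhn_coord: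
  assumes "finite I" "finite W" "kuhn_vertex I x ` {0..<1} \<subseteq> W" "\<And>v i. v \<in> W \<Longrightarrow> i \<notin> I \<Longrightarrow> v i = 0"
  shows "(\<Sum>v\<in>W. kuhn_coord I x v) = 1"
proof -
  have "(\<Sum>v\<in>W. measure lborel (kuhn_shifts I x v)) = measure lborel (\<Union>v\<in>W. kuhn_shifts I x v)"
  proof (rule measure_finite_Union[symmetric])
    show "finite W" by fact
    show "disjoint_family_on (kuhn_shifts I x) W"
    proof (unfold disjoint_family_on_def, intro ballI impI)
      fix v w assume vw: "v \<in> W" "w \<in> W" "v \<noteq> w"
      then obtain i where i: "v i \<noteq> w i" by auto
      then have "i \<in> I" using assms(4) vw by metis
      then show "kuhn_shifts I x v \<inter> kuhn_shifts I x w = {}" using i by (auto simp: kuhn_shifts_def)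
    qed
    show "kuhn_shifts I x ` W \<subseteq> sets lborel" by (auto simp: kuhn_shifts_eq[OF assms(1)])
    show "emeasure lborel (kuhn_shifts I x v) \<noteq> \<infinity>" if "v \<in> W" for v
    proof -
      have "emeasure lborel (kuhn_shifts I x v) \<le> emeasure lborel {0..<1::real}"
        by (intro emeasure_mono) (auto simp: kuhn_shifts_def)
      then show ?thesis by (auto simp: top_unique)
    qed
  qed
  also have "(\<Union>v\<in>W. kuhn_shifts I x v) = {0..<1}"
  proof (intro equalityI subsetI)
    fix \<theta> :: real assume \<theta>: "\<theta> \<in> {0..<1}"
    then have "kuhn_vertex I x \<theta> \<in> W" "\<theta> \<in> kuhn_shifts I x (kuhn_vertex I x \<theta>)"
      using assms(3) by (auto simp: kuhn_shifts_def kuhn_vertex_def)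
    then show "\<theta> \<in> (\<Union>v\<in>W. kuhn_shifts I x v)" by auto
  qed (auto simp: kuhn_shifts_def)
  finally show ?thesis by (simp add: kuhn_coord_def)
qed


text \<open>Points with the same image share a vertex of positive coordinate, so for suitable shifts
  in [0, 1) all their coordinates have equal floors and differ by less than 2. The simplex
  containing the image of \<open>x\<close> has at most one vertex more than \<open>x\<close> has
  non-integral coordinates. The infinite type serves as a supply of names for the lattice points, as
  \<open>widim\<close> takes its vertices from \<open>'a\<close>.\<close>

theorem widim_le:
  fixes X :: "'a set" and \<psi> :: "'a \<Rightarrow> 'i \<Rightarrow> real"
  assumes X: "Metric_space X d" and inf: "infinite (UNIV :: 'a set)" and I: "finite I"
    and cont: "\<And>i x e. i \<in> I \<Longrightarrow> x \<in> X \<Longrightarrow> e > 0 \<Longrightarrow> \<exists>r>0. \<forall>y\<in>X. d x y < r \<longrightarrow> \<bar>\<psi> x i - \<psi> y i\<bar> < e"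
    and bound: "\<And>i x. i \<in> I \<Longrightarrow> x \<in> X \<Longrightarrow> \<bar>\<psi> x i\<bar> \<le> B"
    and few: "\<And>x. x \<in> X \<Longrightarrow> card {i \<in> I. \<psi> x i \<notin> \<int>} \<le> k"
    and fibre: "\<And>x y. x \<in> X \<Longrightarrow> y \<in> X \<Longrightarrow> (\<And>i. i \<in> I \<Longrightarrow> \<bar>\<psi> x i - \<psi> y i\<bar> \<le> 2) \<Longrightarrow> d x y \<le> \<epsilon>"
  shows "widim \<epsilon> X d \<le> enat k"
proof -
  interpret Metric_space X d by fact
  \<comment> \<open>Large enough for the finite box \<open>W\<close> to contain the floor of every
    coordinate after a shift below 1.\<close>
  define M where "M = \<lceil>\<bar>B\<bar>\<rceil> + 2"
  define W where "W = {v :: 'i \<Rightarrow> int. \<forall>i. (i \<in> I \<longrightarrow> v i \<in> {-M..M}) \<and> (i \<notin> I \<longrightarrow> v i = 0)}"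
  have fW: "finite W"
    unfolding W_def using I by (intro finite_set_of_finite_funs) auto
  have "0 \<le> \<lceil>\<bar>B\<bar>\<rceil>" using ceiling_mono[of 0 "\<bar>B\<bar>"] by simp
  then have "0 \<le> M" unfolding M_def by (rule add_nonneg_nonneg) simp
  then have "(\<lambda>_. 0) \<in> W" by (auto simp: W_def)
  then have W0: "W \<noteq> {}" by auto
  have BM: "B + 2 \<le> real_of_int M"
    unfolding M_def using le_of_int_ceiling[of "\<bar>B\<bar>"] by linarith
  have VW: "kuhn_vertex I (\<psi> x) \<theta> \<in> W" if "x \<in> X" "\<theta> \<in> {0..<1}" for x \<theta>
  proof -
    have "\<lfloor>\<psi> x i + \<theta>\<rfloor> \<in> {-M..M}" if i: "i \<in> I" for i
      using bound[OF i \<open>x \<in> X\<close>] \<open>\<theta> \<in> _\<close> BM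
      by (auto simp: le_floor_iff floor_le_iff)
    then show ?thesis by (auto simp: W_def kuhn_vertex_def)
  qed
  have sum1: "(\<Sum>v\<in>W. kuhn_coord I (\<psi> x) v) = 1" if "x \<in> X" for x
    using VW[OF that] by (intro sum_kuhn_coord I fW) (auto simp: W_def)
  obtain Y :: "'a set" where "finite Y" "card Y = card W"
    using infinite_arbitrarily_large[OF inf] by blast
  then obtain g where g: "bij_betw g W Y"
    using finite_same_card_bij[OF fW] by metis
  then have inj: "inj_on g W" by (simp add: bij_betw_def)
  define \<phi> where "\<phi> x u = (if u \<in> g ` W then kuhn_coord I (\<psi> x) (inv_into W g u) else 0)" for x u
  have \<phi>g: "\<phi> x (g v) = kuhn_coord I (\<psi> x) v" if "v \<in> W" for x v
    using that inj by (simp add: \<phi>_def)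
  \<comment> \<open>The \<open>k\<close>-skeleton of the full simplex on all vertices: its closure
    under faces is immediate, and it contains every simplex that occurs.\<close>
  define K where "K = {\<sigma>. \<sigma> \<subseteq> g ` W \<and> \<sigma> \<noteq> {} \<and> card \<sigma> \<le> k + 1}"
  have fK: "finite \<sigma>" if "\<sigma> \<in> K" for \<sigma>
    using that fW by (auto simp: K_def intro: finite_subset)
  have "finite K" using fW by (intro finite_subset[of K "Pow (g ` W)"]) (auto simp: K_def)
  have "abstract_complex K"
    unfolding abstract_complex_def
  proof (intro ballI conjI allI impI)
    fix \<sigma> \<tau> assume "\<sigma> \<in> K" and \<tau>: "\<tau> \<subseteq> \<sigma> \<and> \<tau> \<noteq> {}"
    then have "card \<tau> \<le> card \<sigma>" using fK by (intro card_mono) auto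
    moreover have "\<sigma> \<subseteq> g ` W" "card \<sigma> \<le> k + 1" using \<open>\<sigma> \<in> K\<close> unfolding K_def by blast+
    ultimately have "\<tau> \<subseteq> g ` W" "card \<tau> \<le> k + 1" "\<tau> \<noteq> {}" using \<tau> by (blast, linarith, blast)
    then show "\<tau> \<in> K" unfolding K_def by blast
  next
    fix \<sigma> assume "\<sigma> \<in> K"
    then show "finite \<sigma>" "\<sigma> \<noteq> {}" using fK unfolding K_def by blast+
  qed
  \<comment> \<open>\<open>complex_dim\<close> demands that the dimension is attained, which fails
    for \<open>k\<close> itself when \<open>W\<close> has at most \<open>k\<close> points.\<close>
  define m where "m = min k (card W - 1)"
  have cW: "card (g ` W) = card W" "card W > 0"
    using inj fW W0 by (auto simp: card_image)
  have "complex_dim K m"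
    unfolding complex_dim_def
  proof (intro conjI ballI)
    fix \<sigma> assume "\<sigma> \<in> K"
    then have "card \<sigma> \<le> card W" using cW(1) fW card_mono[of "g ` W" \<sigma>] by (auto simp: K_def)
    then show "card \<sigma> \<le> m + 1" using \<open>\<sigma> \<in> K\<close> by (auto simp: m_def K_def)
  next
    have "m + 1 \<le> card (g ` W)" using cW by (auto simp: m_def)
    then obtain \<sigma> where "\<sigma> \<subseteq> g ` W" "card \<sigma> = m + 1" using obtain_subset_with_card_n by metis
    then have "\<sigma> \<in> K" by (auto simp: K_def m_def)
    then show "\<exists>\<sigma>\<in>K. card \<sigma> = m + 1" using \<open>card \<sigma> = m + 1\<close> by blast
  qed
  moreover have "continuous_map mtopology (realization K) \<phi>"
  proof (rule continuous_map_realization)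
    show "\<phi> \<in> topspace mtopology \<rightarrow> (\<Union>\<sigma>\<in>K. geom_simplex \<sigma>)"
    proof
      fix x assume "x \<in> topspace mtopology"
      then have x: "x \<in> X" by simp
      define S where "S = kuhn_vertex I (\<psi> x) ` {0..<1}"
      have S: "finite S" "card S \<le> k + 1" "S \<subseteq> W"
        using card_kuhn_vertices[OF I, of "\<psi> x"] few[OF x] VW[OF x] by (auto simp: S_def)
      have "(0::real) \<in> {0..<1}" by simp
      then have "S \<noteq> {}" unfolding S_def by blast
      then have "g ` S \<in> K"
        using S card_image_le[OF S(1), of g] by (auto simp: K_def)
      moreover have "\<phi> x \<in> geom_simplex (g ` S)"
      proof -
        have zero: "kuhn_coord I (\<psi> x) v = 0" if "v \<in> W" "v \<notin> S" for v
        proof (rule ccontr)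
          assume "kuhn_coord I (\<psi> x) v \<noteq> 0"
          then have "kuhn_coord I (\<psi> x) v > 0" by (simp add: kuhn_coord_def less_le)
          then obtain \<theta> where t: "0 \<le> \<theta>" "\<theta> < 1" "\<And>i. i \<in> I \<Longrightarrow> v i = \<lfloor>\<psi> x i + \<theta>\<rfloor>"
            by (rule kuhn_coord_posD) auto
          then have "v = kuhn_vertex I (\<psi> x) \<theta>"
            using \<open>v \<in> W\<close> by (auto simp: kuhn_vertex_def W_def fun_eq_iff)
          then show False using t that by (auto simp: S_def)
        qed
        have "(\<Sum>u\<in>g ` S. \<phi> x u) = (\<Sum>v\<in>S. kuhn_coord I (\<psi> x) v)"
          using S(3) inj by (subst sum.reindex) (auto simp: \<phi>g intro: inj_on_subset intro!: sum.cong)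
        also have "\<dots> = (\<Sum>v\<in>W. kuhn_coord I (\<psi> x) v)"
          using S zero fW by (intro sum.mono_neutral_left) auto
        finally have "(\<Sum>u\<in>g ` S. \<phi> x u) = 1" using sum1[OF x] by simp
        moreover have "\<phi> x u = 0" if "u \<notin> g ` S" for u
        proof (cases "u \<in> g ` W")
          case True
          then obtain v where "v \<in> W" "u = g v" by blast
          then show ?thesis using that zero[of v] \<phi>g[of v x] by auto
        qed (simp add: \<phi>_def)
        moreover have "0 \<le> \<phi> x u" for u by (simp add: \<phi>_def kuhn_coord_def)
        ultimately show ?thesis by (auto simp: geom_simplex_def)
      qed
      ultimately show "\<phi> x \<in> (\<Union>\<sigma>\<in>K. geom_simplex \<sigma>)" by blast
    qed
    show "continuous_map mtopology euclideanreal (\<lambda>x. \<phi> x u)" for u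
    proof (cases "u \<in> g ` W")
      case False
      then show ?thesis by (simp add: \<phi>_def)
    next
      case True
      then obtain v where v: "v \<in> W" "u = g v" by auto
      have "\<exists>r>0. \<forall>y\<in>X. d x y < r \<longrightarrow> \<bar>kuhn_coord I (\<psi> x) v - kuhn_coord I (\<psi> y) v\<bar> < e"
        if x: "x \<in> X" and e: "e > 0" for x e
      proof -
        have "\<forall>i\<in>I. \<exists>r>0. \<forall>y\<in>X. d x y < r \<longrightarrow> \<bar>\<psi> x i - \<psi> y i\<bar> < e / 3"
          using cont[OF _ x, of _ "e / 3"] e by auto
        then obtain r where r: "\<And>i. i \<in> I \<Longrightarrow> r i > 0"
          "\<And>i y. i \<in> I \<Longrightarrow> y \<in> X \<Longrightarrow> d x y < r i \<Longrightarrow> \<bar>\<psi> x i - \<psi> y i\<bar> < e / 3"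
          by metis
        show ?thesis
        proof (intro exI[of _ "Min (insert 1 (r ` I))"] conjI ballI impI)
          show "Min (insert 1 (r ` I)) > 0" using I r(1) by auto
          fix y assume y: "y \<in> X" "d x y < Min (insert 1 (r ` I))"
          then have "\<bar>\<psi> x i - \<psi> y i\<bar> \<le> e / 3" if "i \<in> I" for i
            using r(2)[OF that y(1)] that I by auto
          then have "\<bar>kuhn_coord I (\<psi> x) v - kuhn_coord I (\<psi> y) v\<bar> \<le> 2 * (e / 3)"
            using e by (intro kuhn_coord_close I) auto
          then show "\<bar>kuhn_coord I (\<psi> x) v - kuhn_coord I (\<psi> y) v\<bar> < e" using e by linarith
        qed
      qed
      then have "continuous_map mtopology Met_TC.mtopology (\<lambda>x. \<phi> x u)"
        unfolding v(2) \<phi>g[OF v(1)]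
        by (subst metric_continuous_map) (auto simp: Met_TC.Metric_space_axioms dist_real_def Ball_def imp_conjL)
      then show ?thesis by simp
    qed
  qed (use \<open>finite K\<close> fK in auto)
  moreover have "d x y \<le> \<epsilon>" if xy: "x \<in> X" "y \<in> X" and eq: "\<phi> x = \<phi> y" for x y
  proof (rule fibre[OF xy])
    have "\<exists>v\<in>W. kuhn_coord I (\<psi> x) v > 0"
    proof (rule ccontr)
      assume "\<not> ?thesis"
      then have "(\<Sum>v\<in>W. kuhn_coord I (\<psi> x) v) \<le> 0" by (intro sum_nonpos) auto
      then show False using sum1[OF xy(1)] by simp
    qed
    then obtain v where v: "v \<in> W" "kuhn_coord I (\<psi> x) v > 0" by auto
    moreover have "kuhn_coord I (\<psi> y) v > 0"
      using v \<phi>g[OF v(1)] eq by metis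
    ultimately obtain s t where "0 \<le> s" "s < 1" "\<And>i. i \<in> I \<Longrightarrow> v i = \<lfloor>\<psi> x i + s\<rfloor>"
      "0 \<le> t" "t < 1" "\<And>i. i \<in> I \<Longrightarrow> v i = \<lfloor>\<psi> y i + t\<rfloor>"
      by (metis kuhn_coord_posD)
    moreover fix i assume "i \<in> I"
    ultimately have "v i = \<lfloor>\<psi> x i + s\<rfloor>" "v i = \<lfloor>\<psi> y i + t\<rfloor>" "0 \<le> s" "s < 1" "0 \<le> t" "t < 1" by auto
    then show "\<bar>\<psi> x i - \<psi> y i\<bar> \<le> 2" by linarith
  qed
  ultimately have "widim \<epsilon> X d \<le> enat m"
    unfolding widim_def using \<open>abstract_complex K\<close>
    by (intro INF_lower CollectI exI[of _ K] exI[of _ \<phi>]) auto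
  also have "enat m \<le> enat k" by (simp add: m_def)
  finally show ?thesis .
qed

section \<open>The Fubini--Study metric\<close>

definition cinner :: "complex ^ 'k::finite \<Rightarrow> complex ^ 'k \<Rightarrow> complex" where
  "cinner x y = (\<Sum>i\<in>UNIV. x $ i * cnj (y $ i))"

lemma norm_vec_square: "(norm x)\<^sup>2 = (\<Sum>i\<in>UNIV. (norm (x $ i))\<^sup>2)"
  by (simp add: norm_vec_def L2_set_def sum_nonneg)

lemma norm_vec_le_sum: "norm x \<le> (\<Sum>i\<in>UNIV. norm (x $ i))"
  unfolding norm_vec_def by (rule L2_set_le_sum) simp

lemma cinner_self: "cinner x x = of_real ((norm x)\<^sup>2)"
  by (simp add: cinner_def norm_vec_square complex_norm_square del: of_real_power)

lemma cinner_cnj: "cinner y x = cnj (cinner x y)"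
  by (simp add: cinner_def mult.commute)

lemma cinner_diff_left: "cinner (x - y) z = cinner x z - cinner y z"
  by (simp add: cinner_def left_diff_distrib sum_subtractf)

lemma cinner_diff_right: "cinner z (x - y) = cinner z x - cinner z y"
  by (simp add: cinner_def right_diff_distrib sum_subtractf)

lemma cinner_scale_left: "cinner (c *s x) z = c * cinner x z"
  by (simp add: cinner_def sum_distrib_left mult.assoc)

lemma cinner_scale_right: "cinner z (c *s x) = cnj c * cinner z x"
  by (simp add: cinner_def sum_distrib_left mult_ac)

lemma norm_vec_scale: "norm (c *s (x :: complex ^ 'k::finite)) = cmod c * norm x"
  by (simp add: norm_vec_def L2_set_def norm_mult power_mult_distrib
      sum_distrib_left[symmetric] real_sqrt_mult)

lemma cinner_le: "cmod (cinner x y) \<le> norm x * norm y"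
proof -
  have "cmod (cinner x y) \<le> (\<Sum>i\<in>UNIV. \<bar>cmod (x $ i)\<bar> * \<bar>cmod (y $ i)\<bar>)"
    unfolding cinner_def by (rule sum_norm_le) (simp add: norm_mult)
  also have "\<dots> \<le> norm x * norm y"
    unfolding norm_vec_def by (rule L2_set_mult_ineq)
  finally show ?thesis .
qed

lemma proj_unit_cases:
  obtains x where "norm x = 1" "p = proj x"
proof -
  obtain y where y: "y \<noteq> 0" "p = proj y"
    by (induction p rule: proj_space.abs_induct) (auto simp: proportional_def)
  have "proj y = proj (of_real (inverse (norm y)) *s y)"
    using y(1) by (subst proj_eq_iff) (auto intro!: exI[of _ "of_real (inverse (norm y))"])
  then show ?thesis
    using that[of "of_real (inverse (norm y)) *s y"] y by (auto simp: norm_vec_scale norm_inverse)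
qed

lemma proportional_refl: "x \<noteq> 0 \<Longrightarrow> proportional x x"
  by (auto simp: proportional_def intro!: exI[of _ 1])

lemma fs_dist_proj:
  assumes "x \<noteq> 0" "y \<noteq> 0"
  shows "fs_dist (proj x) (proj y) = arccos (cmod (cinner x y) / (norm x * norm y))"
  using fs_dist.abs_eq[OF assms[THEN proportional_refl]] by (simp add: cinner_def)

lemma fs_dist_unit: "norm x = 1 \<Longrightarrow> norm y = 1 \<Longrightarrow> fs_dist (proj x) (proj y) = arccos (cmod (cinner x y))"
  by (subst fs_dist_proj) auto

lemma cos_fs_dist_unit:
  assumes "norm x = 1" "norm y = 1"
  shows "cos (fs_dist (proj x) (proj y)) = cmod (cinner x y)"
proof -
  have "cmod (cinner x y) \<le> 1" using cinner_le[of x y] assms by simp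
  then show ?thesis
    using assms by (simp add: fs_dist_unit cos_arccos order_trans[of _ 0])
qed

lemma fs_dist_bounds: "0 \<le> fs_dist p q" "fs_dist p q \<le> pi / 2"
proof -
  obtain x where x: "norm x = 1" "p = proj x" by (rule proj_unit_cases)
  obtain y where y: "norm y = 1" "q = proj y" by (rule proj_unit_cases)
  have "cmod (cinner x y) \<le> 1" using cinner_le[of x y] x y by simp
  moreover have "fs_dist p q = arccos (cmod (cinner x y))" using x y by (simp add: fs_dist_unit)
  moreover have "- 1 \<le> cmod (cinner x y)" using norm_ge_zero[of "cinner x y"] by linarith
  ultimately show "0 \<le> fs_dist p q" "fs_dist p q \<le> pi / 2"
    using arccos_le_pi2[of "cmod (cinner x y)"] arccos_lbound[of "cmod (cinner x y)"]
    by (metis norm_ge_zero)+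
qed

lemma fs_dist_sym: "fs_dist p q = fs_dist q p"
proof -
  obtain x where x: "norm x = 1" "p = proj x" by (rule proj_unit_cases)
  obtain y where y: "norm y = 1" "q = proj y" by (rule proj_unit_cases)
  show ?thesis using x y by (simp add: fs_dist_unit cinner_cnj[of x y])
qed

lemma norm_orth_part:
  assumes "norm x = 1" "norm y = 1"
  shows "(norm (x - cinner x y *s y))\<^sup>2 = 1 - (cmod (cinner x y))\<^sup>2"
proof -
  have "complex_of_real ((norm (x - cinner x y *s y))\<^sup>2) = of_real (1 - (cmod (cinner x y))\<^sup>2)"
    unfolding cinner_self[symmetric]
  proof -
    have "cinner (x - cinner x y *s y) (x - cinner x y *s y) = 1 - cinner x y * cnj (cinner x y)"
      by (simp add: cinner_diff_left cinner_diff_right cinner_scale_left cinner_scale_right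
          cinner_self[of x] cinner_self[of y] assms cinner_cnj[of y x])
    then show "cinner (x - cinner x y *s y) (x - cinner x y *s y) = of_real (1 - (cmod (cinner x y))\<^sup>2)"
      by (simp add: complex_norm_square del: of_real_power)
  qed
  then show ?thesis by (simp only: of_real_eq_iff)
qed

text \<open>Split \<open>x\<close> and \<open>z\<close> into their parts along the middle unit
  vector \<open>y\<close> and orthogonal to it. The former contribute cos A cos C to the inner
  product of \<open>x\<close> and \<open>z\<close>, the latter at most sin A sin C, so its modulus
  is at least cos (A + C).\<close>

lemma fs_dist_triangle: "fs_dist p r \<le> fs_dist p q + fs_dist q r"
proof -
  obtain x where x: "norm x = 1" "p = proj x" by (rule proj_unit_cases)
  obtain y where y: "norm y = 1" "q = proj y" by (rule proj_unit_cases)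
  obtain z where z: "norm z = 1" "r = proj z" by (rule proj_unit_cases)
  define A where "A = fs_dist p q"
  define C where "C = fs_dist q r"
  have cA: "cos A = cmod (cinner x y)" and cC: "cos C = cmod (cinner z y)"
    using x y z by (simp_all add: A_def C_def cos_fs_dist_unit cinner_cnj[of z y])
  have rng: "0 \<le> A" "A \<le> pi / 2" "0 \<le> C" "C \<le> pi / 2"
    using fs_dist_bounds[of p q] fs_dist_bounds[of q r] by (auto simp: A_def C_def)
  have s: "norm (x - cinner x y *s y) = sin A" "norm (z - cinner z y *s y) = sin C"
  proof -
    have "(norm (x - cinner x y *s y))\<^sup>2 = (sin A)\<^sup>2" "(norm (z - cinner z y *s y))\<^sup>2 = (sin C)\<^sup>2"
      using norm_orth_part[OF x(1) y(1)] norm_orth_part[OF z(1) y(1)] cA cC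
      by (simp_all add: sin_squared_eq)
    moreover have "0 \<le> sin A" "0 \<le> sin C" using rng by (auto intro!: sin_ge_zero)
    ultimately show "norm (x - cinner x y *s y) = sin A" "norm (z - cinner z y *s y) = sin C"
      by (auto simp: power2_eq_iff_nonneg)
  qed
  have "cinner x y * cnj (cinner z y) =
      cinner x z - cinner (x - cinner x y *s y) (z - cinner z y *s y)"
    by (simp add: cinner_diff_left cinner_diff_right cinner_scale_left cinner_scale_right
        cinner_self y cinner_cnj[of y z])
  then have "cmod (cinner x y * cnj (cinner z y)) \<le> cmod (cinner x z) +
      cmod (cinner (x - cinner x y *s y) (z - cinner z y *s y))"
    by (metis norm_triangle_ineq4)
  also have "\<dots> \<le> cmod (cinner x z) + sin A * sin C"
    using cinner_le[of "x - cinner x y *s y" "z - cinner z y *s y"] by (simp add: s)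
  finally have "cos A * cos C \<le> cmod (cinner x z) + sin A * sin C"
    by (simp add: norm_mult cA cC)
  then have "cos (A + C) \<le> cmod (cinner x z)"
    by (simp add: cos_add)
  moreover have "cmod (cinner x z) \<le> 1" using cinner_le[of x z] x z by simp
  ultimately have "arccos (cmod (cinner x z)) \<le> arccos (cos (A + C))"
    by (intro arccos_le_arccos) auto
  also have "\<dots> = A + C"
    using rng by (intro arccos_cos) auto
  finally show ?thesis using x z by (simp add: fs_dist_unit A_def C_def)
qed

text \<open>The orthogonal projector onto a line, that is, the embedding of projective space into
  the Hermitian matrices. Its entries are global coordinates unaffected by rescaling a
  representative.\<close>

lift_definition proj_mat :: "'k::finite proj_space \<Rightarrow> complex ^ 'k ^ 'k"
  is "\<lambda>x. \<chi> i j. x $ i * cnj (x $ j) / of_real ((norm x)\<^sup>2)"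
proof -
  fix x y :: "complex ^ 'k" assume "proportional x y"
  then obtain c where c: "c \<noteq> 0" "y = c *s x" by (auto simp: proportional_def)
  have "c * a * (cnj c * b) / ((of_real (cmod c * n))\<^sup>2) = a * b / (of_real n)\<^sup>2" for a b n
  proof -
    have "(of_real (cmod c * n))\<^sup>2 = c * cnj c * (complex_of_real n)\<^sup>2"
      using complex_norm_square[of c] by (simp add: power_mult_distrib)
    then show ?thesis using c by simp
  qed
  then show "(\<chi> i j. x $ i * cnj (x $ j) / of_real ((norm x)\<^sup>2)) =
      (\<chi> i j. y $ i * cnj (y $ j) / of_real ((norm y)\<^sup>2))"
    by (simp add: vec_eq_iff c norm_vec_scale)
qed

lemma proj_mat_proj: "x \<noteq> 0 \<Longrightarrow> proj_mat (proj x) $ i $ j = x $ i * cnj (x $ j) / of_real ((norm x)\<^sup>2)"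
  using proj_mat.abs_eq[OF proportional_refl, of x] by simp

text \<open>For unit vectors the squared Hilbert-Schmidt norm of the difference is $2 - 2 |<x,
  y>|^2$, and $|<x, y>|$ is the cosine of the distance.\<close>

lemma dist_proj_mat: "(norm (proj_mat p - proj_mat q))\<^sup>2 = 2 * (sin (fs_dist p q))\<^sup>2"
proof -
  obtain x where x: "norm x = 1" "p = proj x" by (rule proj_unit_cases)
  obtain y where y: "norm y = 1" "q = proj y" by (rule proj_unit_cases)
  have xy0: "x \<noteq> 0" "y \<noteq> 0" using x y by auto
  have "complex_of_real ((norm (proj_mat p - proj_mat q))\<^sup>2) =
      of_real (\<Sum>i\<in>UNIV. \<Sum>j\<in>UNIV. (cmod (x $ i * cnj (x $ j) - y $ i * cnj (y $ j)))\<^sup>2)"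
    unfolding norm_vec_square vector_minus_component x(2) y(2) proj_mat_proj[OF xy0(1)]
      proj_mat_proj[OF xy0(2)] x(1) y(1) by simp
  also have "\<dots> = (\<Sum>i\<in>UNIV. \<Sum>j\<in>UNIV.
      (x $ i * cnj (x $ i)) * (x $ j * cnj (x $ j)) + (y $ i * cnj (y $ i)) * (y $ j * cnj (y $ j))
      - (x $ i * cnj (y $ i)) * (y $ j * cnj (x $ j)) - (y $ i * cnj (x $ i)) * (x $ j * cnj (y $ j)))"
  proof -
    have "complex_of_real ((cmod (a * cnj b - c * cnj d))\<^sup>2) = (a * cnj a) * (b * cnj b) +
      (c * cnj c) * (d * cnj d) - (a * cnj c) * (d * cnj b) - (c * cnj a) * (b * cnj d)" for a b c d
      unfolding complex_norm_square complex_cnj_diff complex_cnj_mult complex_cnj_cnj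
      by (simp add: left_diff_distrib right_diff_distrib mult_ac)
    note * = this
    show ?thesis
      unfolding of_real_sum by (rule sum.cong[OF refl], rule sum.cong[OF refl], rule *)
  qed
  also have "\<dots> = cinner x x * cinner x x + cinner y y * cinner y y
      - cinner x y * cinner y x - cinner y x * cinner x y"
    unfolding cinner_def sum_product by (simp add: sum.distrib sum_subtractf)
  also have "\<dots> = of_real (2 - 2 * (cmod (cinner x y))\<^sup>2)"
    using x y complex_norm_square[of "cinner x y"] by (simp add: cinner_self cinner_cnj[of x y])
  finally have "(norm (proj_mat p - proj_mat q))\<^sup>2 = 2 - 2 * (cmod (cinner x y))\<^sup>2"
    by (simp only: of_real_eq_iff)
  then show ?thesis
    using cos_fs_dist_unit[OF x(1) y(1)] x y by (simp add: sin_squared_eq)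
qed

lemma proj_mat_component_le: "cmod (A $ i $ j) \<le> norm (A :: complex ^ 'k::finite ^ 'k)"
  by (rule order_trans[OF Finite_Cartesian_Product.norm_nth_le Finite_Cartesian_Product.norm_nth_le])

lemma proj_mat_close: "cmod (proj_mat p $ i $ j - proj_mat q $ i $ j) \<le> 2 * fs_dist p q"
proof -
  have "0 \<le> sin (fs_dist p q)" "sin (fs_dist p q) \<le> fs_dist p q"
    using fs_dist_bounds[of p q] pi_gt_zero by (intro sin_ge_zero sin_x_le_x; linarith)+
  then have "(norm (proj_mat p - proj_mat q))\<^sup>2 \<le> (2 * fs_dist p q)\<^sup>2"
    unfolding dist_proj_mat power_mult_distrib by (intro mult_mono power_mono) auto
  then have "norm (proj_mat p - proj_mat q) \<le> 2 * fs_dist p q"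
    by (rule power2_le_imp_le) (simp add: fs_dist_bounds)
  then show ?thesis
    using proj_mat_component_le[of "proj_mat p - proj_mat q" i j] by simp
qed

text \<open>Distances lie between 0 and pi/2, where the sine is strictly increasing, so
  \<open>dist_proj_mat\<close> can be inverted uniformly in the points.\<close>

lemma fs_dist_small:
  assumes "\<epsilon> > 0"
  obtains \<delta> where "\<delta> > 0"
    "\<And>p q :: 'k::finite proj_space. (\<And>i j. cmod (proj_mat p $ i $ j - proj_mat q $ i $ j) \<le> \<delta>)
      \<Longrightarrow> fs_dist p q \<le> \<epsilon>"
proof
  define e where "e = min \<epsilon> (pi / 2)"
  have e: "0 < e" "e \<le> \<epsilon>" "e \<le> pi / 2" using assms by (auto simp: e_def)
  have se: "sin e > 0" using e pi_gt_zero by (intro sin_gt_zero) auto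
  let ?N = "real CARD('k)"
  have N: "?N > 0" by simp
  \<comment> \<open>The matrix norm is at most the sum of the moduli of the \<open>?N ^ 2\<close>
    entries, which this choice bounds by \<open>sin e\<close>.\<close>
  define \<delta> where "\<delta> = sin e / ?N ^ 2"
  show "\<delta> > 0" using se N by (auto simp: \<delta>_def)
  fix p q :: "'k proj_space"
  assume pq: "\<And>i j. cmod (proj_mat p $ i $ j - proj_mat q $ i $ j) \<le> \<delta>"
  have "norm (proj_mat p - proj_mat q) \<le> (\<Sum>i\<in>UNIV. \<Sum>j\<in>UNIV. cmod (proj_mat p $ i $ j - proj_mat q $ i $ j))"
    by (intro order_trans[OF norm_vec_le_sum] sum_mono) (auto intro: order_trans[OF norm_vec_le_sum])
  also have "\<dots> \<le> (\<Sum>i\<in>(UNIV::'k set). \<Sum>j\<in>(UNIV::'k set). \<delta>)"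
    by (intro sum_mono pq)
  also have "\<dots> = sin e"
    using N by (simp add: \<delta>_def power2_eq_square)
  finally have "(norm (proj_mat p - proj_mat q))\<^sup>2 \<le> (sin e)\<^sup>2" by (intro power_mono) auto
  then have "2 * (sin (fs_dist p q))\<^sup>2 \<le> (sin e)\<^sup>2" by (simp add: dist_proj_mat)
  moreover have "(sin e)\<^sup>2 < 2 * (sin e)\<^sup>2" using se by simp
  ultimately have "(sin (fs_dist p q))\<^sup>2 < (sin e)\<^sup>2" by linarith
  then have "sin (fs_dist p q) < sin e" using se power2_less_imp_less by (meson less_imp_le)
  then have "fs_dist p q \<le> e"
    using sin_monotone_2pi_le[of e "fs_dist p q"] fs_dist_bounds(2)[of p q] e pi_gt_zero by linarith
  then show "fs_dist p q \<le> \<epsilon>" using e by simp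
qed

lemma fs_dist_eq_0_iff: "fs_dist p q = 0 \<longleftrightarrow> p = q"
proof
  assume "p = q"
  obtain x where x: "norm x = 1" "p = proj x" by (rule proj_unit_cases)
  then show "fs_dist p q = 0" using \<open>p = q\<close> by (simp add: fs_dist_unit cinner_self)
next
  assume d: "fs_dist p q = 0"
  obtain x where x: "norm x = 1" "p = proj x" by (rule proj_unit_cases)
  obtain y where y: "norm y = 1" "q = proj y" by (rule proj_unit_cases)
  have c: "cmod (cinner y x) = 1"
    using cos_fs_dist_unit[OF x(1) y(1)] d x y by (simp add: cinner_cnj[of y x])
  then have "(norm (y - cinner y x *s x))\<^sup>2 = 0" using norm_orth_part[OF y(1) x(1)] by simp
  then have "y = cinner y x *s x" by simp
  moreover have "cinner y x \<noteq> 0" using c by auto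
  moreover have "x \<noteq> 0" "y \<noteq> 0" using x y by auto
  ultimately show "p = q" unfolding x(2) y(2) using proj_eq_iff by blast
qed

text \<open>This makes \<open>disc_dist R\<close> a metric on entire curves although it sees only a
  disc: the 2-by-2 minors of two representations are entire, and vanishing on the disc they vanish
  everywhere.\<close>

lemma curve_eqI:
  assumes f: "holomorphic_curve f" and g: "holomorphic_curve g"
    and R: "R > 0" and eq: "\<And>z. z \<in> cball 0 R \<Longrightarrow> f z = g z"
  shows "f = g"
proof
  fix z
  obtain F where F: "reduced_rep F f" using f by (auto simp: holomorphic_curve_def)
  obtain G where G: "reduced_rep G g" using g by (auto simp: holomorphic_curve_def)
  have nz: "F w \<noteq> 0" "G w \<noteq> 0" for w using F G by (auto simp: reduced_rep_def)
  have "F z $ i * G z $ j - F z $ j * G z $ i = 0" for i j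
  proof (rule analytic_continuation[of "\<lambda>z. F z $ i * G z $ j - F z $ j * G z $ i" UNIV "cball 0 R" 0])
    show "(\<lambda>z. F z $ i * G z $ j - F z $ j * G z $ i) holomorphic_on UNIV"
      using F G by (intro holomorphic_intros) (auto simp: reduced_rep_def)
    show "(0::complex) islimpt cball 0 R"
      by (rule interior_limit_point) (use R in simp)
    fix w :: complex assume "w \<in> cball 0 R"
    then have "proj (F w) = proj (G w)" using eq F G by (simp add: reduced_rep_def)
    then obtain c where "G w = c *s F w" using proj_eq_iff[OF nz] by blast
    then show "F w $ i * G w $ j - F w $ j * G w $ i = 0" by simp
  qed auto
  then have e: "F z $ i * G z $ j = F z $ j * G z $ i" for i j by (simp add: algebra_simps)
  obtain l where l: "F z $ l \<noteq> 0" using nz(1)[of z] by (metis vec_eq_iff zero_index)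
  have "G z = (G z $ l / F z $ l) *s F z"
    using e[of _ l] l by (simp add: vec_eq_iff field_simps)
  moreover from this nz(2)[of z] have "G z $ l / F z $ l \<noteq> 0" by (metis vector_smult_lzero)
  ultimately have "proj (F z) = proj (G z)" using proj_eq_iff[OF nz] by blast
  then show "f z = g z" using F G by (simp add: reduced_rep_def)
qed

lemma fs_dist_le_disc_dist: "z \<in> cball 0 R \<Longrightarrow> fs_dist (f z) (g z) \<le> disc_dist R f g"
  unfolding disc_dist_def by (intro cSUP_upper bdd_aboveI2[of _ _ "pi / 2"] fs_dist_bounds)

lemma disc_dist_le:
  assumes "R \<ge> 0" "\<And>z. z \<in> cball 0 R \<Longrightarrow> fs_dist (f z) (g z) \<le> e"
  shows "disc_dist R f g \<le> e"
  unfolding disc_dist_def using assms by (intro cSUP_least) auto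

lemma Metric_space_disc_dist:
  assumes "R > 0" and M: "\<And>f. f \<in> M \<Longrightarrow> holomorphic_curve f"
  shows "Metric_space M (disc_dist R)"
proof
  have 0: "(0::complex) \<in> cball 0 R" using assms by auto
  show nn: "0 \<le> disc_dist R f g" for f g :: "complex \<Rightarrow> 'a proj_space"
    using fs_dist_le_disc_dist[OF 0, of f g] fs_dist_bounds(1)[of "f 0" "g 0"] by linarith
  show "disc_dist R f g = disc_dist R g f" for f g :: "complex \<Rightarrow> 'a proj_space"
    by (simp add: disc_dist_def fs_dist_sym)
  show "disc_dist R f g = 0 \<longleftrightarrow> f = g" if "f \<in> M" "g \<in> M" for f g
  proof
    assume "disc_dist R f g = 0"
    then have "fs_dist (f z) (g z) = 0" if "z \<in> cball 0 R" for z
      using fs_dist_le_disc_dist[OF that, of f g] fs_dist_bounds(1)[of "f z" "g z"] by linarith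
    then have "f z = g z" if "z \<in> cball 0 R" for z
      using that by (simp add: fs_dist_eq_0_iff)
    then show "f = g" by (rule curve_eqI[OF M[OF that(1)] M[OF that(2)] \<open>R > 0\<close>])
  next
    assume "f = g"
    then have "disc_dist R f g \<le> 0"
      using assms(1) by (intro disc_dist_le) (auto simp: fs_dist_eq_0_iff[THEN iffD2])
    then show "disc_dist R f g = 0" using nn[of f g] by simp
  qed
  show "disc_dist R f h \<le> disc_dist R f g + disc_dist R g h" for f g h :: "complex \<Rightarrow> 'a proj_space"
  proof (rule disc_dist_le)
    fix z :: complex assume z: "z \<in> cball 0 R"
    show "fs_dist (f z) (h z) \<le> disc_dist R f g + disc_dist R g h"
      using fs_dist_triangle[of "f z" "h z" "g z"] fs_dist_le_disc_dist[OF z, of f g]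
        fs_dist_le_disc_dist[OF z, of g h] by linarith
  qed (use assms(1) in simp)
qed

section \<open>Integral estimates in the plane\<close>

lemma integral_prod_swap:
  fixes f :: "real \<Rightarrow> real \<Rightarrow> real"
  assumes "continuous_on UNIV (\<lambda>(x, y). f x y)"
  shows "integral (cbox (a, c) (b, d)) (\<lambda>(x, y). f x y) = integral {c..d} (\<lambda>y. integral {a..b} (\<lambda>x. f x y))"
    "integral (cbox (a, c) (b, d)) (\<lambda>(x, y). f x y) = integral {a..b} (\<lambda>x. integral {c..d} (\<lambda>y. f x y))"
proof -
  have c: "continuous_on (cbox (a, c) (b, d)) (\<lambda>(x, y). f x y)"
    using assms continuous_on_subset by blast
  show 1: "integral (cbox (a, c) (b, d)) (\<lambda>(x, y). f x y) = integral {a..b} (\<lambda>x. integral {c..d} (\<lambda>y. f x y))"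
    using integral_prod_continuous[OF c] by simp
  show "integral (cbox (a, c) (b, d)) (\<lambda>(x, y). f x y) = integral {c..d} (\<lambda>y. integral {a..b} (\<lambda>x. f x y))"
    using integral_swap_continuous[OF c] unfolding 1 by simp
qed

lemma plane_integrable:
  fixes f :: "real \<Rightarrow> real \<Rightarrow> real"
  assumes "continuous_on UNIV (\<lambda>(x, y). f x y)"
  shows "(\<lambda>(x, y). f x y) integrable_on cbox p q"
  using assms continuous_on_subset by (blast intro: integrable_continuous)

lemma plane_slices:
  fixes f :: "real \<Rightarrow> real \<Rightarrow> real"
  assumes "continuous_on UNIV (\<lambda>(x, y). f x y)"
  shows "continuous_on S (\<lambda>x. f x y)" "continuous_on S (\<lambda>y. f x y)"
    "continuous_on S (\<lambda>x. integral {c..d} (\<lambda>y. f x y))"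
    "continuous_on S (\<lambda>y. integral {c..d} (\<lambda>x. f x y))"
proof -
  have "continuous_on S ((\<lambda>(x, y). f x y) \<circ> (\<lambda>x. (x, y)))"
    by (intro continuous_on_compose continuous_intros continuous_on_subset[OF assms]) auto
  then show "continuous_on S (\<lambda>x. f x y)" by (simp add: o_def)
  have "continuous_on S ((\<lambda>(x, y). f x y) \<circ> (\<lambda>y. (x, y)))"
    by (intro continuous_on_compose continuous_intros continuous_on_subset[OF assms]) auto
  then show "continuous_on S (\<lambda>y. f x y)" by (simp add: o_def)
  have "continuous_on S (\<lambda>x. integral (cbox c d) (f x))"
    by (rule integral_continuous_on_param) (rule continuous_on_subset[OF assms], simp)
  then show "continuous_on S (\<lambda>x. integral {c..d} (\<lambda>y. f x y))" by simp
  have "continuous_on UNIV ((\<lambda>(x, y). f x y) \<circ> (\<lambda>(y, x). (x, y)))"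
    unfolding case_prod_unfold
    by (intro continuous_on_compose continuous_intros continuous_on_subset[OF assms[unfolded case_prod_unfold]]) auto
  then have "continuous_on UNIV (\<lambda>(y, x). f x y)"
    by (simp add: o_def case_prod_unfold)
  then have "continuous_on S (\<lambda>y. integral (cbox c d) (\<lambda>x. f x y))"
    by (intro integral_continuous_on_param) (rule continuous_on_subset, assumption, simp)
  then show "continuous_on S (\<lambda>y. integral {c..d} (\<lambda>x. f x y))" by simp
qed

text \<open>Two distinct closed squares meet at most in a grid line, which is negligible.\<close>

lemma integral_grid:
  fixes f :: "real \<times> real \<Rightarrow> real" and X Y L :: real
  assumes f: "continuous_on UNIV f" and G: "finite G" and L: "L > 0"
  defines "S \<equiv> \<lambda>(a, b). cbox (X + real a * L, Y + real b * L) (X + real (Suc a) * L, Y + real (Suc b) * L)"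
  shows "(f has_integral (\<Sum>g\<in>G. integral (S g) f)) (\<Union>g\<in>G. S g)"
proof (rule has_integral_UN[OF G])
  fix g assume "g \<in> G"
  have "f integrable_on S g"
    using f by (auto simp: S_def split: prod.splits intro!: integrable_continuous continuous_on_subset[OF f])
  then show "(f has_integral integral (S g) f) (S g)" by (rule integrable_integral)
next
  show "pairwise (\<lambda>g h. negligible (S g \<inter> S h)) G"
  proof (rule pairwiseI)
    fix g h :: "nat \<times> nat" assume "g \<noteq> h"
    obtain a b c d where gh: "g = (a, b)" "h = (c, d)" by (cases g, cases h) auto
    \<comment> \<open>If two distinct intervals of the grid share a point, it is the larger of their
      left endpoints.\<close>
    have sep: "x = max (Z + real a * L) (Z + real c * L)"
      if "a \<noteq> c" "Z + real a * L \<le> x" "x \<le> Z + real (Suc a) * L"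
        "Z + real c * L \<le> x" "x \<le> Z + real (Suc c) * L" for a c :: nat and Z x
    proof (cases "a < c")
      case True
      then have "real (Suc a) * L \<le> real c * L" using L by (intro mult_right_mono) auto
      then show ?thesis using that by linarith
    next
      case False
      then have "real (Suc c) * L \<le> real a * L" using L that(1) by (intro mult_right_mono) auto
      then show ?thesis using that by linarith
    qed
    have "S g \<inter> S h \<subseteq> {p. p \<bullet> (1, 0) = max (X + real a * L) (X + real c * L)} \<or>
        S g \<inter> S h \<subseteq> {p. p \<bullet> (0, 1) = max (Y + real b * L) (Y + real d * L)}"
    proof (cases "a = c")
      case False
      have "p \<bullet> (1, 0) = max (X + real a * L) (X + real c * L)" if "p \<in> S g \<inter> S h" for p
        using that sep[OF False, of X "fst p"] by (cases p) (auto simp: S_def gh inner_Pair)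
      then show ?thesis by blast
    next
      case True
      then have "b \<noteq> d" using \<open>g \<noteq> h\<close> gh by auto
      have "p \<bullet> (0, 1) = max (Y + real b * L) (Y + real d * L)" if "p \<in> S g \<inter> S h" for p
        using that sep[OF \<open>b \<noteq> d\<close>, of Y "snd p"] by (cases p) (auto simp: S_def gh inner_Pair)
      then show ?thesis by blast
    qed
    moreover have "(1::real, 0::real) \<in> Basis" "(0::real, 1::real) \<in> Basis"
      by (auto simp: Basis_prod_def)
    ultimately show "negligible (S g \<inter> S h)"
      by (elim disjE) (rule negligible_subset[OF negligible_standard_hyperplane], assumption+)+
  qed
qed

lemma grid_union:
  fixes X Y L :: real
  assumes L: "L > 0" and "k > 0"
  defines "S \<equiv> \<lambda>(a, b). cbox (X + real a * L, Y + real b * L) (X + real (Suc a) * L, Y + real (Suc b) * L)"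
  shows "G \<subseteq> {..<k} \<times> {..<k} \<Longrightarrow> (\<Union>g\<in>G. S g) \<subseteq> cbox (X, Y) (X + real k * L, Y + real k * L)"
    "cbox (X, Y) (X + real k * L, Y + real k * L) \<subseteq> (\<Union>g\<in>{..<k} \<times> {..<k}. S g)"
proof -
  assume G: "G \<subseteq> {..<k} \<times> {..<k}"
  have le: "0 \<le> real a * L" "real (Suc a) * L \<le> real k * L" if "a < k" for a
    using that L by (auto intro!: mult_right_mono simp del: of_nat_Suc)
  show "(\<Union>g\<in>G. S g) \<subseteq> cbox (X, Y) (X + real k * L, Y + real k * L)"
  proof
    fix p assume "p \<in> (\<Union>g\<in>G. S g)"
    then obtain a b where "(a, b) \<in> G" "p \<in> S (a, b)" by auto
    moreover from this have "a < k" "b < k" using G by auto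
    ultimately show "p \<in> cbox (X, Y) (X + real k * L, Y + real k * L)"
      using le[of a] le[of b] by (cases p) (auto simp: S_def simp del: of_nat_Suc)
  qed
next
  have ex: "\<exists>a<k. Z + real a * L \<le> x \<and> x \<le> Z + real (Suc a) * L"
    if x: "Z \<le> x" "x \<le> Z + real k * L" for Z x
  \<comment> \<open>The right edge belongs to the last interval, whereas the floor would give the
    index \<open>k\<close>.\<close>
  proof (cases "x = Z + real k * L")
    case True
    then show ?thesis using \<open>k > 0\<close> L by (intro exI[of _ "k - 1"]) (auto simp: algebra_simps)
  next
    case False
    define a where "a = nat \<lfloor>(x - Z) / L\<rfloor>"
    have ge: "(x - Z) / L \<ge> 0" using x L by auto
    then have a: "real a \<le> (x - Z) / L" "(x - Z) / L < real a + 1"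
      unfolding a_def by linarith+
    have "(x - Z) / L < real k" using x False L by (simp add: field_simps)
    then have "a < k" using a by linarith
    then show ?thesis using a L by (intro exI[of _ a]) (auto simp: field_simps)
  qed
  show "cbox (X, Y) (X + real k * L, Y + real k * L) \<subseteq> (\<Union>g\<in>{..<k} \<times> {..<k}. S g)"
  proof
    fix p assume p: "p \<in> cbox (X, Y) (X + real k * L, Y + real k * L)"
    obtain x y where xy: "p = (x, y)" by (cases p)
    obtain a b where "a < k" "X + real a * L \<le> x" "x \<le> X + real (Suc a) * L"
      "b < k" "Y + real b * L \<le> y" "y \<le> Y + real (Suc b) * L"
      using ex[of X x] ex[of Y y] p xy by auto
    then have "p \<in> S (a, b)" "(a, b) \<in> {..<k} \<times> {..<k}" by (auto simp: S_def xy)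
    then show "p \<in> (\<Union>g\<in>{..<k} \<times> {..<k}. S g)" by blast
  qed
qed

subsection \<open>Testing the Laplacian against a bump\<close>

text \<open>A double zero at both ends of the interval from 0 to \<open>r\<close>: the bump and its
  first derivative vanish there, so integrating by parts twice leaves no boundary terms.\<close>

definition bump :: "real \<Rightarrow> real \<Rightarrow> real" where "bump r t = (t * (r - t))\<^sup>2"
definition bump' :: "real \<Rightarrow> real \<Rightarrow> real" where "bump' r t = 2 * t * (r - t) * (r - 2 * t)"
definition bump'' :: "real \<Rightarrow> real \<Rightarrow> real" where "bump'' r t = 2 * (r - 2 * t)\<^sup>2 - 4 * t * (r - t)"

lemma bump_deriv:
  "((\<lambda>t. bump r (t - X)) has_real_derivative bump' r (t - X)) (at t within A)"
  "((\<lambda>t. bump' r (t - X)) has_real_derivative bump'' r (t - X)) (at t within A)"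
  unfolding bump_def bump'_def bump''_def
  by (auto intro!: derivative_eq_intros simp: power2_eq_square algebra_simps)

lemma bump_bounds:
  assumes "0 \<le> t" "t \<le> r"
  shows "0 \<le> bump r t" "bump r t \<le> r ^ 4 / 16" "\<bar>bump'' r t\<bar> \<le> 2 * r\<^sup>2"
proof -
  show "0 \<le> bump r t" by (simp add: bump_def)
  have 1: "0 \<le> t * (r - t)" using assms by auto
  have 2: "t * (r - t) \<le> r\<^sup>2 / 4" using sum_squares_ge_zero[of "r - 2 * t" 0]
    by (simp add: power2_eq_square algebra_simps)
  have "(t * (r - t))\<^sup>2 \<le> (r\<^sup>2 / 4)\<^sup>2" by (rule power_mono[OF 2 1])
  then show "bump r t \<le> r ^ 4 / 16" by (simp add: bump_def power_divide)
  have 3: "(r - 2 * t)\<^sup>2 = r\<^sup>2 - 4 * (t * (r - t))" by (simp add: power2_eq_square algebra_simps)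
  have 4: "bump'' r t = 2 * r\<^sup>2 - 12 * (t * (r - t))" unfolding bump''_def 3 by simp
  show "\<bar>bump'' r t\<bar> \<le> 2 * r\<^sup>2"
    unfolding 4 using 1 2 by (auto simp: abs_le_iff)
qed

lemma bump_lower:
  assumes "0 \<le> \<eta>" "\<eta> \<le> 1 / 2" "\<eta> * r \<le> t" "t \<le> (1 - \<eta>) * r" "0 \<le> r"
  shows "\<eta>\<^sup>2 * r ^ 4 / 4 \<le> bump r t"
proof -
  have 1: "\<eta> * r * (r - \<eta> * r) \<le> t * (r - t)"
  proof -
    have "t * (r - t) - \<eta> * r * (r - \<eta> * r) = (t - \<eta> * r) * (r - \<eta> * r - t)" by (simp add: algebra_simps)
    moreover have "0 \<le> (t - \<eta> * r) * (r - \<eta> * r - t)"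
      using assms by (intro mult_nonneg_nonneg) (auto simp: algebra_simps)
    ultimately show ?thesis by linarith
  qed
  have "\<eta> * r\<^sup>2 / 2 \<le> \<eta> * r * (r - \<eta> * r)"
  proof -
    have "\<eta> * r\<^sup>2 * (1 / 2) \<le> \<eta> * r\<^sup>2 * (1 - \<eta>)" using assms by (intro mult_left_mono) auto
    then show ?thesis by (simp add: power2_eq_square algebra_simps)
  qed
  with 1 have "\<eta> * r\<^sup>2 / 2 \<le> t * (r - t)" by linarith
  then have "(\<eta> * r\<^sup>2 / 2)\<^sup>2 \<le> (t * (r - t))\<^sup>2" using assms by (intro power_mono) auto
  then show ?thesis by (simp add: bump_def power_mult_distrib power_divide)
qed

lemma bump_by_parts:
  fixes g :: "real \<Rightarrow> real"
  assumes g: "\<And>x. (g has_real_derivative g' x) (at x)" "\<And>x. (g' has_real_derivative g'' x) (at x)"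
    and c: "continuous_on UNIV g''" and r: "r > 0"
  shows "integral {X..X + r} (\<lambda>x. bump r (x - X) * g'' x) = integral {X..X + r} (\<lambda>x. bump'' r (x - X) * g x)"
proof -
  let ?h = "\<lambda>x. bump r (x - X) * g' x - bump' r (x - X) * g x"
  note d1 = bump_deriv(1)[of r X] and d2 = bump_deriv(2)[of r X]
  have "((\<lambda>x. bump r (x - X) * g'' x - bump'' r (x - X) * g x) has_integral ?h (X + r) - ?h X) {X..X + r}"
  proof (rule fundamental_theorem_of_calculus)
    fix x
    have "(?h has_real_derivative (bump' r (x - X) * g' x + g'' x * bump r (x - X)) -
        (bump'' r (x - X) * g x + g' x * bump' r (x - X))) (at x within {X..X + r})"
      by (intro DERIV_diff DERIV_mult d1 d2 g[THEN DERIV_subset] subset_UNIV)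
    then show "(?h has_vector_derivative bump r (x - X) * g'' x - bump'' r (x - X) * g x) (at x within {X..X + r})"
      unfolding has_real_derivative_iff_has_vector_derivative[symmetric] by (simp add: algebra_simps)
  qed (use r in simp)
  then have "((\<lambda>x. bump r (x - X) * g'' x - bump'' r (x - X) * g x) has_integral 0) {X..X + r}"
    by (simp add: bump_def bump'_def)
  moreover have "continuous_on {X..X + r} g"
    using g(1) by (meson DERIV_continuous_on has_field_derivative_at_within)
  moreover have "continuous_on {X..X + r} g''" using c continuous_on_subset by blast
  then have "(\<lambda>x. bump r (x - X) * g'' x) integrable_on {X..X + r}"
    unfolding bump_def by (intro integrable_continuous_real continuous_intros)
  moreover have "(\<lambda>x. bump'' r (x - X) * g x) integrable_on {X..X + r}"
    unfolding bump''_def using calculation(2) by (intro integrable_continuous_real continuous_intros)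
  ultimately show ?thesis
    using integral_diff[of "\<lambda>x. bump r (x - X) * g'' x" "{X..X + r}" "\<lambda>x. bump'' r (x - X) * g x"]
    by (simp add: integral_unique)
qed

text \<open>Derivatives are recorded along the two coordinate directions because the integrations by
  parts run along coordinate lines.\<close>

locale plane_C2 =
  fixes w wx wy wxx wyy :: "real \<Rightarrow> real \<Rightarrow> real"
  assumes dx: "\<And>x y. ((\<lambda>x. w x y) has_real_derivative wx x y) (at x)"
    and dy: "\<And>x y. ((\<lambda>y. w x y) has_real_derivative wy x y) (at y)"
    and dxx: "\<And>x y. ((\<lambda>x. wx x y) has_real_derivative wxx x y) (at x)"
    and dyy: "\<And>x y. ((\<lambda>y. wy x y) has_real_derivative wyy x y) (at y)"
    and cw: "continuous_on UNIV (\<lambda>(x, y). w x y)"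
    and cwx: "continuous_on UNIV (\<lambda>(x, y). wx x y)"
    and cwy: "continuous_on UNIV (\<lambda>(x, y). wy x y)"
    and cwxx: "continuous_on UNIV (\<lambda>(x, y). wxx x y)"
    and cwyy: "continuous_on UNIV (\<lambda>(x, y). wyy x y)"
begin

lemma integral_bump_laplacian:
  assumes r: "r > 0"
  shows "integral (cbox (X, Y) (X + r, Y + r)) (\<lambda>(x, y). bump r (x - X) * bump r (y - Y) * (wxx x y + wyy x y)) =
    integral (cbox (X, Y) (X + r, Y + r)) (\<lambda>(x, y).
      (bump'' r (x - X) * bump r (y - Y) + bump r (x - X) * bump'' r (y - Y)) * w x y)"
proof -
  have cb: "continuous_on UNIV (\<lambda>(x, y). bump r (x - X) * bump r (y - Y) * u x y)"
    "continuous_on UNIV (\<lambda>(x, y). bump'' r (x - X) * bump r (y - Y) * u x y)"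
    "continuous_on UNIV (\<lambda>(x, y). bump r (x - X) * bump'' r (y - Y) * u x y)"
    if "continuous_on UNIV (\<lambda>(x, y). u x y)" for u :: "real \<Rightarrow> real \<Rightarrow> real"
    using that unfolding bump_def bump''_def case_prod_unfold by (auto intro!: continuous_intros)
  let ?Q = "cbox (X, Y) (X + r, Y + r)"
  have 1: "integral ?Q (\<lambda>(x, y). bump r (x - X) * bump r (y - Y) * wxx x y) =
    integral ?Q (\<lambda>(x, y). bump'' r (x - X) * bump r (y - Y) * w x y)"
  proof -
    have "integral {X..X + r} (\<lambda>x. bump r (x - X) * bump r (y - Y) * wxx x y) =
      integral {X..X + r} (\<lambda>x. bump'' r (x - X) * bump r (y - Y) * w x y)" for y
      using bump_by_parts[OF dx[where y = y] dxx[where y = y] plane_slices(1)[OF cwxx] r, of X]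
      by (simp add: mult.assoc mult.left_commute[of _ "bump r (y - Y)"])
    then show ?thesis
      unfolding integral_prod_swap(1)[OF cb(1)[OF cwxx]] integral_prod_swap(1)[OF cb(2)[OF cw]] by simp
  qed
  have 2: "integral ?Q (\<lambda>(x, y). bump r (x - X) * bump r (y - Y) * wyy x y) =
    integral ?Q (\<lambda>(x, y). bump r (x - X) * bump'' r (y - Y) * w x y)"
  proof -
    have "integral {Y..Y + r} (\<lambda>y. bump r (x - X) * bump r (y - Y) * wyy x y) =
      integral {Y..Y + r} (\<lambda>y. bump r (x - X) * bump'' r (y - Y) * w x y)" for x
      using bump_by_parts[OF dy[where x = x] dyy[where x = x] plane_slices(2)[OF cwyy] r, of Y]
      by (simp add: mult.assoc)
    then show ?thesis
      unfolding integral_prod_swap(2)[OF cb(1)[OF cwyy]] integral_prod_swap(2)[OF cb(3)[OF cw]] by simp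
  qed
  have add: "integral ?Q (\<lambda>(x, y). f x y + g x y) = integral ?Q (\<lambda>(x, y). f x y) + integral ?Q (\<lambda>(x, y). g x y)"
    if "continuous_on UNIV (\<lambda>(x, y). f x y)" "continuous_on UNIV (\<lambda>(x, y). g x y)" for f g :: "real \<Rightarrow> real \<Rightarrow> real"
    using integral_add[OF plane_integrable[OF that(1)] plane_integrable[OF that(2)], of "(X, Y)" "(X + r, Y + r)"]
    by (simp add: case_prod_unfold)
  show ?thesis
    unfolding distrib_left distrib_right add[OF cb(1)[OF cwxx] cb(1)[OF cwyy]] add[OF cb(2)[OF cw] cb(3)[OF cw]] 1 2 ..
qed

end

context plane_C2
begin

text \<open>A Caccioppoli-type estimate. Testing the Laplacian against a product of bumps moves both
  derivatives onto the bumps; this costs the factor of order $r^6$, against order $r^8$ for the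
  product of bumps on the inner box, whence $r^{-2}$.\<close>

lemma energy_le_integral:
  assumes nn: "\<And>x y. w x y \<ge> 0" and cq: "continuous_on UNIV (\<lambda>(x, y). q x y)"
    and q: "\<And>x y. q x y \<ge> 0" and lap: "\<And>x y. wxx x y + wyy x y = 2 * q x y"
    and r: "r > 0" and \<eta>: "0 < \<eta>" "\<eta> \<le> 1 / 2"
    and sub: "cbox (X + \<eta> * r, Y + \<eta> * r) (X + (1 - \<eta>) * r, Y + (1 - \<eta>) * r) \<supseteq> A"
    and A: "(\<lambda>(x, y). q x y) integrable_on A"
  shows "integral A (\<lambda>(x, y). q x y) \<le> 2 / (\<eta> ^ 4 * r\<^sup>2) * integral (cbox (X, Y) (X + r, Y + r)) (\<lambda>(x, y). w x y)"
proof -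
  let ?Q = "cbox (X, Y) (X + r, Y + r)"
  let ?I = "cbox (X + \<eta> * r, Y + \<eta> * r) (X + (1 - \<eta>) * r, Y + (1 - \<eta>) * r)"
  have IQ: "?I \<subseteq> ?Q"
  proof -
    have "0 \<le> \<eta> * r" "(1 - \<eta>) * r \<le> r" using r \<eta> by (auto intro: mult_left_le_one_le)
    then show ?thesis unfolding cbox_Pair_eq by (intro Sigma_mono) auto
  qed
  \<comment> \<open>The square of the lower bound \<eta>^2 r^4 / 4 that each bump satisfies on the
    inner box.\<close>
  define c where "c = \<eta> ^ 4 * r ^ 8 / 16"
  have c0: "c > 0" using r \<eta> by (auto simp: c_def)
  have bq: "continuous_on UNIV (\<lambda>(x, y). bump r (x - X) * bump r (y - Y) * u x y)"
    "continuous_on UNIV (\<lambda>(x, y). (bump'' r (x - X) * bump r (y - Y) + bump r (x - X) * bump'' r (y - Y)) * u x y)"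
    "continuous_on UNIV (\<lambda>(x, y). K * u x y)"
    if "continuous_on UNIV (\<lambda>(x, y). u x y)" for u :: "real \<Rightarrow> real \<Rightarrow> real" and K
    using that unfolding bump_def bump''_def case_prod_unfold by (auto intro!: continuous_intros)
  have bnn: "bump r t \<ge> 0" for t by (simp add: bump_def)
  have "c * integral A (\<lambda>(x, y). q x y) = integral A (\<lambda>(x, y). c * q x y)"
    by (simp add: case_prod_unfold)
  also have "\<dots> \<le> integral ?Q (\<lambda>(x, y). bump r (x - X) * bump r (y - Y) * q x y)"
  proof -
    have iA: "(\<lambda>(x, y). c * q x y) integrable_on A"
      using integrable_on_cmult_left[OF A, of c] by (simp add: case_prod_unfold)
    have iQ: "(\<lambda>(x, y). c * q x y) integrable_on ?I"
      by (rule plane_integrable[OF bq(3)[OF cq]])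
    have "integral A (\<lambda>(x, y). c * q x y) \<le> integral ?I (\<lambda>(x, y). c * q x y)"
      by (rule integral_subset_le[OF sub iA iQ]) (use c0 q in auto)
    also have "\<dots> \<le> integral ?I (\<lambda>(x, y). bump r (x - X) * bump r (y - Y) * q x y)"
    proof (rule integral_le[OF iQ plane_integrable[OF bq(1)[OF cq]]])
      fix p assume p: "p \<in> ?I"
      obtain x y where xy: "p = (x, y)" by (cases p)
      have "\<eta>\<^sup>2 * r ^ 4 / 4 \<le> bump r (x - X)"
        by (rule bump_lower) (use p xy \<eta> r in auto)
      moreover have "\<eta>\<^sup>2 * r ^ 4 / 4 \<le> bump r (y - Y)"
        by (rule bump_lower) (use p xy \<eta> r in auto)
      ultimately have "(\<eta>\<^sup>2 * r ^ 4 / 4) * (\<eta>\<^sup>2 * r ^ 4 / 4) \<le> bump r (x - X) * bump r (y - Y)"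
        by (intro mult_mono) (auto simp: bnn)
      moreover have "(\<eta>\<^sup>2 * r ^ 4 / 4) * (\<eta>\<^sup>2 * r ^ 4 / 4) = c"
        by (simp add: c_def power_add[symmetric] field_simps)
      ultimately show "(case p of (x, y) \<Rightarrow> c * q x y) \<le> (case p of (x, y) \<Rightarrow> bump r (x - X) * bump r (y - Y) * q x y)"
        using q xy by (auto intro: mult_right_mono)
    qed
    also have "\<dots> \<le> integral ?Q (\<lambda>(x, y). bump r (x - X) * bump r (y - Y) * q x y)"
      by (rule integral_subset_le[OF IQ plane_integrable[OF bq(1)[OF cq]] plane_integrable[OF bq(1)[OF cq]]])
        (auto simp: bnn q)
    finally show ?thesis .
  qed
  also have "\<dots> = (1 / 2) * integral ?Q (\<lambda>(x, y). bump r (x - X) * bump r (y - Y) * (wxx x y + wyy x y))"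
    by (simp add: lap case_prod_unfold mult.left_commute[of _ 2])
  also have "\<dots> = (1 / 2) * integral ?Q (\<lambda>(x, y).
      (bump'' r (x - X) * bump r (y - Y) + bump r (x - X) * bump'' r (y - Y)) * w x y)"
    by (simp add: integral_bump_laplacian[OF r])
  \<comment> \<open>Each of the two terms is at most $2 r^2$ times $r^4 / 16$. An upper bound on the
    Laplacian of the test function suffices as \<open>w\<close> is nonnegative.\<close>
  also have "\<dots> \<le> (1 / 2) * integral ?Q (\<lambda>(x, y). (r ^ 6 / 4) * w x y)"
  proof (intro mult_left_mono integral_le[OF plane_integrable[OF bq(2)[OF cw]] plane_integrable[OF bq(3)[OF cw]]])
    fix p assume p: "p \<in> ?Q"
    obtain x y where xy: "p = (x, y)" by (cases p)
    have b: "bump r (x - X) \<le> r ^ 4 / 16" "bump'' r (x - X) \<le> 2 * r\<^sup>2" "bump r (y - Y) \<le> r ^ 4 / 16" "bump'' r (y - Y) \<le> 2 * r\<^sup>2"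
      using bump_bounds[of "x - X" r] bump_bounds[of "y - Y" r] p xy by auto
    have "bump'' r (x - X) * bump r (y - Y) \<le> 2 * r\<^sup>2 * (r ^ 4 / 16)"
      using b bnn by (intro mult_mono) auto
    moreover have "bump r (x - X) * bump'' r (y - Y) \<le> (r ^ 4 / 16) * (2 * r\<^sup>2)"
      using b bnn[of "x - X"] r by (meson mult_left_mono mult_right_mono order_trans zero_le_power2 mult_nonneg_nonneg zero_le_numeral)
    moreover have "2 * r\<^sup>2 * (r ^ 4 / 16) + (r ^ 4 / 16) * (2 * r\<^sup>2) = r ^ 6 / 4"
      by (simp add: power_add[symmetric])
    ultimately have "bump'' r (x - X) * bump r (y - Y) + bump r (x - X) * bump'' r (y - Y) \<le> r ^ 6 / 4" by linarith
    then show "(case p of (x, y) \<Rightarrow> (bump'' r (x - X) * bump r (y - Y) + bump r (x - X) * bump'' r (y - Y)) * w x y)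
        \<le> (case p of (x, y) \<Rightarrow> (r ^ 6 / 4) * w x y)"
      unfolding xy prod.case by (rule mult_right_mono[OF _ nn])
  qed auto
  also have "\<dots> = r ^ 6 / 8 * integral ?Q (\<lambda>(x, y). w x y)"
    by (simp add: case_prod_unfold)
  finally have "integral A (\<lambda>(x, y). q x y) \<le> r ^ 6 / 8 / c * integral ?Q (\<lambda>(x, y). w x y)"
    using c0 by (simp add: field_simps)
  also have "r ^ 6 / 8 / c = 2 / (\<eta> ^ 4 * r\<^sup>2)"
    using r \<eta> by (simp add: c_def field_simps power_add[symmetric])
  finally show ?thesis .
qed

end

section \<open>Weighted means over discs under an upper bound on the Laplacian\<close>

lemma pos_part_square_deriv: "((\<lambda>s. (max 0 s)\<^sup>2) has_real_derivative 2 * max 0 s) (at s within A)"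
proof -
  consider "s > 0" | "s < 0" | "s = 0" by linarith
  then have "((\<lambda>s. (max 0 s)\<^sup>2) has_real_derivative 2 * max 0 s) (at s)"
  proof cases
    case 1
    have "((\<lambda>s. s\<^sup>2) has_real_derivative 2 * max 0 s) (at s)"
      using 1 by (auto intro!: derivative_eq_intros)
    then show ?thesis
      by (rule DERIV_cong_ev[THEN iffD1, rotated -1])
        (use 1 in \<open>auto simp: eventually_nhds intro!: exI[of _ "{0<..}"]\<close>)
  next
    case 2
    have "((\<lambda>s. 0) has_real_derivative 2 * max 0 s) (at s)"
      using 2 by (auto intro!: derivative_eq_intros)
    then show ?thesis
      by (rule DERIV_cong_ev[THEN iffD1, rotated -1])
        (use 2 in \<open>auto simp: eventually_nhds intro!: exI[of _ "{..<0}"]\<close>)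
  next
    case 3
    have "(\<lambda>h. ((max 0 h)\<^sup>2 - 0) / h) \<midarrow>0\<rightarrow> (0::real)"
    proof (rule Lim_null_comparison)
      show "\<forall>\<^sub>F h in at (0::real). norm (((max 0 h)\<^sup>2 - 0) / h) \<le> \<bar>h\<bar>"
        by (auto simp: eventually_at power2_eq_square max_def intro!: exI[of _ 1])
      show "((\<lambda>h. \<bar>h\<bar>) \<longlongrightarrow> 0) (at (0::real))"
        using tendsto_rabs[OF tendsto_ident_at, of "0::real" UNIV] by simp
    qed
    then show ?thesis using 3 by (simp add: has_field_derivative_iff)
  qed
  then show ?thesis by (rule has_field_derivative_at_within)
qed

text \<open>The weight \<open>\<kappa>\<close> is radial with \<open>z \<kappa>(z) = - \<nabla>\<psi>(z)\<close>, so the radial derivative of \<open>w\<close>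
  integrated against \<open>\<kappa>\<close> is the Laplacian integrated against \<open>\<psi>\<close>.\<close>

definition mean_weight :: "real \<Rightarrow> real \<Rightarrow> real" where "mean_weight x y = max 0 (1 - x\<^sup>2 - y\<^sup>2)"
definition mean_potential :: "real \<Rightarrow> real \<Rightarrow> real" where "mean_potential x y = (mean_weight x y)\<^sup>2 / 4"

lemma mean_potential_deriv:
  "((\<lambda>x. mean_potential x y) has_real_derivative - x * mean_weight x y) (at x within A)"
  "((\<lambda>y. mean_potential x y) has_real_derivative - y * mean_weight x y) (at y within A)"
proof -
  have "((\<lambda>x. (max 0 (1 - x\<^sup>2 - y\<^sup>2))\<^sup>2) has_real_derivative 2 * max 0 (1 - x\<^sup>2 - y\<^sup>2) * (- 2 * x)) (at x within A)"
    by (rule DERIV_chain2[OF pos_part_square_deriv]) (auto intro!: derivative_eq_intros)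
  from DERIV_cdivide[OF this, of 4]
  show "((\<lambda>x. mean_potential x y) has_real_derivative - x * mean_weight x y) (at x within A)"
    by (simp add: mean_potential_def mean_weight_def mult.commute)
  have "((\<lambda>y. (max 0 (1 - x\<^sup>2 - y\<^sup>2))\<^sup>2) has_real_derivative 2 * max 0 (1 - x\<^sup>2 - y\<^sup>2) * (- 2 * y)) (at y within A)"
    by (rule DERIV_chain2[OF pos_part_square_deriv]) (auto intro!: derivative_eq_intros)
  from DERIV_cdivide[OF this, of 4]
  show "((\<lambda>y. mean_potential x y) has_real_derivative - y * mean_weight x y) (at y within A)"
    by (simp add: mean_potential_def mean_weight_def mult.commute)
qed

lemma mean_weight_bounds:
  "0 \<le> mean_weight x y" "mean_weight x y \<le> 1" "0 \<le> mean_potential x y" "mean_potential x y \<le> 1 / 4"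
proof -
  show 1: "0 \<le> mean_weight x y" "mean_weight x y \<le> 1"
    using zero_le_power2[of x] zero_le_power2[of y] by (auto simp: mean_weight_def max_def simp del: zero_le_power2)
  then show "0 \<le> mean_potential x y" "mean_potential x y \<le> 1 / 4"
    using power_mono[of "mean_weight x y" 1 2] by (auto simp: mean_potential_def)
qed

text \<open>Since \<open>- x * v x\<close> is the derivative of \<open>u\<close> and
  \<open>u\<close> vanishes at both ends, the factor \<open>x\<close> on the left trades for a
  derivative of \<open>g\<close>; the factor \<open>t\<close> comes from the chain rule.\<close>

lemma mean_weight_by_parts:
  fixes g :: "real \<Rightarrow> real"
  assumes g: "\<And>x. (g has_real_derivative g' x) (at x)" and c: "continuous_on UNIV g'"
    and u: "\<And>x. (u has_real_derivative - x * v x) (at x within {-1..1})" "continuous_on {-1..1} v" "u (-1) = 0" "u 1 = 0"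
  shows "integral {-1..1} (\<lambda>x. v x * (x * g (x0 + t * x))) = t * integral {-1..1} (\<lambda>x. u x * g' (x0 + t * x))"
proof -
  have g1: "((\<lambda>x. g (x0 + t * x)) has_real_derivative g' (x0 + t * x) * t) (at x within {-1..1})" for x
    by (rule DERIV_chain2[OF g]) (auto intro!: derivative_eq_intros)
  have "((\<lambda>x. - x * v x * g (x0 + t * x) + g' (x0 + t * x) * t * u x) has_integral
      u 1 * g (x0 + t * 1) - u (-1) * g (x0 + t * (-1))) {-1..1}"
  proof (rule fundamental_theorem_of_calculus)
    fix x
    show "((\<lambda>x. u x * g (x0 + t * x)) has_vector_derivative
        - x * v x * g (x0 + t * x) + g' (x0 + t * x) * t * u x) (at x within {-1..1})"
      using DERIV_mult[OF u(1) g1] by (simp only: has_real_derivative_iff_has_vector_derivative)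
  qed simp
  then have "((\<lambda>x. t * (u x * g' (x0 + t * x)) - v x * (x * g (x0 + t * x))) has_integral 0) {-1..1}"
    using u(3,4) by (simp add: algebra_simps)
  moreover have "continuous_on {-1..1} u"
    by (rule DERIV_continuous_on[OF u(1)])
  moreover have "continuous_on {-1..1} (\<lambda>x. g' (x0 + t * x))"
    by (rule continuous_on_compose2[OF c]) (auto intro!: continuous_intros)
  moreover have "continuous_on {-1..1} (\<lambda>x. g (x0 + t * x))"
    by (rule DERIV_continuous_on[OF g1])
  ultimately have "(\<lambda>x. t * (u x * g' (x0 + t * x))) integrable_on {-1..1}"
    "(\<lambda>x. v x * (x * g (x0 + t * x))) integrable_on {-1..1}"
    using u(2) by (auto intro!: integrable_continuous_real continuous_intros)
  from integral_diff[OF this] show ?thesis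
    using \<open>((\<lambda>x. t * (u x * g' (x0 + t * x)) - v x * (x * g (x0 + t * x))) has_integral 0) {-1..1}\<close>
    by (simp add: integral_unique)
qed

context plane_C2
begin

text \<open>An unnormalised mean over the disc of radius \<open>t\<close>, as the weight vanishes
  off the unit disc. Rescaling \<open>w\<close> over a fixed square confines \<open>t\<close> to the
  integrand, where the Leibniz rule applies.\<close>

definition weighted_mean :: "real \<Rightarrow> real \<Rightarrow> real \<Rightarrow> real" where
  "weighted_mean x0 y0 t = integral (cbox (-1, -1) (1, 1)) (\<lambda>(x, y). mean_weight x y * w (x0 + t * x) (y0 + t * y))"

lemma continuous_on_scaled:
  assumes "continuous_on UNIV (\<lambda>(x, y). u x y)"
  shows "continuous_on UNIV (\<lambda>(x, y). u (x0 + t * x) (y0 + t * y :: real) :: real)"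
    "continuous_on UNIV (\<lambda>(t, (x, y)). u (x0 + t * x) (y0 + t * y) :: real)"
proof -
  have "continuous_on UNIV ((\<lambda>(x, y). u x y) \<circ> (\<lambda>(x, y). (x0 + t * x, y0 + t * y)))"
    unfolding case_prod_unfold
    by (intro continuous_on_compose continuous_intros continuous_on_subset[OF assms[unfolded case_prod_unfold]]) auto
  then show "continuous_on UNIV (\<lambda>(x, y). u (x0 + t * x) (y0 + t * y))"
    by (simp add: o_def case_prod_unfold)
  have "continuous_on UNIV ((\<lambda>(x, y). u x y) \<circ> (\<lambda>(t, (x, y)). (x0 + t * x, y0 + t * y)))"
    unfolding case_prod_unfold
    by (intro continuous_on_compose continuous_intros continuous_on_subset[OF assms[unfolded case_prod_unfold]]) auto
  then show "continuous_on UNIV (\<lambda>(t, (x, y)). u (x0 + t * x) (y0 + t * y))"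
    by (simp add: o_def case_prod_unfold)
qed

lemma continuous_mean_weight: "continuous_on UNIV (\<lambda>(x, y). mean_weight x y)"
  "continuous_on UNIV (\<lambda>(x, y). mean_potential x y)"
  unfolding mean_weight_def mean_potential_def case_prod_unfold by (auto intro!: continuous_intros)

text \<open>The chain rule in two variables needs total differentiability, which follows from the
  partial derivatives because \<open>wy\<close> is continuous.\<close>

lemma has_derivative_along:
  "((\<lambda>t. w (x0 + t * x) (y0 + t * y)) has_real_derivative
     x * wx (x0 + t * x) (y0 + t * y) + y * wy (x0 + t * x) (y0 + t * y)) (at t)"
proof -
  have lim: "((\<lambda>(x, y). blinfun_scaleR_left (wy x y)) \<longlongrightarrow> blinfun_scaleR_left (wy a b)) (at (a, b))" for a b
  proof -
    have "isCont (\<lambda>(x, y). wy x y) (a, b)" using cwy by (simp add: continuous_on_eq_continuous_at)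
    then have "((\<lambda>(x, y). wy x y) \<longlongrightarrow> wy a b) (at (a, b))" by (simp add: isCont_def)
    from bounded_linear.tendsto[OF bounded_linear_blinfun_scaleR_left this] show ?thesis
      by (simp add: case_prod_unfold)
  qed
  have D: "((\<lambda>(x, y). w x y) has_derivative
      (\<lambda>(hx, hy). wx a b * hx + blinfun_apply (blinfun_scaleR_left (wy a b)) hy)) (at (a, b) within UNIV \<times> UNIV)" for a b
  proof (rule has_derivative_partialsI[where fx = "\<lambda>h. wx a b * h" and fy = "\<lambda>x y. blinfun_scaleR_left (wy x y)"])
    show "((\<lambda>x. w x b) has_derivative (\<lambda>h. wx a b * h)) (at a within UNIV)"
      using dx by (simp add: has_field_derivative_def)
    show "((\<lambda>y. w x y) has_derivative blinfun_apply (blinfun_scaleR_left (wy x y))) (at y within UNIV)" for x y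
      using dy[of x y] unfolding has_field_derivative_def
      by (rule has_derivative_eq_rhs) (auto simp: mult.commute)
  qed (use lim in \<open>auto simp: isCont_def\<close>)
  have "((\<lambda>t. (x0 + t * x, y0 + t * y)) has_derivative (\<lambda>h. (h * x, h * y))) (at t)"
    by (auto intro!: derivative_eq_intros)
  from diff_chain_at[OF this D[of "x0 + t * x" "y0 + t * y", unfolded UNIV_Times_UNIV]]
  have "((\<lambda>t. w (x0 + t * x) (y0 + t * y)) has_derivative
      (\<lambda>h. wx (x0 + t * x) (y0 + t * y) * (h * x) + wy (x0 + t * x) (y0 + t * y) * (h * y))) (at t)"
    by (simp add: o_def mult.commute)
  then show ?thesis
    unfolding has_field_derivative_def by (rule has_derivative_eq_rhs) (auto simp: algebra_simps)
qed

lemma weighted_mean_deriv: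
  "(weighted_mean x0 y0 has_real_derivative
     t * integral (cbox (-1, -1) (1, 1)) (\<lambda>(x, y). mean_potential x y *
       (wxx (x0 + t * x) (y0 + t * y) + wyy (x0 + t * x) (y0 + t * y)))) (at t)"
proof -
  let ?B = "cbox (-1, -1) (1::real, 1::real)"
  let ?fx = "\<lambda>t (x, y). mean_weight x y * (x * wx (x0 + t * x) (y0 + t * y) + y * wy (x0 + t * x) (y0 + t * y))"
  have d: "((\<lambda>t. integral ?B (\<lambda>(x, y). mean_weight x y * w (x0 + t * x) (y0 + t * y))) has_real_derivative
      integral ?B (?fx t)) (at t within UNIV)"
  proof (rule leibniz_rule_field_derivative)
    fix t :: real and p :: "real \<times> real"
    obtain x y where p: "p = (x, y)" by (cases p)
    show "((\<lambda>t. case p of (x, y) \<Rightarrow> mean_weight x y * w (x0 + t * x) (y0 + t * y)) has_real_derivative ?fx t p) (at t within UNIV)"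
      unfolding p prod.case by (rule DERIV_cmult[OF has_derivative_along])
  next
    fix t :: real
    show "(\<lambda>(x, y). mean_weight x y * w (x0 + t * x) (y0 + t * y)) integrable_on ?B"
      by (rule plane_integrable) (use continuous_on_mult[OF continuous_mean_weight(1) continuous_on_scaled(1)[OF cw]]
          in \<open>simp add: case_prod_unfold\<close>)
  next
    have "continuous_on UNIV (\<lambda>(t, p). ?fx t p)"
      using continuous_on_scaled(2)[OF cwx] continuous_on_scaled(2)[OF cwy]
      unfolding case_prod_unfold mean_weight_def
      by (auto intro!: continuous_intros)
    then show "continuous_on (UNIV \<times> ?B) (\<lambda>(t, p). ?fx t p)"
      using continuous_on_subset by blast
  qed auto
  have s: "continuous_on UNIV (\<lambda>(x, y). k x y * u (x0 + t * x) (y0 + t * y))"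
    if "continuous_on UNIV (\<lambda>(x, y). k x y)" "continuous_on UNIV (\<lambda>(x, y). u x y)" for k u :: "real \<Rightarrow> real \<Rightarrow> real"
    using continuous_on_mult[OF that(1) continuous_on_scaled(1)[OF that(2), of x0 t y0]] by (simp add: case_prod_unfold)
  have cxw: "continuous_on UNIV (\<lambda>(x, y). mean_weight x y * x)" "continuous_on UNIV (\<lambda>(x, y). mean_weight x y * y)"
    unfolding mean_weight_def case_prod_unfold by (auto intro!: continuous_intros)
  \<comment> \<open>On the boundary of the square $1 - x^2 - y^2$ is at most 0, so the boundary
    terms disappear.\<close>
  have zero: "mean_potential x y = 0" if "\<bar>x\<bar> = 1 \<or> \<bar>y\<bar> = 1" for x y
    using that by (auto simp: mean_potential_def mean_weight_def abs_square_eq_1 power2_eq_1_iff abs_eq_iff')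
  have x: "integral ?B (\<lambda>(x, y). mean_weight x y * x * wx (x0 + t * x) (y0 + t * y)) =
      t * integral ?B (\<lambda>(x, y). mean_potential x y * wxx (x0 + t * x) (y0 + t * y))"
  proof -
    have "integral {-1..1} (\<lambda>x. mean_weight x y * x * wx (x0 + t * x) (y0 + t * y)) =
        t * integral {-1..1} (\<lambda>x. mean_potential x y * wxx (x0 + t * x) (y0 + t * y))" for y
      using mean_weight_by_parts[OF dxx[where y = "y0 + t * y"] plane_slices(1)[OF cwxx] mean_potential_deriv(1)[where y = y]
          plane_slices(1)[OF continuous_mean_weight(1)] zero zero, of x0 t] by (simp add: mult.assoc)
    then show ?thesis
      unfolding integral_prod_swap(1)[OF s[OF cxw(1) cwx]] integral_prod_swap(1)[OF s[OF continuous_mean_weight(2) cwxx]] by simp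
  qed
  have y: "integral ?B (\<lambda>(x, y). mean_weight x y * y * wy (x0 + t * x) (y0 + t * y)) =
      t * integral ?B (\<lambda>(x, y). mean_potential x y * wyy (x0 + t * x) (y0 + t * y))"
  proof -
    have "integral {-1..1} (\<lambda>y. mean_weight x y * y * wy (x0 + t * x) (y0 + t * y)) =
        t * integral {-1..1} (\<lambda>y. mean_potential x y * wyy (x0 + t * x) (y0 + t * y))" for x
      using mean_weight_by_parts[OF dyy[where x = "x0 + t * x"] plane_slices(2)[OF cwyy] mean_potential_deriv(2)[where x = x]
          plane_slices(2)[OF continuous_mean_weight(1)] zero zero, of y0 t] by (simp add: mult.assoc)
    then show ?thesis
      unfolding integral_prod_swap(2)[OF s[OF cxw(2) cwy]] integral_prod_swap(2)[OF s[OF continuous_mean_weight(2) cwyy]] by simp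
  qed
  have add: "integral ?B (\<lambda>(x, y). f x y + g x y) = integral ?B (\<lambda>(x, y). f x y) + integral ?B (\<lambda>(x, y). g x y)"
    if "continuous_on UNIV (\<lambda>(x, y). f x y)" "continuous_on UNIV (\<lambda>(x, y). g x y)" for f g :: "real \<Rightarrow> real \<Rightarrow> real"
    using integral_add[OF plane_integrable[OF that(1)] plane_integrable[OF that(2)], of "(-1, -1)" "(1, 1)"]
    by (simp add: case_prod_unfold)
  have "integral ?B (?fx t) = t * integral ?B (\<lambda>(x, y). mean_potential x y *
       (wxx (x0 + t * x) (y0 + t * y) + wyy (x0 + t * x) (y0 + t * y)))"
    unfolding distrib_left add[OF s[OF continuous_mean_weight(2) cwxx] s[OF continuous_mean_weight(2) cwyy]]
      mult.assoc[symmetric] add[OF s[OF cxw(1) cwx] s[OF cxw(2) cwy]] x y ..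
  then show ?thesis using d by (simp add: weighted_mean_def[abs_def])
qed

end

context plane_C2
begin

text \<open>The potential is at most 1/4, the Laplacian at most 2 and the square has area 4, so the
  mean grows at a rate of at most \<open>2 * t\<close>. Its value at 0 is at most
  \<open>4 * w x0 y0\<close>, as the weight is at most 1.\<close>

lemma weighted_mean_le:
  assumes nn: "\<And>x y. w x y \<ge> 0" and lap: "\<And>x y. wxx x y + wyy x y \<le> 2" and t: "t \<ge> 0"
  shows "weighted_mean x0 y0 t \<le> 4 * w x0 y0 + t\<^sup>2"
proof -
  let ?B = "cbox (-1, -1) (1::real, 1::real)"
  have B: "measure lborel ?B = 4" by (simp add: content_Pair)
  have const: "integral ?B (\<lambda>_. c) = 4 * c" for c :: real
    by (simp add: integral_const B)
  let ?P = "\<lambda>t. integral ?B (\<lambda>(x, y). mean_potential x y * (wxx (x0 + t * x) (y0 + t * y) + wyy (x0 + t * x) (y0 + t * y)))"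
  have P: "?P s \<le> 2" for s
  proof -
    have "?P s \<le> integral ?B (\<lambda>_. 1 / 2)"
    proof (rule integral_le)
      have "continuous_on UNIV (\<lambda>(x, y). mean_potential x y * (wxx (x0 + s * x) (y0 + s * y) + wyy (x0 + s * x) (y0 + s * y)))"
        using continuous_on_scaled(1)[OF cwxx, of x0 s y0] continuous_on_scaled(1)[OF cwyy, of x0 s y0]
          continuous_mean_weight(2)
        unfolding case_prod_unfold by (intro continuous_on_mult continuous_on_add)
      then show "(\<lambda>(x, y). mean_potential x y * (wxx (x0 + s * x) (y0 + s * y) + wyy (x0 + s * x) (y0 + s * y))) integrable_on ?B"
        by (rule plane_integrable)
      fix p :: "real \<times> real"
      obtain x y where p: "p = (x, y)" by (cases p)
      have "mean_potential x y * (wxx (x0 + s * x) (y0 + s * y) + wyy (x0 + s * x) (y0 + s * y)) \<le> mean_potential x y * 2"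
        by (intro mult_left_mono lap mean_weight_bounds)
      also have "\<dots> \<le> 1 / 2" using mean_weight_bounds(4)[of x y] by simp
      finally show "(case p of (x, y) \<Rightarrow> mean_potential x y * (wxx (x0 + s * x) (y0 + s * y) + wyy (x0 + s * x) (y0 + s * y))) \<le> 1 / 2"
        by (simp add: p)
    qed (simp add: integrable_const)
    then show ?thesis unfolding const by simp
  qed
  have "weighted_mean x0 y0 t - t\<^sup>2 \<le> weighted_mean x0 y0 0 - 0\<^sup>2"
  proof (rule DERIV_nonpos_imp_nonincreasing[OF t])
    fix s assume s: "0 \<le> s" "s \<le> t"
    have "((\<lambda>s. weighted_mean x0 y0 s - s\<^sup>2) has_real_derivative s * ?P s - 2 * s) (at s)"
      using weighted_mean_deriv[of x0 y0 s] by (auto intro!: derivative_eq_intros)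
    moreover have "s * ?P s \<le> s * 2" using P[of s] s by (intro mult_left_mono)
    ultimately show "\<exists>y. ((\<lambda>s. weighted_mean x0 y0 s - s\<^sup>2) has_real_derivative y) (at s) \<and> y \<le> 0"
      by (intro exI conjI) auto
  qed
  moreover have "weighted_mean x0 y0 0 \<le> 4 * w x0 y0"
  proof -
    have "weighted_mean x0 y0 0 \<le> integral ?B (\<lambda>_. w x0 y0)"
      unfolding weighted_mean_def
    proof (rule integral_le)
      have "continuous_on UNIV (\<lambda>(x, y). mean_weight x y * w (x0 + 0 * x) (y0 + 0 * y))"
        using continuous_mean_weight(1) unfolding case_prod_unfold by (auto intro!: continuous_intros)
      then show "(\<lambda>(x, y). mean_weight x y * w (x0 + 0 * x) (y0 + 0 * y)) integrable_on ?B"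
        by (rule plane_integrable)
    qed (auto intro!: mult_left_le_one_le nn mean_weight_bounds)
    then show ?thesis unfolding const .
  qed
  ultimately show ?thesis by simp
qed

text \<open>One small value of the nonnegative function \<open>w\<close> controls its integral over
  the whole box, since an upper bound on the Laplacian limits how fast means around that point can
  grow.\<close>

lemma box_integral_le:
  assumes nn: "\<And>x y. w x y \<ge> 0" and lap: "\<And>x y. wxx x y + wyy x y \<le> 2"
    and l: "l > 0" and z0: "(x0, y0) \<in> cbox (X, Y) (X + l, Y + l)"
  shows "integral (cbox (X, Y) (X + l, Y + l)) (\<lambda>(x, y). w x y) \<le> 32 * l\<^sup>2 * (w x0 y0 + l\<^sup>2)"
proof -
  let ?f = "\<lambda>(x, y). w x y"
  let ?C = "cbox (x0 - l, y0 - l) (x0 + l, y0 + l)"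
  let ?H = "cbox (-1/2, -1/2) (1/2, 1/2) :: (real \<times> real) set"
  let ?B = "cbox (-1, -1) (1::real, 1::real)"
  have "(?f has_integral integral ?C ?f) ?C"
    by (intro integrable_integral plane_integrable cw)
  \<comment> \<open>Shrinking by \<open>2 * l\<close> carries the square \<open>?C\<close> about the
    base point onto \<open>?H\<close>, where the weight is at least 1 - 1/4 - 1/4 = 1/2.\<close>
  from has_integral_affinity'[OF this, of "2 * l" "(x0, y0)"]
  have "((\<lambda>p. ?f ((2 * l) *\<^sub>R p + (x0, y0))) has_integral integral ?C ?f /\<^sub>R (2 * l) ^ DIM(real \<times> real))
      (cbox (((x0 - l, y0 - l) - (x0, y0)) /\<^sub>R (2 * l)) (((x0 + l, y0 + l) - (x0, y0)) /\<^sub>R (2 * l)))"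
    using l by simp
  moreover have "(\<lambda>p. ?f ((2 * l) *\<^sub>R p + (x0, y0))) = (\<lambda>(x, y). w (x0 + 2 * l * x) (y0 + 2 * l * y))"
    by (auto simp: fun_eq_iff add.commute)
  moreover have "((x0 - l, y0 - l) - (x0, y0)) /\<^sub>R (2 * l) = (- 1 / 2, - 1 / 2)"
    "((x0 + l, y0 + l) - (x0, y0)) /\<^sub>R (2 * l) = (1 / 2, 1 / 2)"
    using l by (simp_all add: field_simps)
  moreover have "integral ?C ?f /\<^sub>R (2 * l) ^ DIM(real \<times> real) = integral ?C ?f / (4 * l\<^sup>2)"
  proof -
    have "DIM(real \<times> real) = 2" by simp
    then show ?thesis by (simp only: power_mult_distrib real_scaleR_def divide_inverse) (simp add: mult.commute)
  qed
  ultimately have H: "((\<lambda>(x, y). w (x0 + 2 * l * x) (y0 + 2 * l * y)) has_integral integral ?C ?f / (4 * l\<^sup>2)) ?H"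
    by (simp only:)
  have ints: "(\<lambda>(x, y). mean_weight x y * w (x0 + 2 * l * x) (y0 + 2 * l * y)) integrable_on cbox p p'" for p p'
  proof -
    have "continuous_on UNIV (\<lambda>(x, y). mean_weight x y * w (x0 + 2 * l * x) (y0 + 2 * l * y))"
      using continuous_on_mult[OF continuous_mean_weight(1) continuous_on_scaled(1)[OF cw, of x0 "2 * l" y0]]
      by (simp add: case_prod_unfold)
    then show ?thesis by (rule plane_integrable)
  qed
  have "integral (cbox (X, Y) (X + l, Y + l)) ?f \<le> integral ?C ?f"
    by (rule integral_subset_le) (use z0 nn in \<open>auto intro!: plane_integrable cw\<close>)
  also have "\<dots> = 8 * l\<^sup>2 * integral ?H (\<lambda>(x, y). (1 / 2) * w (x0 + 2 * l * x) (y0 + 2 * l * y))"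
    using integral_unique[OF H] l by (simp add: case_prod_unfold)
  also have "\<dots> \<le> 8 * l\<^sup>2 * integral ?H (\<lambda>(x, y). mean_weight x y * w (x0 + 2 * l * x) (y0 + 2 * l * y))"
  proof (intro mult_left_mono integral_le ints)
    show "(\<lambda>(x, y). (1 / 2) * w (x0 + 2 * l * x) (y0 + 2 * l * y)) integrable_on ?H"
      using has_integral_integrable[OF has_integral_mult_right[OF H, of "1 / 2"]] by (simp add: case_prod_unfold)
    fix p assume p: "p \<in> ?H"
    obtain x y where xy: "p = (x, y)" by (cases p)
    have "x\<^sup>2 \<le> (1/2)\<^sup>2" "y\<^sup>2 \<le> (1/2)\<^sup>2"
      using p xy by (auto simp: abs_le_square_iff[symmetric])
    then have "1 / 2 \<le> mean_weight x y" by (simp add: mean_weight_def power2_eq_square)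
    then show "(case p of (x, y) \<Rightarrow> (1 / 2) * w (x0 + 2 * l * x) (y0 + 2 * l * y)) \<le>
        (case p of (x, y) \<Rightarrow> mean_weight x y * w (x0 + 2 * l * x) (y0 + 2 * l * y))"
      unfolding xy prod.case by (intro mult_right_mono nn)
  qed auto
  also have "\<dots> \<le> 8 * l\<^sup>2 * weighted_mean x0 y0 (2 * l)"
    unfolding weighted_mean_def
    by (intro mult_left_mono integral_subset_le ints) (auto intro!: mult_nonneg_nonneg nn mean_weight_bounds)
  also have "\<dots> \<le> 8 * l\<^sup>2 * (4 * w x0 y0 + (2 * l)\<^sup>2)"
    using l by (intro mult_left_mono weighted_mean_le nn lap) auto
  finally show ?thesis by (simp add: algebra_simps power2_eq_square)
qed

end

section \<open>Counting grid squares that carry energy\<close>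

definition grid_square :: "real \<Rightarrow> real \<Rightarrow> real \<Rightarrow> nat \<times> nat \<Rightarrow> (real \<times> real) set" where
  "grid_square X Y L = (\<lambda>(a, b).
     cbox (X + real a * L, Y + real b * L) (X + real (Suc a) * L, Y + real (Suc b) * L))"

text \<open>A square outside the inner box has a coordinate in one of two end strips of at most
  \<open>\<eta> * s + 1\<close> indices each; the reflection \<open>s - Suc a\<close> carries the
  right strip into the left one.\<close>

lemma card_margin:
  fixes \<eta> :: real and s :: nat
  assumes "0 \<le> \<eta>" "\<eta> \<le> 1"
  shows "real (card {g \<in> {..<s} \<times> {..<s}. case g of (a, b) \<Rightarrow>
     \<not> (\<eta> * s \<le> a \<and> Suc a \<le> (1 - \<eta>) * s \<and> \<eta> * s \<le> b \<and> Suc b \<le> (1 - \<eta>) * s)}) \<le> 4 * s * (\<eta> * s + 1)"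
proof -
  define M1 where "M1 = {a \<in> {..<s}. real a < \<eta> * s}"
  define M2 where "M2 = {a \<in> {..<s}. real (Suc a) > (1 - \<eta>) * s}"
  have n0: "0 \<le> \<eta> * s" using assms by simp
  have c: "card {a :: nat. real a < u} \<le> nat \<lceil>u\<rceil>" "finite {a :: nat. real a < u}" for u
  proof -
    have "{a :: nat. real a < u} \<subseteq> {..<nat \<lceil>u\<rceil>}" by (auto simp: zless_nat_conj less_ceiling_iff nat_less_iff zless_nat_eq_int_zless)
    then show "card {a :: nat. real a < u} \<le> nat \<lceil>u\<rceil>" "finite {a :: nat. real a < u}"
      using card_mono[of "{..<nat \<lceil>u\<rceil>}"] finite_subset by (fastforce, blast)
  qed
  have u: "real (nat \<lceil>\<eta> * s\<rceil>) \<le> \<eta> * s + 1" using n0 by linarith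
  have "M1 \<subseteq> {a. real a < \<eta> * s}" by (auto simp: M1_def)
  then have 1: "real (card M1) \<le> \<eta> * s + 1"
    using card_mono[OF c(2)] c(1)[of "\<eta> * s"] u by (meson of_nat_le_iff order_trans)
  have "(\<lambda>a. s - Suc a) ` M2 \<subseteq> {a. real a < \<eta> * s}"
    by (auto simp: M2_def of_nat_diff algebra_simps)
  moreover have "inj_on (\<lambda>a. s - Suc a) M2" by (auto simp: inj_on_def M2_def)
  ultimately have "card M2 \<le> card {a. real a < \<eta> * s}" using c(2) card_inj_on_le by blast
  then have 2: "real (card M2) \<le> \<eta> * s + 1" using c(1)[of "\<eta> * s"] u by (meson of_nat_le_iff order_trans)
  let ?M = "M1 \<union> M2"
  have fin: "finite ?M" by (auto simp: M1_def M2_def)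
  have M: "real (card ?M) \<le> 2 * (\<eta> * s + 1)"
    using 1 2 of_nat_mono[OF card_Un_le[of M1 M2], where 'a = real] by simp
  have "{g \<in> {..<s} \<times> {..<s}. case g of (a, b) \<Rightarrow>
     \<not> (\<eta> * s \<le> a \<and> Suc a \<le> (1 - \<eta>) * s \<and> \<eta> * s \<le> b \<and> Suc b \<le> (1 - \<eta>) * s)} \<subseteq> ?M \<times> {..<s} \<union> {..<s} \<times> ?M"
    by (auto simp: M1_def M2_def not_le)
  then have "card {g \<in> {..<s} \<times> {..<s}. case g of (a, b) \<Rightarrow>
     \<not> (\<eta> * s \<le> a \<and> Suc a \<le> (1 - \<eta>) * s \<and> \<eta> * s \<le> b \<and> Suc b \<le> (1 - \<eta>) * s)} \<le> card (?M \<times> {..<s} \<union> {..<s} \<times> ?M)"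
    using fin by (intro card_mono) auto
  also have "\<dots> \<le> 2 * (card ?M * s)"
    using card_Un_le[of "?M \<times> {..<s}" "{..<s} \<times> ?M"] by (simp add: card_cartesian_product mult.commute)
  finally have "real (card {g \<in> {..<s} \<times> {..<s}. case g of (a, b) \<Rightarrow>
     \<not> (\<eta> * s \<le> a \<and> Suc a \<le> (1 - \<eta>) * s \<and> \<eta> * s \<le> b \<and> Suc b \<le> (1 - \<eta>) * s)}) \<le> real (2 * (card ?M * s))"
    by (rule of_nat_mono)
  also have "\<dots> = 2 * (real (card ?M) * s)" by simp
  also have "\<dots> \<le> 2 * (2 * (\<eta> * s + 1) * s)" using M by (intro mult_left_mono mult_right_mono) auto
  finally show ?thesis by (simp add: algebra_simps)
qed

context plane_C2
begin

text \<open>Each of the \<open>k * k\<close> subboxes has a point with \<open>w\<close> at most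
  \<open>T\<close>, which bounds the integral of \<open>w\<close> over the big box and hence the
  energy in the inner box. That energy limits the inner members of \<open>G\<close>; the first
  summand pays for the margin, where the bump is small.\<close>

lemma card_energetic_squares_le:
  fixes k t s :: nat and \<eta> L T e :: real
  assumes nn: "\<And>x y. w x y \<ge> 0" and cq: "continuous_on UNIV (\<lambda>(x, y). q x y)"
    and q: "\<And>x y. 0 \<le> q x y" "\<And>x y. q x y \<le> 1" and lap: "\<And>x y. wxx x y + wyy x y = 2 * q x y"
    and L: "L > 0" and \<eta>: "0 < \<eta>" "\<eta> \<le> 1 / 2" and k: "k > 0" and t: "t > 0" and s: "s = k * t"
    and low: "\<And>a b. a < k \<Longrightarrow> b < k \<Longrightarrow> \<exists>x y. (x, y) \<in> grid_square X Y (t * L) (a, b) \<and> w x y \<le> T"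
    and G: "G \<subseteq> {..<s} \<times> {..<s}" and e: "e > 0" "\<And>g. g \<in> G \<Longrightarrow> e \<le> integral (grid_square X Y L g) (\<lambda>(x, y). q x y)"
  shows "real (card G) \<le> 4 * s * (\<eta> * s + 1) + 64 * (T + (t * L)\<^sup>2) / (e * \<eta> ^ 4)"
proof -
  define l where "l = real t * L"
  define r where "r = real s * L"
  have l: "l > 0" and r: "r > 0" "r = real k * l" using L t k s by (auto simp: l_def r_def)
  let ?Q = "cbox (X, Y) (X + r, Y + r)"
  let ?q = "\<lambda>(x, y). q x y" and ?w = "\<lambda>(x, y). w x y"
  have "integral ?Q ?w \<le> (\<Sum>g\<in>{..<k} \<times> {..<k}. integral (grid_square X Y l g) ?w)"
  proof -
    have I: "(?w has_integral (\<Sum>g\<in>{..<k} \<times> {..<k}. integral (grid_square X Y l g) ?w))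
        (\<Union>g\<in>{..<k} \<times> {..<k}. grid_square X Y l g)"
      unfolding grid_square_def by (rule integral_grid[OF cw _ l]) auto
    have "?Q \<subseteq> (\<Union>g\<in>{..<k} \<times> {..<k}. grid_square X Y l g)"
      unfolding grid_square_def r(2) by (rule grid_union(2)[OF l k])
    then show ?thesis
      by (rule has_integral_subset_le[OF _ integrable_integral[OF plane_integrable[OF cw]] I])
        (simp add: nn case_prod_unfold)
  qed
  also have "\<dots> \<le> (\<Sum>g\<in>{..<k} \<times> {..<k}. 32 * l\<^sup>2 * (T + l\<^sup>2))"
  proof (rule sum_mono)
    fix g assume "g \<in> {..<k} \<times> {..<k}"
    then obtain a b where g: "g = (a, b)" "a < k" "b < k" by auto
    obtain x y where xy: "(x, y) \<in> grid_square X Y l (a, b)" "w x y \<le> T"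
      using low[OF g(2,3)] by (auto simp: l_def)
    have sq: "grid_square X Y l g = cbox (X + a * l, Y + b * l) (X + a * l + l, Y + b * l + l)"
      by (simp add: grid_square_def g algebra_simps)
    have lap2: "wxx x y + wyy x y \<le> 2" for x y using lap[of x y] q(2)[of x y] by simp
    have "integral (grid_square X Y l g) ?w \<le> 32 * l\<^sup>2 * (w x y + l\<^sup>2)"
      unfolding sq by (rule box_integral_le[OF nn lap2 l]) (use xy g sq in auto)
    also have "\<dots> \<le> 32 * l\<^sup>2 * (T + l\<^sup>2)" using xy by (intro mult_left_mono) auto
    finally show "integral (grid_square X Y l g) ?w \<le> 32 * l\<^sup>2 * (T + l\<^sup>2)" .
  qed
  also have "\<dots> = 32 * r\<^sup>2 * (T + l\<^sup>2)" by (simp add: r(2) card_cartesian_product power2_eq_square)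
  finally have Iw: "integral ?Q ?w \<le> 32 * r\<^sup>2 * (T + l\<^sup>2)" .
  define inner where "inner = (\<lambda>(a :: nat, b :: nat). \<eta> * s \<le> a \<and> Suc a \<le> (1 - \<eta>) * s \<and> \<eta> * s \<le> b \<and> Suc b \<le> (1 - \<eta>) * s)"
  define G' where "G' = {g \<in> G. inner g}"
  define A where "A = (\<Union>g\<in>G'. grid_square X Y L g)"
  have fG: "finite G" using G by (rule finite_subset) auto
  then have fG': "finite G'" by (simp add: G'_def)
  have IA: "(?q has_integral (\<Sum>g\<in>G'. integral (grid_square X Y L g) ?q)) A"
    unfolding A_def grid_square_def by (rule integral_grid[OF cq fG' L])
  have "A \<subseteq> cbox (X + \<eta> * r, Y + \<eta> * r) (X + (1 - \<eta>) * r, Y + (1 - \<eta>) * r)"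
  proof
    fix p assume "p \<in> A"
    then obtain a b where ab: "inner (a, b)" "p \<in> grid_square X Y L (a, b)" by (auto simp: A_def G'_def)
    have "\<eta> * s * L \<le> a * L" "Suc a * L \<le> (1 - \<eta>) * s * L" "\<eta> * s * L \<le> b * L" "Suc b * L \<le> (1 - \<eta>) * s * L"
      using ab(1) L by (auto simp: inner_def intro!: mult_right_mono)
    then show "p \<in> cbox (X + \<eta> * r, Y + \<eta> * r) (X + (1 - \<eta>) * r, Y + (1 - \<eta>) * r)"
      using ab(2) by (cases p) (auto simp: grid_square_def r_def mult.assoc)
  qed
  from energy_le_integral[OF nn cq q(1) lap r(1) \<eta> this has_integral_integrable[OF IA]]
  have "(\<Sum>g\<in>G'. integral (grid_square X Y L g) ?q) \<le> 2 / (\<eta> ^ 4 * r\<^sup>2) * integral ?Q ?w"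
    using integral_unique[OF IA] by simp
  also have "\<dots> \<le> 2 / (\<eta> ^ 4 * r\<^sup>2) * (32 * r\<^sup>2 * (T + l\<^sup>2))"
    using Iw \<eta> by (intro mult_left_mono) auto
  also have "\<dots> = 64 * (T + l\<^sup>2) / \<eta> ^ 4" using r(1) by simp
  finally have "(\<Sum>g\<in>G'. integral (grid_square X Y L g) ?q) \<le> 64 * (T + l\<^sup>2) / \<eta> ^ 4" .
  moreover have "(\<Sum>g\<in>G'. e) \<le> (\<Sum>g\<in>G'. integral (grid_square X Y L g) ?q)"
    by (rule sum_mono) (use e(2) in \<open>simp add: G'_def\<close>)
  ultimately have "(\<Sum>g\<in>G'. e) \<le> 64 * (T + l\<^sup>2) / \<eta> ^ 4" by linarith
  then have 1: "real (card G') \<le> 64 * (T + l\<^sup>2) / (e * \<eta> ^ 4)"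
    using e(1) \<eta> by (simp add: field_simps)
  have "G \<subseteq> G' \<union> {g \<in> {..<s} \<times> {..<s}. \<not> inner g}" using G by (auto simp: G'_def)
  then have "card G \<le> card (G' \<union> {g \<in> {..<s} \<times> {..<s}. \<not> inner g})"
    using fG' by (intro card_mono) auto
  also have "\<dots> \<le> card G' + card {g \<in> {..<s} \<times> {..<s}. \<not> inner g}" by (rule card_Un_le)
  finally have "real (card G) \<le> real (card G') + real (card {g \<in> {..<s} \<times> {..<s}. \<not> inner g})" by linarith
  moreover have "real (card {g \<in> {..<s} \<times> {..<s}. \<not> inner g}) \<le> 4 * s * (\<eta> * s + 1)"
    using card_margin[of \<eta> s] \<eta> by (simp add: inner_def case_prod_unfold)
  ultimately show ?thesis using 1 by (simp add: l_def)
qed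

end

section \<open>Energy of squares with large oscillation\<close>

lemma norm_diff_le_integral:
  fixes g :: "real \<Rightarrow> complex"
  assumes g: "\<And>t. (g has_vector_derivative g' t) (at t)" and b: "\<And>t. norm (g' t) \<le> h t"
    and h: "continuous_on UNIV h" and ab: "a \<le> b"
  shows "norm (g b - g a) \<le> integral {a..b} h"
proof -
  have "(g' has_integral (g b - g a)) {a..b}"
    by (rule fundamental_theorem_of_calculus[OF ab]) (rule has_vector_derivative_at_within[OF g])
  moreover have "h integrable_on {a..b}"
    using continuous_on_subset[OF h] by (intro integrable_continuous_real) auto
  ultimately show ?thesis
    using integral_norm_bound_integral[of g' "{a..b}" h] b by (auto simp: has_integral_iff)
qed

text \<open>On each horizontal segment of the strip the oscillation forces the integral of
  \<open>m\<close> to be at least \<open>d\<close>, hence that of its square to be at least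
  \<open>d\<^sup>2 / L\<close>; this is integrated over the heights from \<open>a\<close> to
  \<open>b\<close>.\<close>

lemma strip_energy:
  fixes m :: "real \<Rightarrow> real \<Rightarrow> real" and g :: "real \<Rightarrow> real \<Rightarrow> complex"
  assumes gx: "\<And>x y. ((\<lambda>x. g x y) has_vector_derivative gx x y) (at x)" "\<And>x y. norm (gx x y) \<le> 2 * m x y"
    and m: "continuous_on UNIV (\<lambda>(x, y). m x y)" "\<And>x y. 0 \<le> m x y"
    and L: "L > 0" and d: "d > 0" and ab: "a \<le> b" "Y \<le> a" "b \<le> Y + L"
    and x: "X \<le> x1" "x1 \<le> x2" "x2 \<le> X + L"
    and osc: "\<And>y. a \<le> y \<Longrightarrow> y \<le> b \<Longrightarrow> 2 * d \<le> norm (g x2 y - g x1 y)"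
  shows "(b - a) * (d\<^sup>2 / L) \<le> integral (cbox (X, Y) (X + L, Y + L)) (\<lambda>(x, y). (m x y)\<^sup>2)"
proof -
  have m2: "continuous_on UNIV (\<lambda>(x, y). (m x y)\<^sup>2)"
    using m(1) unfolding case_prod_unfold by (intro continuous_intros)
  have line: "d\<^sup>2 / L \<le> integral {X..X + L} (\<lambda>x. (m x y)\<^sup>2)" if y: "a \<le> y" "y \<le> b" for y
  proof -
    have cm: "continuous_on S (\<lambda>x. m x y)" for S by (rule plane_slices(1)[OF m(1)])
    have "norm (g x2 y - g x1 y) \<le> integral {x1..x2} (\<lambda>x. 2 * m x y)"
      by (rule norm_diff_le_integral[OF gx]) (use x cm in \<open>auto intro!: continuous_intros\<close>)
    also have "\<dots> \<le> integral {X..X + L} (\<lambda>x. 2 * m x y)"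
      by (rule integral_subset_le) (use x m(2) cm in \<open>auto intro!: integrable_continuous_real continuous_intros\<close>)
    finally have 1: "d \<le> integral {X..X + L} (\<lambda>x. m x y)" using osc[OF y] by simp
    \<comment> \<open>Cauchy-Schwarz in arithmetic-geometric form: the constant is chosen to
      integrate to \<open>d / 2\<close>, half of the known lower bound.\<close>
    have "integral {X..X + L} (\<lambda>x. m x y) \<le> integral {X..X + L} (\<lambda>x. L / (2 * d) * (m x y)\<^sup>2 + d / (2 * L))"
    proof (rule integral_le)
      fix x
      have "0 \<le> (L * m x y - d)\<^sup>2" by simp
      then have "2 * d * L * m x y \<le> L\<^sup>2 * (m x y)\<^sup>2 + d\<^sup>2" by (simp add: power2_eq_square algebra_simps)
      then show "m x y \<le> L / (2 * d) * (m x y)\<^sup>2 + d / (2 * L)"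
        using L d by (simp add: field_simps power2_eq_square)
    qed (use cm L d in \<open>auto intro!: integrable_continuous_real continuous_intros\<close>)
    also have "\<dots> = L / (2 * d) * integral {X..X + L} (\<lambda>x. (m x y)\<^sup>2) + d / 2"
    proof -
      have "integral {X..X + L} (\<lambda>x. L / (2 * d) * (m x y)\<^sup>2 + d / (2 * L)) =
          integral {X..X + L} (\<lambda>x. L / (2 * d) * (m x y)\<^sup>2) + integral {X..X + L} (\<lambda>x. d / (2 * L))"
        by (rule integral_add) (use cm L d in \<open>auto intro!: integrable_continuous_real continuous_intros\<close>)
      then show ?thesis using L by simp
    qed
    finally have "d / 2 \<le> L / (2 * d) * integral {X..X + L} (\<lambda>x. (m x y)\<^sup>2)" using 1 by simp
    then show ?thesis using L d by (simp add: field_simps power2_eq_square)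
  qed
  have cI: "continuous_on S (\<lambda>y. integral {X..X + L} (\<lambda>x. (m x y)\<^sup>2))" for S
    by (rule plane_slices(4)[OF m2])
  have "(b - a) * (d\<^sup>2 / L) = integral {a..b} (\<lambda>_. d\<^sup>2 / L)" using ab by simp
  also have "\<dots> \<le> integral {a..b} (\<lambda>y. integral {X..X + L} (\<lambda>x. (m x y)\<^sup>2))"
    by (rule integral_le) (use line cI in \<open>auto intro!: integrable_continuous_real\<close>)
  also have "\<dots> \<le> integral {Y..Y + L} (\<lambda>y. integral {X..X + L} (\<lambda>x. (m x y)\<^sup>2))"
  proof -
    have "0 \<le> integral {X..X + L} (\<lambda>x. (m x y)\<^sup>2)" for y
      by (rule integral_nonneg) (auto intro!: integrable_continuous_real plane_slices(1)[OF m2])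
    then show ?thesis
      by (intro integral_subset_le) (use ab cI in \<open>auto intro!: integrable_continuous_real\<close>)
  qed
  also have "\<dots> = integral (cbox (X, Y) (X + L, Y + L)) (\<lambda>(x, y). (m x y)\<^sup>2)"
    by (rule integral_prod_swap(1)[OF m2, symmetric])
  finally show ?thesis .
qed

lemma square_energy_horizontal:
  fixes m :: "real \<Rightarrow> real \<Rightarrow> real" and g :: "real \<Rightarrow> real \<Rightarrow> complex"
  assumes gx: "\<And>x y. ((\<lambda>x. g x y) has_vector_derivative gx x y) (at x)" "\<And>x y. norm (gx x y) \<le> 2 * m x y"
    and gy: "\<And>x y. ((\<lambda>y. g x y) has_vector_derivative gy x y) (at y)" "\<And>x y. norm (gy x y) \<le> 2 * m x y"
    and m: "continuous_on UNIV (\<lambda>(x, y). m x y)" "\<And>x y. 0 \<le> m x y" "\<And>x y. m x y \<le> 1"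
    and L: "L > 0" and \<delta>: "\<delta> > 0" and y: "Y \<le> y" "y \<le> Y + L"
    and x: "X \<le> x1" "x1 \<le> X + L" "X \<le> x2" "x2 \<le> X + L"
    and osc: "\<delta> / 2 \<le> norm (g x2 y - g x1 y)"
  shows "min (\<delta> / 16) (L / 2) * ((\<delta> / 8)\<^sup>2 / L) \<le> integral (cbox (X, Y) (X + L, Y + L)) (\<lambda>(x, y). (m x y)\<^sup>2)"
proof -
  \<comment> \<open>A vertical move by at most \<eta> changes each of the two values by at most
    \<delta>/8, so of the oscillation \<delta>/2 there remains \<delta>/4, twice the
    \<open>d\<close> = \<delta>/8 of \<open>strip_energy\<close>. The cap \<open>L / 2\<close> lets
    a strip of height \<eta> fit into the square above or below \<open>y\<close>.\<close>
  define \<eta> where "\<eta> = min (\<delta> / 16) (L / 2)"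
  have \<eta>: "0 < \<eta>" "\<eta> \<le> \<delta> / 16" "\<eta> \<le> L / 2" using L \<delta> by (auto simp: \<eta>_def)
  have lip: "norm (g x b - g x a) \<le> 2 * (b - a)" if "a \<le> b" for x a b
  proof -
    have "norm (g x b - g x a) \<le> integral {a..b} (\<lambda>_. 2)"
      by (rule norm_diff_le_integral[OF gy(1) _ _ that]) (use order_trans[OF gy(2)] m(3) in \<open>auto\<close>)
    then show ?thesis using that by simp
  qed
  have lip': "norm (g x a - g x b) \<le> 2 * \<bar>a - b\<bar>" for x a b
    using lip[of a b x] lip[of b a x] by (cases "a \<le> b") (auto simp: norm_minus_commute)
  obtain a where a: "Y \<le> a" "a + \<eta> \<le> Y + L" "a \<le> y" "y \<le> a + \<eta>"
  proof (cases "y \<le> Y + L / 2")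
    case True
    then show ?thesis using that[of y] y \<eta> by auto
  next
    case False
    then show ?thesis using that[of "y - \<eta>"] y \<eta> by auto
  qed
  have o: "2 * (\<delta> / 8) \<le> norm (g x2 t - g x1 t)" if "a \<le> t" "t \<le> a + \<eta>" for t
  proof -
    have "\<bar>t - y\<bar> \<le> \<eta>" using that a by auto
    moreover have "norm (g x2 y - g x1 y) \<le> norm (g x2 t - g x1 t) + norm (g x2 y - g x2 t) + norm (g x1 t - g x1 y)"
      using norm_triangle_ineq[of "(g x2 t - g x1 t) + (g x2 y - g x2 t)" "g x1 t - g x1 y"]
        norm_triangle_ineq[of "g x2 t - g x1 t" "g x2 y - g x2 t"] by (simp add: algebra_simps)
    ultimately show ?thesis using lip'[of x2 y t] lip'[of x1 t y] osc \<eta> by (auto simp: abs_minus_commute)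
  qed
  have "(a + \<eta> - a) * ((\<delta> / 8)\<^sup>2 / L) \<le> integral (cbox (X, Y) (X + L, Y + L)) (\<lambda>(x, y). (m x y)\<^sup>2)"
  proof (cases "x1 \<le> x2")
    case True
    show ?thesis
      by (rule strip_energy[OF gx m(1,2) L _ _ a(1,2) x(1) True x(4)]) (use \<delta> \<eta> o in auto)
  next
    case False
    then have "x2 \<le> x1" by simp
    show ?thesis
      by (rule strip_energy[OF gx m(1,2) L _ _ a(1,2) x(3) \<open>x2 \<le> x1\<close> x(2)])
        (use \<delta> \<eta> o in \<open>auto simp: norm_minus_commute\<close>)
  qed
  then show ?thesis by (simp add: \<eta>_def)
qed

text \<open>Go from one point to the other through the corner \<open>(x2, y1)\<close>: one leg
  carries at least half of the oscillation. The vertical leg reduces to the horizontal one by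
  exchanging the coordinates.\<close>

lemma square_energy:
  fixes m :: "real \<Rightarrow> real \<Rightarrow> real" and g :: "real \<Rightarrow> real \<Rightarrow> complex"
  assumes gx: "\<And>x y. ((\<lambda>x. g x y) has_vector_derivative gx x y) (at x)" "\<And>x y. norm (gx x y) \<le> 2 * m x y"
    and gy: "\<And>x y. ((\<lambda>y. g x y) has_vector_derivative gy x y) (at y)" "\<And>x y. norm (gy x y) \<le> 2 * m x y"
    and m: "continuous_on UNIV (\<lambda>(x, y). m x y)" "\<And>x y. 0 \<le> m x y" "\<And>x y. m x y \<le> 1"
    and L: "L > 0" and \<delta>: "\<delta> > 0"
    and p: "(x1, y1) \<in> cbox (X, Y) (X + L, Y + L)" "(x2, y2) \<in> cbox (X, Y) (X + L, Y + L)"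
    and osc: "\<delta> < norm (g x2 y2 - g x1 y1)"
  shows "min (\<delta> / 16) (L / 2) * ((\<delta> / 8)\<^sup>2 / L) \<le> integral (cbox (X, Y) (X + L, Y + L)) (\<lambda>(x, y). (m x y)\<^sup>2)"
proof -
  have b: "X \<le> x1" "x1 \<le> X + L" "X \<le> x2" "x2 \<le> X + L" "Y \<le> y1" "y1 \<le> Y + L" "Y \<le> y2" "y2 \<le> Y + L"
    using p by auto
  have "norm (g x2 y2 - g x1 y1) \<le> norm (g x2 y1 - g x1 y1) + norm (g x2 y2 - g x2 y1)"
    using norm_triangle_ineq[of "g x2 y1 - g x1 y1" "g x2 y2 - g x2 y1"] by simp
  then consider "\<delta> / 2 \<le> norm (g x2 y1 - g x1 y1)" | "\<delta> / 2 \<le> norm (g x2 y2 - g x2 y1)" using osc by linarith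
  then show ?thesis
  proof cases
    case 1
    then show ?thesis
      by (intro square_energy_horizontal[OF gx gy m L \<delta> b(5,6) b(1-4)])
  next
    case 2
    have m2: "continuous_on UNIV (\<lambda>(x, y). (m x y)\<^sup>2)"
      using m(1) unfolding case_prod_unfold by (intro continuous_intros)
    have swap: "continuous_on UNIV (\<lambda>(x, y). u y x)" if "continuous_on UNIV (\<lambda>(x, y). u x y)" for u :: "real \<Rightarrow> real \<Rightarrow> real"
    proof -
      have "continuous_on UNIV ((\<lambda>(x, y). u x y) \<circ> (\<lambda>(y, x). (x, y)))"
        unfolding case_prod_unfold
        by (intro continuous_on_compose continuous_intros continuous_on_subset[OF that[unfolded case_prod_unfold]]) auto
      then show ?thesis by (simp add: o_def case_prod_unfold)
    qed
    have "min (\<delta> / 16) (L / 2) * ((\<delta> / 8)\<^sup>2 / L) \<le> integral (cbox (Y, X) (Y + L, X + L)) (\<lambda>(x, y). (m y x)\<^sup>2)"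
      by (rule square_energy_horizontal[where g = "\<lambda>x y. g y x", OF gy gx swap[OF m(1)] m(2,3) L \<delta> b(3,4) b(5-8) 2])
    also have "\<dots> = integral (cbox (X, Y) (X + L, Y + L)) (\<lambda>(x, y). (m x y)\<^sup>2)"
      unfolding integral_prod_swap(1)[OF swap[OF m2]] integral_prod_swap(2)[OF m2] ..
    finally show ?thesis .
  qed
qed

section \<open>Concentration of point sets\<close>

definition box_points :: "(nat \<times> nat) set \<Rightarrow> nat \<Rightarrow> nat \<Rightarrow> nat \<Rightarrow> (nat \<times> nat) set" where
  "box_points G p q s = G \<inter> ({p..<p + s} \<times> {q..<q + s})"

lemma box_points_subdivide:
  assumes "t > 0"
  shows "box_points G p q (k * t) = (\<Union>(a, b)\<in>{..<k} \<times> {..<k}. box_points G (p + a * t) (q + b * t) t)"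
proof (intro equalityI subsetI)
  fix g assume g: "g \<in> box_points G p q (k * t)"
  obtain x y where xy: "g = (x, y)" by (cases g)
  have r: "(x - p) div t < k" "(y - q) div t < k"
    using g xy assms by (auto simp: box_points_def less_mult_imp_div_less)
  define A B where "A = (x - p) div t * t" and "B = (y - q) div t * t"
  define u v where "u = (x - p) mod t" and "v = (y - q) mod t"
  have "A + u = x - p" "B + v = y - q" by (simp_all add: A_def B_def u_def v_def)
  moreover have "u < t" "v < t" using assms by (simp_all add: u_def v_def)
  ultimately have "g \<in> box_points G (p + A) (q + B) t"
    using g xy unfolding box_points_def by auto
  then have "g \<in> box_points G (p + (x - p) div t * t) (q + (y - q) div t * t) t"
    by (simp add: A_def B_def)
  then show "g \<in> (\<Union>(a, b)\<in>{..<k} \<times> {..<k}. box_points G (p + a * t) (q + b * t) t)"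
    using r by blast
next
  fix g assume "g \<in> (\<Union>(a, b)\<in>{..<k} \<times> {..<k}. box_points G (p + a * t) (q + b * t) t)"
  then obtain a b where ab: "a < k" "b < k" "g \<in> box_points G (p + a * t) (q + b * t) t" by auto
  have "Suc a * t \<le> k * t" "Suc b * t \<le> k * t" using ab by (auto intro!: mult_le_mono1 simp del: mult_Suc)
  then show "g \<in> box_points G p q (k * t)"
    using ab(3) unfolding box_points_def by (auto simp: mult_Suc)
qed

text \<open>If every box of density at least \<open>\<beta>\<close> has an empty subbox, the maximal density of a box
  drops by the factor \<open>1 - 1 / k\<^sup>2\<close> with each subdivision.\<close>

lemma dense_box_exists:
  fixes \<beta> :: real
  assumes G: "finite G" and k: "k > 0" and b: "b > 0"
    and none: "\<And>p q j. \<beta> * (b * k ^ Suc j)\<^sup>2 \<le> card (box_points G p q (b * k ^ Suc j)) \<Longrightarrow>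
      \<exists>a<k. \<exists>c<k. box_points G (p + a * (b * k ^ j)) (q + c * (b * k ^ j)) (b * k ^ j) = {}"
  shows "card (box_points G p q (b * k ^ J)) \<le> max \<beta> ((1 - 1 / k\<^sup>2) ^ J) * (b * k ^ J)\<^sup>2"
proof (induction J arbitrary: p q)
  case 0
  have "card (box_points G p q b) \<le> card ({p..<p + b} \<times> {q..<q + b})"
    by (rule card_mono) (auto simp: box_points_def)
  then have "real (card (box_points G p q b)) \<le> 1 * (real b)\<^sup>2"
    by (simp add: card_cartesian_product power2_eq_square flip: of_nat_mult)
  also have "\<dots> \<le> max \<beta> 1 * (real b)\<^sup>2" by (intro mult_right_mono) auto
  finally show ?case by simp
next
  case (Suc J)
  define \<rho> where "\<rho> = 1 - 1 / (real k)\<^sup>2"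
  have k1: "1 \<le> real k" using k by simp
  then have \<rho>: "0 \<le> \<rho>" "\<rho> \<le> 1" by (auto simp: \<rho>_def)
  let ?t = "b * k ^ J" and ?s = "b * k ^ Suc J"
  have s: "?s = k * ?t" by simp
  show ?case
  proof (cases "\<beta> * (real ?s)\<^sup>2 \<le> card (box_points G p q ?s)")
    case False
    then have "card (box_points G p q ?s) \<le> \<beta> * (real ?s)\<^sup>2" by simp
    also have "\<dots> \<le> max \<beta> (\<rho> ^ Suc J) * (real ?s)\<^sup>2" by (intro mult_right_mono) auto
    finally show ?thesis by (simp add: \<rho>_def)
  next
    case True
    then obtain a c where ac: "a < k" "c < k" "box_points G (p + a * ?t) (q + c * ?t) ?t = {}"
      using none[where j = J and p = p and q = q] by auto
    let ?I = "{..<k} \<times> {..<k} - {(a, c)}"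
    have "box_points G p q ?s = (\<Union>(a, b)\<in>{..<k} \<times> {..<k}. box_points G (p + a * ?t) (q + b * ?t) ?t)"
      unfolding s using b k by (intro box_points_subdivide) auto
    also have "\<dots> = (\<Union>(a, b)\<in>?I. box_points G (p + a * ?t) (q + b * ?t) ?t)"
      using ac by blast
    finally have e: "box_points G p q ?s = (\<Union>(a, b)\<in>?I. box_points G (p + a * ?t) (q + b * ?t) ?t)" .
    have "card (box_points G p q ?s) \<le> (\<Sum>i\<in>?I. card (case i of (a, b) \<Rightarrow> box_points G (p + a * ?t) (q + b * ?t) ?t))"
      unfolding e by (rule card_UN_le) simp
    then have "real (card (box_points G p q ?s)) \<le> real (\<Sum>i\<in>?I. card (case i of (a, b) \<Rightarrow> box_points G (p + a * ?t) (q + b * ?t) ?t))"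
      by (rule of_nat_mono)
    also have "\<dots> = (\<Sum>i\<in>?I. real (card (case i of (a, b) \<Rightarrow> box_points G (p + a * ?t) (q + b * ?t) ?t)))"
      by (rule of_nat_sum)
    also have "\<dots> \<le> (\<Sum>i\<in>?I. max \<beta> (\<rho> ^ J) * (real ?t)\<^sup>2)"
      by (rule sum_mono) (use Suc.IH in \<open>auto simp: \<rho>_def split: prod.split\<close>)
    also have "\<dots> = (real k ^ 2 - 1) * (max \<beta> (\<rho> ^ J) * (real ?t)\<^sup>2)"
    proof -
      have "card ?I = k\<^sup>2 - 1" using ac by (simp add: card_cartesian_product power2_eq_square)
      moreover have "k\<^sup>2 \<ge> 1" using k by simp
      ultimately show ?thesis by (simp add: of_nat_diff)
    qed
    also have "\<dots> = \<rho> * max \<beta> (\<rho> ^ J) * (real ?s)\<^sup>2"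
      using k1 by (simp add: \<rho>_def field_simps power2_eq_square)
    also have "\<dots> \<le> max \<beta> (\<rho> ^ Suc J) * (real ?s)\<^sup>2"
    proof (intro mult_right_mono)
      show "\<rho> * max \<beta> (\<rho> ^ J) \<le> max \<beta> (\<rho> ^ Suc J)"
      proof (cases "\<beta> \<le> \<rho> ^ J")
        case True
        then show ?thesis by (simp add: max_def)
      next
        case False
        then have "0 \<le> \<beta>" using \<rho> zero_le_power[of \<rho> J] by linarith
        then have "\<rho> * \<beta> \<le> \<beta>" using \<rho> by (simp add: mult_left_le_one_le)
        moreover have "max \<beta> (\<rho> ^ J) = \<beta>" using False by simp
        ultimately show ?thesis by (simp add: le_max_iff_disj)
      qed
    qed auto
    finally show ?thesis by (simp add: \<rho>_def)
  qed
qed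

text \<open>If \<open>G\<close> has density above \<beta>, then \<open>dense_box_exists\<close>
  yields a box that is still \<beta>-dense and whose subboxes all meet \<open>G\<close>, hence all
  meet the region where \<open>w\<close> is at most \<open>T\<close>. There
  \<open>card_energetic_squares_le\<close> admits fewer squares than the density demands. As
  \<kappa> and \<open>b0\<close> are fixed before \<open>w\<close>, \<open>q\<close> and the
  position of the grid, the bound is uniform.\<close>

lemma few_energetic_squares:
  fixes L e \<beta> T :: real
  assumes L: "L > 0" and e: "e > 0" and \<beta>: "\<beta> > 0" and T: "T \<ge> 0"
  obtains \<kappa> b0 :: nat where "\<kappa> > 0"
    "\<And>w wx wy wxx wyy q X Y G b. plane_C2 w wx wy wxx wyy \<Longrightarrow> (\<And>x y. 0 \<le> w x y) \<Longrightarrow>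
       continuous_on UNIV (\<lambda>(x, y). q x y) \<Longrightarrow> (\<And>x y. 0 \<le> q x y) \<Longrightarrow> (\<And>x y. q x y \<le> 1) \<Longrightarrow>
       (\<And>x y. wxx x y + wyy x y = 2 * q x y) \<Longrightarrow> b0 \<le> b \<Longrightarrow> G \<subseteq> {..<b * \<kappa>} \<times> {..<b * \<kappa>} \<Longrightarrow>
       (\<And>g. g \<in> G \<Longrightarrow> e \<le> integral (grid_square X Y L g) (\<lambda>(x, y). q x y)) \<Longrightarrow>
       (\<And>g. g \<in> G \<Longrightarrow> \<exists>x y. (x, y) \<in> grid_square X Y L g \<and> w x y \<le> T) \<Longrightarrow>
       real (card G) \<le> \<beta> * (real (b * \<kappa>))\<^sup>2"
proof -
  \<comment> \<open>Limits the share of the margin, 4 \<eta> s^2, to a quarter of \<beta>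
    s^2.\<close>
  define \<eta> where "\<eta> = min (\<beta> / 16) (1 / 2)"
  have \<eta>: "0 < \<eta>" "\<eta> \<le> 1 / 2" "\<eta> \<le> \<beta> / 16" using \<beta> by (auto simp: \<eta>_def)
  define E where "E = e * \<eta> ^ 4"
  have E: "E > 0" using e \<eta> by (simp add: E_def)
  \<comment> \<open>The subboxes of side \<open>t * L\<close> are \<open>k\<close> times smaller
    than the box, so their term 64 (t L)^2 / E falls below \<beta> s^2 / 8.\<close>
  obtain k :: nat where k: "real k > 512 * L\<^sup>2 / (E * \<beta>) + 1" using reals_Archimedean2 by blast
  have k1: "real k > 1" using k E \<beta> by (smt (verit) divide_nonneg_pos mult_pos_pos zero_le_power2 mult_nonneg_nonneg)
  have kk: "64 * L\<^sup>2 / E \<le> \<beta> / 8 * (real k)\<^sup>2"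
  proof -
    have "512 * L\<^sup>2 / (E * \<beta>) \<le> real k" using k by simp
    also have "real k \<le> (real k)\<^sup>2" using k1 by (simp add: power2_eq_square)
    finally show ?thesis using E \<beta> by (simp add: field_simps)
  qed
  have "1 - 1 / (real k)\<^sup>2 < 1" "0 \<le> 1 - 1 / (real k)\<^sup>2" using k1 by (auto simp: field_simps)
  \<comment> \<open>After \<open>J\<close> subdivisions the alternative in
    \<open>dense_box_exists\<close> drops below \<beta>, and the maximum there is \<beta>
    itself.\<close>
  then obtain J where J: "(1 - 1 / (real k)\<^sup>2) ^ J < \<beta>" using real_arch_pow_inv[OF \<beta>] by blast
  \<comment> \<open>The smallest box side \<open>b\<close> must already absorb the terms of lower
    order, 4 s and 64 T / E.\<close>
  obtain b0 :: nat where b0: "real b0 > 16 / \<beta> + 512 * T / (E * \<beta>) + 1" using reals_Archimedean2 by blast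
  have nn: "0 \<le> 16 / \<beta>" "0 \<le> 512 * T / (E * \<beta>)" using \<beta> T E by auto
  show ?thesis
  proof (rule that[of "k ^ J" b0])
    show "k ^ J > 0" using k1 by simp
    fix w wx wy wxx wyy q :: "real \<Rightarrow> real \<Rightarrow> real" and X Y :: real and G :: "(nat \<times> nat) set" and b :: nat
    assume P: "plane_C2 w wx wy wxx wyy" and w: "\<And>x y. 0 \<le> w x y" and cq: "continuous_on UNIV (\<lambda>(x, y). q x y)"
      and q: "\<And>x y. 0 \<le> q x y" "\<And>x y. q x y \<le> 1" and lap: "\<And>x y. wxx x y + wyy x y = 2 * q x y"
      and b: "b0 \<le> b" and G: "G \<subseteq> {..<b * k ^ J} \<times> {..<b * k ^ J}"
      and en: "\<And>g. g \<in> G \<Longrightarrow> e \<le> integral (grid_square X Y L g) (\<lambda>(x, y). q x y)"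
      and low: "\<And>g. g \<in> G \<Longrightarrow> \<exists>x y. (x, y) \<in> grid_square X Y L g \<and> w x y \<le> T"
    have fG: "finite G" using G by (rule finite_subset) auto
    have k0: "k > 0" using k1 by simp
    have b1: "real b > 16 / \<beta> + 512 * T / (E * \<beta>) + 1" using b0 b by linarith
    then have bpos: "b > 0" using nn by (cases b) auto
    show "real (card G) \<le> \<beta> * (real (b * k ^ J))\<^sup>2"
    proof (rule ccontr)
      assume "\<not> ?thesis"
      moreover have "box_points G 0 0 (b * k ^ J) = G" using G by (auto simp: box_points_def)
      ultimately have "\<not> real (card (box_points G 0 0 (b * k ^ J))) \<le> max \<beta> ((1 - 1 / (real k)\<^sup>2) ^ J) * (real (b * k ^ J))\<^sup>2"
        using J by (simp add: max_def)
      then obtain p r j where dense: "\<beta> * (real (b * k ^ Suc j))\<^sup>2 \<le> card (box_points G p r (b * k ^ Suc j))"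
        and occ: "\<And>a c. a < k \<Longrightarrow> c < k \<Longrightarrow> box_points G (p + a * (b * k ^ j)) (r + c * (b * k ^ j)) (b * k ^ j) \<noteq> {}"
        using dense_box_exists[OF fG k0 bpos, of \<beta> 0 0 J] unfolding of_nat_mult of_nat_power by blast
      define t where "t = b * k ^ j"
      define s where "s = k * t"
      have st: "b * k ^ Suc j = s" by (simp add: s_def t_def)
      have t0: "t > 0" using bpos k0 by (simp add: t_def)
      have "b \<le> t" using k0 by (simp add: t_def)
      also have "t \<le> s" using k0 by (simp add: s_def)
      finally have "real b \<le> real s" by simp
      then have s1: "real s \<ge> 16 / \<beta>" "real s \<ge> 512 * T / (E * \<beta>)" "real s \<ge> 1" using b1 nn by linarith+
      \<comment> \<open>The points of the dense box, with its corner moved to the origin of the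
        grid.\<close>
      define G' where "G' = {(a, c). (p + a, r + c) \<in> G \<and> a < s \<and> c < s}"
      have shift: "grid_square (X + p * L) (Y + r * L) L (a, c) = grid_square X Y L (p + a, r + c)" for a c
        by (simp add: grid_square_def algebra_simps)
      have cardG': "card G' = card (box_points G p r s)"
      proof (rule bij_betw_same_card[of "\<lambda>(a, c). (p + a, r + c)"])
        show "bij_betw (\<lambda>(a, c). (p + a, r + c)) G' (box_points G p r s)"
        proof (rule bij_betwI[where g = "\<lambda>(a, c). (a - p, c - r)"])
        qed (auto simp: G'_def box_points_def)
      qed
      interpret plane_C2 w wx wy wxx wyy by fact
      have "real (card G') \<le> 4 * s * (\<eta> * s + 1) + 64 * (T + (t * L)\<^sup>2) / (e * \<eta> ^ 4)"
      proof (rule card_energetic_squares_le[OF w cq q lap L \<eta>(1,2) k0 t0 s_def, where X = "X + p * L" and Y = "Y + r * L"])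
        show "G' \<subseteq> {..<s} \<times> {..<s}" by (auto simp: G'_def)
        show "e \<le> integral (grid_square (X + p * L) (Y + r * L) L g) (\<lambda>(x, y). q x y)" if "g \<in> G'" for g
          using that en by (auto simp: G'_def shift)
        fix a c assume ac: "a < k" "c < k"
        obtain x y where xy: "(x, y) \<in> G" "p + a * t \<le> x" "x < p + a * t + t" "r + c * t \<le> y" "y < r + c * t + t"
          using occ[OF ac] by (auto simp: box_points_def t_def)
        obtain u v where uv: "(u, v) \<in> grid_square X Y L (x, y)" "w u v \<le> T" using low[OF xy(1)] by blast
        have "(real p + a * t) * L \<le> real x * L" "real (Suc x) * L \<le> (real p + Suc a * t) * L"
          "(real r + c * t) * L \<le> real y * L" "real (Suc y) * L \<le> (real r + Suc c * t) * L"
          using xy L by (auto intro!: mult_right_mono simp flip: of_nat_mult of_nat_add)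
        then have "(u, v) \<in> grid_square (X + p * L) (Y + r * L) (t * L) (a, c)"
          using uv(1) unfolding grid_square_def by (auto simp: algebra_simps)
        then show "\<exists>x y. (x, y) \<in> grid_square (X + p * L) (Y + r * L) (t * L) (a, c) \<and> w x y \<le> T"
          using uv(2) by blast
      qed (use e in auto)
      also have "\<dots> = 4 * \<eta> * (real s)\<^sup>2 + 4 * s + 64 * T / E + 64 * L\<^sup>2 / E * (real t)\<^sup>2"
        using E by (simp add: E_def[symmetric] power2_eq_square field_simps)
      also have "\<dots> < \<beta> * (real s)\<^sup>2"
      proof -
        have 1: "4 * \<eta> * (real s)\<^sup>2 \<le> \<beta> / 4 * (real s)\<^sup>2" using \<eta>(3) by (intro mult_right_mono) auto
        have "16 \<le> \<beta> * s" using s1(1) \<beta> by (simp add: field_simps)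
        then have "16 * real s \<le> \<beta> * s * real s" by (rule mult_right_mono) simp
        then have 2: "4 * s \<le> \<beta> / 4 * (real s)\<^sup>2" by (simp add: power2_eq_square)
        have "512 * T / (E * \<beta>) \<le> (real s)\<^sup>2"
          using s1(2,3) by (smt (verit) power2_eq_square mult_left_le mult_le_cancel_left1)
        then have 3: "64 * T / E \<le> \<beta> / 8 * (real s)\<^sup>2" using E \<beta> by (simp add: field_simps)
        have "64 * L\<^sup>2 / E * (real t)\<^sup>2 \<le> \<beta> / 8 * (real k)\<^sup>2 * (real t)\<^sup>2" by (intro mult_right_mono kk) auto
        then have 4: "64 * L\<^sup>2 / E * (real t)\<^sup>2 \<le> \<beta> / 8 * (real s)\<^sup>2" by (simp add: s_def power_mult_distrib)
        have "0 < \<beta> * (real s)\<^sup>2" using \<beta> s1(3) by auto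
        then show ?thesis using 1 2 3 4 by simp
      qed
      finally have "real (card G') < \<beta> * (real s)\<^sup>2" .
      then show False using dense unfolding st cardG' by simp
    qed
  qed
qed

section \<open>Calculus along a holomorphic curve\<close>

definition curve_deriv :: "(complex \<Rightarrow> complex ^ 'k) \<Rightarrow> complex \<Rightarrow> complex ^ 'k" where
  "curve_deriv F z = (\<chi> i. deriv (\<lambda>w. F w $ i) z)"

text \<open>The square of the Fubini-Study derivative, with the sum over pairs replaced by the Gram
  determinant of F' and F. In this form it comes out of the Laplacian of ln |F|.\<close>

definition curve_energy :: "(complex \<Rightarrow> complex ^ 'k::finite) \<Rightarrow> complex \<Rightarrow> real" where
  "curve_energy F z = ((norm (curve_deriv F z))\<^sup>2 * (norm (F z))\<^sup>2 - (cmod (cinner (curve_deriv F z) (F z)))\<^sup>2) /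
     ((norm (F z))\<^sup>2)\<^sup>2"

lemma curve_energy_nonneg: "0 \<le> curve_energy F z"
proof -
  have "(cmod (cinner (curve_deriv F z) (F z)))\<^sup>2 \<le> (norm (curve_deriv F z) * norm (F z))\<^sup>2"
    by (rule power_mono[OF cinner_le]) simp
  then show ?thesis by (simp add: curve_energy_def power_mult_distrib)
qed

text \<open>The summand is symmetric and vanishes on the diagonal, so the sum over all pairs is
  twice the given one, and it factors into inner products.\<close>

lemma lagrange_identity:
  fixes x y :: "complex ^ 'k::{finite, linorder}"
  shows "(\<Sum>(i, j)\<in>{(i, j). i < j}. (cmod (x $ i * y $ j - y $ i * x $ j))\<^sup>2) =
    (norm x)\<^sup>2 * (norm y)\<^sup>2 - (cmod (cinner x y))\<^sup>2"
proof -
  define t where "t = (\<lambda>(i, j). (cmod (x $ i * y $ j - y $ i * x $ j))\<^sup>2)"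
  let ?U = "{(i :: 'k, j). i < j}"
  have e: "(UNIV :: ('k \<times> 'k) set) = ?U \<union> prod.swap ` ?U \<union> {(i, j). i = j}"
    by (auto simp: image_iff)
  have "sum t UNIV = sum t (?U \<union> prod.swap ` ?U) + sum t {(i, j). i = j}"
    unfolding e by (rule sum.union_disjoint) auto
  also have "sum t (?U \<union> prod.swap ` ?U) = sum t ?U + sum t (prod.swap ` ?U)"
    by (rule sum.union_disjoint) auto
  also have "sum t {(i, j). i = j} = 0" by (rule sum.neutral) (auto simp: t_def)
  also have "sum t (prod.swap ` ?U) = sum t ?U"
  proof -
    have "t (prod.swap p) = t p" for p
    proof (cases p)
      case (Pair i j)
      have "x $ j * y $ i - y $ j * x $ i = - (x $ i * y $ j - y $ i * x $ j)" by (simp add: mult.commute)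
      then show ?thesis unfolding Pair t_def by (simp only: swap_simp prod.case norm_minus_cancel)
    qed
    then show ?thesis by (subst sum.reindex) auto
  qed
  finally have 1: "sum t UNIV = 2 * sum t ?U" by simp
  have "complex_of_real (sum t UNIV) = (\<Sum>i\<in>UNIV. \<Sum>j\<in>UNIV. complex_of_real ((cmod (x $ i * y $ j - y $ i * x $ j))\<^sup>2))"
    by (simp add: t_def sum.cartesian_product case_prod_unfold)
  also have "\<dots> = (\<Sum>i\<in>UNIV. \<Sum>j\<in>UNIV.
      (x $ i * cnj (x $ i)) * (y $ j * cnj (y $ j)) + (y $ i * cnj (y $ i)) * (x $ j * cnj (x $ j))
      - (x $ i * cnj (y $ i)) * (y $ j * cnj (x $ j)) - (y $ i * cnj (x $ i)) * (x $ j * cnj (y $ j)))"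
  proof -
    have *: "complex_of_real ((cmod (a * b - c * d))\<^sup>2) = (a * cnj a) * (b * cnj b) +
      (c * cnj c) * (d * cnj d) - (a * cnj c) * (b * cnj d) - (c * cnj a) * (d * cnj b)" for a b c d
      unfolding complex_norm_square complex_cnj_diff complex_cnj_mult
      by (simp add: left_diff_distrib right_diff_distrib mult_ac)
    show ?thesis by (rule sum.cong[OF refl], rule sum.cong[OF refl], rule *)
  qed
  also have "\<dots> = cinner x x * cinner y y + cinner y y * cinner x x
      - cinner x y * cinner y x - cinner y x * cinner x y"
    unfolding cinner_def sum_product by (simp add: sum.distrib sum_subtractf)
  also have "\<dots> = of_real (2 * ((norm x)\<^sup>2 * (norm y)\<^sup>2 - (cmod (cinner x y))\<^sup>2))"
    using complex_norm_square[of "cinner x y"] by (simp add: cinner_self cinner_cnj[of x y])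
  finally have "sum t UNIV = 2 * ((norm x)\<^sup>2 * (norm y)\<^sup>2 - (cmod (cinner x y))\<^sup>2)"
    by (simp only: of_real_eq_iff)
  with 1 show ?thesis by (simp add: t_def)
qed

lemma fs_derivative_rep_eq: "fs_derivative_rep F z = sqrt (curve_energy F z)"
proof -
  have "(\<Sum>j\<in>UNIV. (cmod (F z $ j))\<^sup>2) = (norm (F z))\<^sup>2" by (simp add: norm_vec_square)
  then show ?thesis
    using lagrange_identity[of "curve_deriv F z" "F z"]
    by (simp add: fs_derivative_rep_def curve_energy_def curve_deriv_def)
qed

lemma has_vector_derivative_along:
  assumes "F holomorphic_on UNIV"
  shows "((\<lambda>t. F (z + of_real t * v)) has_vector_derivative v * deriv F (z + of_real t * v)) (at t)"
proof -
  have "(F has_field_derivative deriv F (z + of_real t * v)) (at (z + of_real t * v))"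
    using assms holomorphic_derivI by blast
  moreover have "((\<lambda>t. z + of_real t * v) has_vector_derivative v) (at t)"
    by (auto intro!: derivative_eq_intros simp: has_vector_derivative_def scaleR_conv_of_real)
  ultimately have "(F \<circ> (\<lambda>t. z + of_real t * v) has_vector_derivative v * deriv F (z + of_real t * v)) (at t)"
    by (rule field_vector_diff_chain_at[rotated])
  then show ?thesis by (simp add: o_def)
qed

lemma cinner_deriv_along:
  fixes A B :: "complex \<Rightarrow> complex ^ 'k::finite"
  assumes "\<And>i. (\<lambda>z. A z $ i) holomorphic_on UNIV" "\<And>i. (\<lambda>z. B z $ i) holomorphic_on UNIV"
  shows "((\<lambda>t. cinner (A (z + of_real t * v)) (B (z + of_real t * v))) has_vector_derivative
     v * cinner (curve_deriv A (z + of_real t * v)) (B (z + of_real t * v)) +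
     cnj v * cinner (A (z + of_real t * v)) (curve_deriv B (z + of_real t * v))) (at t)"
proof -
  let ?p = "\<lambda>t. z + complex_of_real t * v"
  have "((\<lambda>t. \<Sum>i\<in>UNIV. A (?p t) $ i * cnj (B (?p t) $ i)) has_vector_derivative
     (\<Sum>i\<in>UNIV. A (?p t) $ i * cnj (v * deriv (\<lambda>z. B z $ i) (?p t)) +
        (v * deriv (\<lambda>z. A z $ i) (?p t)) * cnj (B (?p t) $ i))) (at t)"
    by (intro has_vector_derivative_sum has_vector_derivative_mult has_vector_derivative_cnj
        has_vector_derivative_along assms)
  then show ?thesis
    by (simp add: cinner_def curve_deriv_def sum.distrib sum_distrib_left algebra_simps)
qed

lemma holomorphic_curve_deriv:
  assumes "\<And>i. (\<lambda>z. F z $ i) holomorphic_on UNIV"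
  shows "(\<lambda>z. curve_deriv F z $ i) holomorphic_on UNIV"
  using holomorphic_deriv[OF assms[of i]] by (simp add: curve_deriv_def)

lemma norm_square_deriv_along:
  fixes F :: "complex \<Rightarrow> complex ^ 'k::finite"
  assumes F: "\<And>i. (\<lambda>z. F z $ i) holomorphic_on UNIV"
  shows "((\<lambda>t. (norm (F (z + of_real t * v)))\<^sup>2) has_real_derivative
     2 * Re (v * cinner (curve_deriv F (z + of_real t * v)) (F (z + of_real t * v)))) (at t)"
proof -
  have "((\<lambda>t. Re (cinner (F (z + of_real t * v)) (F (z + of_real t * v)))) has_vector_derivative
     Re (v * cinner (curve_deriv F (z + of_real t * v)) (F (z + of_real t * v)) +
     cnj v * cinner (F (z + of_real t * v)) (curve_deriv F (z + of_real t * v)))) (at t)"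
    by (rule bounded_linear.has_vector_derivative[OF bounded_linear_Re cinner_deriv_along[OF F F]])
  moreover have "Re (cnj v * cinner x y) = Re (v * cinner y x)" for x y :: "complex ^ 'k"
    by (subst cinner_cnj[of y x]) simp
  ultimately show ?thesis
    by (simp add: cinner_self has_real_derivative_iff_has_vector_derivative)
qed

lemma ln_norm_deriv_along:
  fixes F :: "complex \<Rightarrow> complex ^ 'k::finite"
  assumes F: "\<And>i. (\<lambda>z. F z $ i) holomorphic_on UNIV" "\<And>z. F z \<noteq> 0"
  shows "((\<lambda>t. ln (norm (F (z + of_real t * v)))) has_real_derivative
     Re (v * cinner (curve_deriv F (z + of_real t * v)) (F (z + of_real t * v))) / (norm (F (z + of_real t * v)))\<^sup>2) (at t)"
proof -
  have "((\<lambda>t. ln ((norm (F (z + of_real t * v)))\<^sup>2) / 2) has_real_derivative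
     (1 / (norm (F (z + of_real t * v)))\<^sup>2 *
      (2 * Re (v * cinner (curve_deriv F (z + of_real t * v)) (F (z + of_real t * v))))) / 2) (at t)"
    by (intro DERIV_cdivide DERIV_chain2[OF DERIV_ln_divide norm_square_deriv_along[OF F(1)]]) (use F(2) in simp)
  moreover have "ln ((norm (F w))\<^sup>2) / 2 = ln (norm (F w))" for w
    using F(2)[of w] by (simp add: ln_realpow)
  ultimately have "((\<lambda>t. ln (norm (F (z + of_real t * v)))) has_real_derivative
     (1 / (norm (F (z + of_real t * v)))\<^sup>2 *
      (2 * Re (v * cinner (curve_deriv F (z + of_real t * v)) (F (z + of_real t * v))))) / 2) (at t)"
    by (simp only:)
  moreover have "(1 / n * (2 * r)) / 2 = r / n" for n r :: real by simp
  ultimately show ?thesis by (rule DERIV_cong)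
qed

text \<open>The derivative of ln |F| in the direction \<open>v\<close>; \<open>log_hessian\<close>
  is the second derivative. The directions 1 and \<open>\<i>\<close> give the partial derivatives,
  so one computation covers both axes.\<close>

definition log_gradient :: "(complex \<Rightarrow> complex ^ 'k::finite) \<Rightarrow> complex \<Rightarrow> complex \<Rightarrow> real" where
  "log_gradient F v z = Re (v * cinner (curve_deriv F z) (F z)) / (norm (F z))\<^sup>2"

definition log_hessian :: "(complex \<Rightarrow> complex ^ 'k::finite) \<Rightarrow> complex \<Rightarrow> complex \<Rightarrow> real" where
  "log_hessian F v z =
     (Re (v * (v * cinner (curve_deriv (curve_deriv F) z) (F z) + cnj v * cinner (curve_deriv F z) (curve_deriv F z))) * (norm (F z))\<^sup>2 -
      Re (v * cinner (curve_deriv F z) (F z)) * (2 * Re (v * cinner (curve_deriv F z) (F z)))) / ((norm (F z))\<^sup>2 * (norm (F z))\<^sup>2)"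

lemma log_gradient_deriv_along:
  fixes F :: "complex \<Rightarrow> complex ^ 'k::finite"
  assumes F: "\<And>i. (\<lambda>z. F z $ i) holomorphic_on UNIV" "\<And>z. F z \<noteq> 0"
  shows "((\<lambda>t. log_gradient F v (z + of_real t * v)) has_real_derivative log_hessian F v (z + of_real t * v)) (at t)"
proof -
  have "((\<lambda>t. Re (v * cinner (curve_deriv F (z + of_real t * v)) (F (z + of_real t * v)))) has_real_derivative
      Re (v * (v * cinner (curve_deriv (curve_deriv F) (z + of_real t * v)) (F (z + of_real t * v)) +
        cnj v * cinner (curve_deriv F (z + of_real t * v)) (curve_deriv F (z + of_real t * v))))) (at t)"
    unfolding has_real_derivative_iff_has_vector_derivative
    by (intro bounded_linear.has_vector_derivative[OF bounded_linear_Re]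
        bounded_linear.has_vector_derivative[OF bounded_linear_mult_right] cinner_deriv_along holomorphic_curve_deriv F(1))
  from DERIV_divide[OF this norm_square_deriv_along[OF F(1)]] show ?thesis
    using F(2) by (simp add: log_gradient_def log_hessian_def)
qed

text \<open>Over the directions 1 and \<open>\<i>\<close> the terms with F'' cancel, as the square
  of \<open>\<i>\<close> is -1, and the squares of the real and imaginary parts of <F', F> add up to
  its squared modulus.\<close>

lemma log_hessian_sum:
  assumes "F z \<noteq> 0"
  shows "log_hessian F 1 z + log_hessian F \<i> z = 2 * curve_energy F z"
proof -
  define S where "S = (norm (F z))\<^sup>2"
  have S: "S \<noteq> 0" using assms by (simp add: S_def)
  have "Re (cinner (curve_deriv F z) (curve_deriv F z)) = (norm (curve_deriv F z))\<^sup>2"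
    "Im (cinner (curve_deriv F z) (curve_deriv F z)) = 0" by (simp_all add: cinner_self)
  then show ?thesis
    unfolding log_hessian_def curve_energy_def S_def[symmetric]
    using S by (simp add: cmod_power2[unfolded power2_eq_square] add_divide_distrib[symmetric] power2_eq_square algebra_simps)
qed

lemma continuous_curve:
  fixes F :: "complex \<Rightarrow> complex ^ 'k::finite"
  assumes "\<And>i. (\<lambda>z. F z $ i) holomorphic_on UNIV"
  shows "continuous_on S F"
proof -
  have "continuous_on UNIV (\<lambda>z. \<chi> i. F z $ i)"
    by (intro continuous_on_vec_lambda holomorphic_on_imp_continuous_on assms)
  then show ?thesis by (auto intro: continuous_on_subset)
qed

lemma continuous_cinner:
  fixes A B :: "'a::topological_space \<Rightarrow> complex ^ 'k::finite"
  assumes "continuous_on S A" "continuous_on S B"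
  shows "continuous_on S (\<lambda>z. cinner (A z) (B z))"
  unfolding cinner_def using assms by (intro continuous_intros)

lemma continuous_curve_quantities:
  fixes F :: "complex \<Rightarrow> complex ^ 'k::finite"
  assumes F: "\<And>i. (\<lambda>z. F z $ i) holomorphic_on UNIV" "\<And>z. F z \<noteq> 0"
  shows "continuous_on S (\<lambda>z. ln (norm (F z)))" "continuous_on S (log_gradient F v)"
    "continuous_on S (log_hessian F v)" "continuous_on S (curve_energy F)"
proof -
  note c = continuous_curve[OF F(1)] continuous_curve[OF holomorphic_curve_deriv[OF F(1)]]
    continuous_curve[OF holomorphic_curve_deriv[OF holomorphic_curve_deriv[OF F(1)]]]
  show "continuous_on S (\<lambda>z. ln (norm (F z)))"
    using F(2) by (intro continuous_intros c) auto
  show "continuous_on S (log_gradient F v)"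
    unfolding log_gradient_def[abs_def] using F(2) by (intro continuous_intros continuous_cinner c) auto
  show "continuous_on S (log_hessian F v)"
    unfolding log_hessian_def[abs_def] using F(2) by (intro continuous_intros continuous_cinner c) auto
  show "continuous_on S (curve_energy F)"
    unfolding curve_energy_def[abs_def] using F(2) by (intro continuous_intros continuous_cinner c) auto
qed

lemma continuous_on_Complex:
  assumes "continuous_on UNIV h"
  shows "continuous_on UNIV (\<lambda>(x, y). h (Complex x y))"
proof -
  have "continuous_on UNIV (\<lambda>p :: real \<times> real. Complex (fst p) (snd p))"
    unfolding Complex_eq by (intro continuous_intros)
  from continuous_on_compose2[OF assms this] show ?thesis by (simp add: case_prod_unfold)
qed

text \<open>Horizontal and vertical lines in the shape \<open>z + of_real t * v\<close> of the
  directional derivatives.\<close>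

lemma Complex_lines: "Complex x y = \<i> * of_real y + of_real x * 1" "Complex x y = of_real x + of_real y * \<i>"
  by (simp_all add: Complex_eq mult.commute add.commute)

lemma plane_C2_ln_norm:
  fixes F :: "complex \<Rightarrow> complex ^ 'k::finite"
  assumes F: "\<And>i. (\<lambda>z. F z $ i) holomorphic_on UNIV" "\<And>z. F z \<noteq> 0"
  shows "plane_C2 (\<lambda>x y. ln (norm (F (Complex x y))) + c)
    (\<lambda>x y. log_gradient F 1 (Complex x y)) (\<lambda>x y. log_gradient F \<i> (Complex x y))
    (\<lambda>x y. log_hessian F 1 (Complex x y)) (\<lambda>x y. log_hessian F \<i> (Complex x y))"
proof
  fix x y
  note d = DERIV_add[OF ln_norm_deriv_along[OF F, folded log_gradient_def] DERIV_const, simplified]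
  show "((\<lambda>x. ln (norm (F (Complex x y))) + c) has_real_derivative log_gradient F 1 (Complex x y)) (at x)"
    unfolding Complex_lines(1) by (rule d)
  show "((\<lambda>y. ln (norm (F (Complex x y))) + c) has_real_derivative log_gradient F \<i> (Complex x y)) (at y)"
    unfolding Complex_lines(2) by (rule d)
  show "((\<lambda>x. log_gradient F 1 (Complex x y)) has_real_derivative log_hessian F 1 (Complex x y)) (at x)"
    unfolding Complex_lines(1) by (rule log_gradient_deriv_along[OF F])
  show "((\<lambda>y. log_gradient F \<i> (Complex x y)) has_real_derivative log_hessian F \<i> (Complex x y)) (at y)"
    unfolding Complex_lines(2) by (rule log_gradient_deriv_along[OF F])
qed (intro continuous_on_Complex continuous_intros continuous_curve_quantities F)+

text \<open>Splitting \<open>F' = \<lambda>F + K\<close> with \<open>K \<bottom> F\<close>, only \<open>K\<close> contributes to the derivative of the projector.\<close>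

lemma proj_mat_deriv_along:
  fixes F :: "complex \<Rightarrow> complex ^ 'k::finite"
  assumes F: "\<And>i. (\<lambda>z. F z $ i) holomorphic_on UNIV" "\<And>z. F z \<noteq> 0" and v: "cmod v = 1"
  obtains D where "((\<lambda>t. proj_mat (proj (F (z + of_real t * v))) $ i $ j) has_vector_derivative D) (at t)"
    "norm D \<le> 2 * sqrt (curve_energy F (z + of_real t * v))"
proof -
  let ?p = "\<lambda>t. z + complex_of_real t * v"
  define N where "N = (\<lambda>w. complex_of_real ((norm (F w))\<^sup>2))"
  define A where "A = F (?p t)"
  define B where "B = curve_deriv F (?p t)"
  define c where "c = cinner B A"
  define S where "S = (norm A)\<^sup>2"
  have S: "S > 0" using F(2) by (simp add: S_def A_def)
  have N': "((\<lambda>t. N (?p t)) has_vector_derivative of_real (2 * Re (v * c))) (at t)"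
    unfolding N_def c_def A_def B_def
    using norm_square_deriv_along[OF F(1), of z v t, unfolded has_real_derivative_iff_has_vector_derivative]
    by (rule bounded_linear.has_vector_derivative[OF bounded_linear_of_real])
  have num: "((\<lambda>t. F (?p t) $ i * cnj (F (?p t) $ j)) has_vector_derivative
      A $ i * cnj (v * B $ j) + (v * B $ i) * cnj (A $ j)) (at t)"
    unfolding A_def B_def curve_deriv_def vec_lambda_beta
    by (intro has_vector_derivative_mult has_vector_derivative_cnj has_vector_derivative_along F)
  define D where "D = (A $ i * cnj (v * B $ j) + (v * B $ i) * cnj (A $ j)) / of_real S
      - A $ i * cnj (A $ j) * of_real (2 * Re (v * c)) / (of_real S)\<^sup>2"
  have inv: "((\<lambda>t. inverse (N (?p t))) has_vector_derivative - (of_real (2 * Re (v * c)) / (of_real S)\<^sup>2)) (at t)"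
  proof -
    have "N (?p t) = of_real S" by (simp add: N_def S_def A_def)
    then have "N (?p t) \<noteq> 0" using S by simp
    from field_vector_diff_chain_at[OF N' DERIV_inverse[OF this]]
    show ?thesis using \<open>N (?p t) = of_real S\<close> by (simp add: o_def divide_inverse power2_eq_square)
  qed
  have pe: "proj_mat (proj (F w)) $ i $ j = F w $ i * cnj (F w $ j) * inverse (N w)" for w
    by (simp add: proj_mat_proj F(2) N_def divide_inverse)
  have "((\<lambda>t. proj_mat (proj (F (?p t))) $ i $ j) has_vector_derivative
      (F (?p t) $ i * cnj (F (?p t) $ j)) * (- (of_real (2 * Re (v * c)) / (of_real S)\<^sup>2)) +
      (A $ i * cnj (v * B $ j) + (v * B $ i) * cnj (A $ j)) * inverse (N (?p t))) (at t)"
    unfolding pe by (rule has_vector_derivative_mult[OF num inv])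
  moreover have "(F (?p t) $ i * cnj (F (?p t) $ j)) * (- (of_real (2 * Re (v * c)) / (of_real S)\<^sup>2)) +
      (A $ i * cnj (v * B $ j) + (v * B $ i) * cnj (A $ j)) * inverse (N (?p t)) = D"
    by (simp add: D_def N_def S_def A_def divide_inverse)
  ultimately have der: "((\<lambda>t. proj_mat (proj (F (?p t))) $ i $ j) has_vector_derivative D) (at t)" by simp
  define l where "l = c / of_real S"
  define K where "K = B - l *s A"
  have nK: "(norm K)\<^sup>2 = (norm B)\<^sup>2 - (cmod c)\<^sup>2 / S"
  proof -
    have "complex_of_real ((norm K)\<^sup>2) = cinner K K" by (simp add: cinner_self)
    also have "\<dots> = cinner B B - cnj l * c - l * cnj c + l * cnj l * cinner A A"
      unfolding K_def by (simp add: cinner_diff_left cinner_diff_right cinner_scale_left cinner_scale_right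
          c_def cinner_cnj[of A B] algebra_simps)
    also have "\<dots> = of_real ((norm B)\<^sup>2) - c * cnj c / of_real S"
      using S by (simp add: cinner_self l_def S_def[symmetric] flip: of_real_power)
    also have "\<dots> = of_real ((norm B)\<^sup>2 - (cmod c)\<^sup>2 / S)"
      by (simp add: complex_norm_square del: of_real_power)
    finally show ?thesis by (simp only: of_real_eq_iff)
  qed
  have B: "B $ u = K $ u + l * A $ u" for u by (simp add: K_def)
  have "D = (A $ i * cnj (v * K $ j) + (v * K $ i) * cnj (A $ j)) / of_real S"
  proof -
    have r: "complex_of_real (2 * Re (v * c)) = of_real S * (v * l + cnj (v * l))"
      using S complex_add_cnj[of "v * c"] by (simp add: l_def ring_distribs)
    have "D = (A $ i * cnj (v * B $ j) + (v * B $ i) * cnj (A $ j) - A $ i * cnj (A $ j) * (v * l + cnj (v * l))) / of_real S"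
      unfolding D_def r using S by (simp add: power2_eq_square diff_divide_distrib)
    then show ?thesis unfolding B by (simp add: algebra_simps)
  qed
  then have "norm D \<le> (norm (A $ i) * norm (K $ j) + norm (K $ i) * norm (A $ j)) / S"
    using S v norm_triangle_ineq[of "A $ i * cnj (v * K $ j)" "(v * K $ i) * cnj (A $ j)"]
    by (simp add: norm_divide norm_mult divide_right_mono)
  also have "\<dots> \<le> (norm A * norm K + norm K * norm A) / S"
    using S by (intro divide_right_mono add_mono mult_mono Finite_Cartesian_Product.norm_nth_le) auto
  also have "\<dots> = 2 * (norm K * norm A / S)" by (simp add: mult.commute)
  also have "norm K * norm A / S = sqrt (curve_energy F (?p t))"
  proof -
    have "(norm K * norm A / S)\<^sup>2 = curve_energy F (?p t)"
      unfolding power_divide power_mult_distrib nK curve_energy_def A_def[symmetric] B_def[symmetric] c_def[symmetric] S_def[symmetric]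
      using S by (simp add: field_simps power2_eq_square)
    then show ?thesis using S by (metis abs_of_nonneg divide_nonneg_nonneg less_imp_le mult_nonneg_nonneg norm_ge_zero real_sqrt_abs)
  qed
  finally show ?thesis using der that by blast
qed

section \<open>Brody curves avoiding hypersurfaces\<close>

lemma finite_intersection_general_position:
  assumes V: "projective_variety V" and dim: "proj_dim V = ereal (real n)"
    and D: "\<forall>i\<in>{1..n}. hypersurface (D i)" and gen: "general_position V n D"
  shows "finite (V \<inter> (\<Inter>i\<in>{1..n}. zeros (D i)))"
proof (rule finite_if_proj_dim_le_0)
  obtain S where S: "\<forall>Q\<in>S. \<exists>d. homogeneous d Q" "V = (\<Inter>Q\<in>S. zeros Q)"
    using V by (auto simp: projective_variety_def zariski_closed_def)
  have "V \<inter> (\<Inter>i\<in>{1..n}. zeros (D i)) = (\<Inter>Q\<in>S \<union> D ` {1..n}. zeros Q)" using S by auto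
  then show "zariski_closed (V \<inter> (\<Inter>i\<in>{1..n}. zeros (D i)))"
    unfolding zariski_closed_def using S D by (intro exI[of _ "S \<union> D ` {1..n}"]) (auto simp: hypersurface_def)
  show "proj_dim (V \<inter> (\<Inter>i\<in>{1..n}. zeros (D i))) \<le> 0"
  proof (cases "n = 0")
    \<comment> \<open>The intersection over no hypersurfaces is the whole space, so the set is
      \<open>V\<close>, of dimension 0.\<close>
    case True
    then show ?thesis using dim by (simp add: zero_ereal_def)
  next
    case False
    obtain m where "proj_dim V = ereal (real m)" "subgeneral_position m V n D"
      using gen by (auto simp: general_position_def)
    \<comment> \<open>The \<open>m\<close> of \<open>general_position\<close> is \<open>n\<close>,
      both being the dimension of \<open>V\<close>. With all \<open>n\<close> hypersurfaces taken
      together the bound becomes \<open>n - n\<close>.\<close>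
    then have "subgeneral_position n V n D" using dim by simp
    moreover have "{1..n} \<noteq> {}" "card {1..n} \<le> n + 1" using False by auto
    ultimately have "proj_dim ((\<Inter>i\<in>{1..n}. zeros (D i)) \<inter> V) \<le> ereal (real n - real (card {1..n}))"
      unfolding subgeneral_position_def by blast
    then show ?thesis by (simp add: Int_commute zero_ereal_def)
  qed
qed

lemma continuous_eval_poly: "continuous_on S (eval_poly Q)"
  unfolding eval_poly_def[abs_def] by (intro continuous_intros)

lemma proj_mat_unit:
  assumes "norm x = 1"
  shows "proj_mat (proj x) = (\<chi> i j. x $ i * cnj (x $ j))"
proof -
  have x0: "x \<noteq> 0" using assms by auto
  show ?thesis unfolding vec_eq_iff by (simp add: proj_mat_proj[OF x0] assms)
qed

lemma inj_proj_mat: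
  assumes "proj_mat p = proj_mat q"
  shows "p = q"
proof -
  have "sin (fs_dist p q) = 0" using dist_proj_mat[of p q] assms by simp
  moreover have "fs_dist p q < pi" using fs_dist_bounds(2)[of p q] pi_gt_zero by linarith
  ultimately have "fs_dist p q = 0"
    using fs_dist_bounds(1)[of p q] sin_gt_zero[of "fs_dist p q"] by (cases "fs_dist p q = 0") auto
  then show ?thesis by (simp add: fs_dist_eq_0_iff)
qed

text \<open>Compactness: unit vectors over \<open>V\<close> whose projector stays \<eta>-far from
  the intersection form a compact set on which the sum of the moduli of the forms is positive, hence
  bounded away from 0.\<close>

lemma near_intersection:
  fixes V :: "'k::finite proj_space set" and D :: "nat \<Rightarrow> 'k polynomial"
  assumes V: "zariski_closed V" and D: "\<And>i. i \<in> I \<Longrightarrow> \<exists>d. homogeneous d (D i)" and I: "finite I"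
    and \<eta>: "\<eta> > 0"
  obtains \<tau> where "\<tau> > 0"
    "\<And>x. norm x = 1 \<Longrightarrow> proj x \<in> V \<Longrightarrow> (\<And>i. i \<in> I \<Longrightarrow> cmod (eval_poly (D i) x) \<le> \<tau>) \<Longrightarrow>
      \<exists>p\<in>V \<inter> (\<Inter>i\<in>I. zeros (D i)). dist (proj_mat (proj x)) (proj_mat p) < \<eta>"
proof -
  let ?P = "V \<inter> (\<Inter>i\<in>I. zeros (D i))"
  obtain S where S: "\<forall>Q\<in>S. \<exists>d. homogeneous d Q" "V = (\<Inter>Q\<in>S. zeros Q)"
    using V by (auto simp: zariski_closed_def)
  have x0: "x \<noteq> 0" if "norm x = 1" for x :: "complex ^ 'k" using that by auto
  have inV: "proj x \<in> V \<longleftrightarrow> (\<forall>Q\<in>S. eval_poly Q x = 0)" if "norm x = 1" for x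
    using S proj_in_zeros_iff[OF _ x0[OF that]] by blast
  \<comment> \<open>The products \<open>x $ i * cnj (x $ j)\<close> are continuous everywhere and
    agree with \<open>proj_mat (proj x)\<close> on unit vectors, which makes \<open>K\<close>
    closed.\<close>
  define K where "K = {x :: complex ^ 'k. norm x = 1} \<inter> (\<Inter>Q\<in>S. {x. eval_poly Q x = 0}) \<inter>
      (\<Inter>p\<in>?P. {x. \<eta> \<le> dist (\<chi> i j. x $ i * cnj (x $ j)) (proj_mat p)})"
  have "closed K"
    unfolding K_def
    by (intro closed_Int closed_INT ballI closed_Collect_eq closed_Collect_le continuous_eval_poly continuous_intros)
  moreover have "bounded K" unfolding K_def by (rule boundedI[of _ 1]) auto
  ultimately have cK: "compact K" by (simp add: compact_eq_bounded_closed)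
  define g where "g x = (\<Sum>i\<in>I. cmod (eval_poly (D i) x))" for x
  have cg: "continuous_on K g"
    unfolding g_def[abs_def] by (intro continuous_intros continuous_eval_poly)
  have gpos: "g x > 0" if x: "x \<in> K" for x
  proof (rule ccontr)
    assume "\<not> g x > 0"
    then have "g x = 0" using sum_nonneg[of I "\<lambda>i. cmod (eval_poly (D i) x)"] by (auto simp: g_def not_less)
    then have z: "\<forall>i\<in>I. eval_poly (D i) x = 0" using I by (simp add: g_def sum_nonneg_eq_0_iff)
    have n1: "norm x = 1" using x by (auto simp: K_def)
    have "proj x \<in> ?P"
      using inV[OF n1] x z D proj_in_zeros_iff[OF _ x0[OF n1]] by (auto simp: K_def)
    then have "\<eta> \<le> dist (\<chi> i j. x $ i * cnj (x $ j)) (proj_mat (proj x))" using x unfolding K_def by blast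
    then show False using \<eta> by (simp add: proj_mat_unit[OF n1])
  qed
  obtain \<mu> where \<mu>: "\<mu> > 0" "\<And>x. x \<in> K \<Longrightarrow> \<mu> \<le> g x"
  proof (cases "K = {}")
    case True
    then show ?thesis using that[of 1] by auto
  next
    case False
    obtain x where "x \<in> K" "\<forall>y\<in>K. g x \<le> g y" using continuous_attains_inf[OF cK False cg] by blast
    then show ?thesis using that[of "g x"] gpos by auto
  qed
  show ?thesis
  \<comment> \<open>The added 1 keeps the sum over \<open>I\<close> strictly below \<mu>, also for
    empty \<open>I\<close>.\<close>
  proof (rule that[of "\<mu> / (real (card I) + 1)"])
    show "\<mu> / (real (card I) + 1) > 0" using \<mu> by simp
    fix x assume x: "norm x = 1" "proj x \<in> V" and s: "\<And>i. i \<in> I \<Longrightarrow> cmod (eval_poly (D i) x) \<le> \<mu> / (real (card I) + 1)"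
    have "g x \<le> real (card I) * (\<mu> / (real (card I) + 1))"
      unfolding g_def using sum_bounded_above[OF s] by simp
    also have "\<dots> < \<mu>" using \<mu>(1) by (simp add: field_simps)
    finally have "x \<notin> K" using \<mu>(2)[of x] by auto
    then show "\<exists>p\<in>?P. dist (proj_mat (proj x)) (proj_mat p) < \<eta>"
      using x inV[OF x(1)] unfolding K_def proj_mat_unit[OF x(1)] by (auto simp: not_le)
  qed
qed

lemma holomorphic_eval_poly:
  assumes "\<And>i. (\<lambda>z. F z $ i) holomorphic_on UNIV"
  shows "(\<lambda>z. eval_poly Q (F z)) holomorphic_on UNIV"
  unfolding eval_poly_def by (intro holomorphic_intros assms)

text \<open>Along any representation \<open>Q\<close> is entire and zero-free, hence an exponential
  of some \<open>l\<close>; as \<open>Q\<close> has degree \<open>d\<close>, scaling by exp (- l /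
  d) turns it into 1.\<close>

lemma normalised_rep:
  assumes f: "holomorphic_curve f" and Q: "homogeneous d Q" "d \<ge> 1" and avoid: "\<And>z. f z \<notin> zeros Q"
  obtains G where "reduced_rep G f" "\<And>z. eval_poly Q (G z) = 1"
proof -
  obtain F where F: "reduced_rep F f" using f by (auto simp: holomorphic_curve_def)
  then have hol: "\<And>i. (\<lambda>z. F z $ i) holomorphic_on UNIV" and nz: "\<And>z. F z \<noteq> 0" and fp: "\<And>z. f z = proj (F z)"
    by (auto simp: reduced_rep_def)
  have "eval_poly Q (F z) \<noteq> 0" for z
    using avoid[of z] proj_in_zeros_iff[OF Q(1) nz[of z]] by (simp add: fp)
  then obtain l where l: "l holomorphic_on UNIV" "\<And>z. eval_poly Q (F z) = exp (l z)"
    using contractible_imp_holomorphic_log[OF holomorphic_eval_poly[OF hol] contractible_UNIV] by auto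
  define G where "G z = exp (- l z / of_nat d) *s F z" for z
  have G0: "G z \<noteq> 0" for z using nz[of z] by (auto simp: G_def vec_eq_iff)
  have "proj (F z) = proj (G z)" for z
    using proj_eq_iff[OF nz[of z] G0[of z]] by (auto simp: G_def)
  moreover have "(\<lambda>z. G z $ i) holomorphic_on UNIV" for i
    unfolding G_def vector_smult_component using Q(2) by (intro holomorphic_intros l hol) auto
  ultimately have "reduced_rep G f" using G0 fp by (auto simp: reduced_rep_def)
  moreover have "eval_poly Q (G z) = 1" for z
  proof -
    have "exp (- l z / of_nat d) ^ d = exp (- l z)"
      using Q(2) by (simp flip: exp_of_nat_mult)
    then show ?thesis
      by (simp add: G_def eval_poly_scale[OF Q(1)] l(2) exp_minus)
  qed
  ultimately show ?thesis by (rule that)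
qed

lemma unit_scale_cases:
  fixes x :: "complex ^ 'k::finite"
  assumes "x \<noteq> 0"
  obtains y where "norm y = 1" "x = of_real (norm x) *s y" "proj y = proj x"
proof -
  define y where "y = of_real (inverse (norm x)) *s x"
  have x: "x = of_real (norm x) *s y" using assms by (simp add: y_def)
  have 1: "norm y = 1" using assms by (simp add: y_def norm_vec_scale norm_inverse)
  then have "y \<noteq> 0" by auto
  then have "proj y = proj x" using assms x proj_eq_iff[of y x] by (metis norm_eq_zero of_real_eq_0_iff)
  then show ?thesis using that 1 x by blast
qed

text \<open>\<open>Q\<close> is bounded on the unit sphere, so a vector at which it equals 1 cannot
  be short. This is the lower bound for the logarithms of the normalised representations.\<close>

lemma homogeneous_eval_bound:
  assumes Q: "homogeneous d Q" "d \<ge> 1"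
  obtains C where "C \<ge> 0" "\<And>x. eval_poly Q x = 1 \<Longrightarrow> - C \<le> ln (norm x)"
proof -
  have "compact (eval_poly Q ` sphere 0 1)"
    by (intro compact_continuous_image continuous_eval_poly compact_sphere)
  then have "bounded (eval_poly Q ` sphere 0 1)" by (rule compact_imp_bounded)
  then obtain M where "\<forall>y\<in>eval_poly Q ` sphere 0 1. cmod y \<le> M" unfolding bounded_iff by blast
  then have M: "cmod (eval_poly Q x) \<le> M" if "norm x = 1" for x using that by simp
  \<comment> \<open>At least 1, so that \<open>ln M'\<close> is nonnegative and a vector shorter
    than \<open>1 / M'\<close> has \<open>norm x ^ d\<close> at most \<open>norm x\<close>.\<close>
  define M' where "M' = max M 1"
  show ?thesis
  proof (rule that[of "ln M'"])
    show "ln M' \<ge> 0" by (simp add: M'_def)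
    fix x assume x: "eval_poly Q x = 1"
    have x0: "x \<noteq> 0"
    proof
      assume "x = 0"
      then have "eval_poly Q x = 0 ^ d * eval_poly Q x" using eval_poly_scale[OF Q(1), of 0 x] by simp
      then show False using x Q(2) by (simp add: power_0_left)
    qed
    obtain y where y: "norm y = 1" "x = of_real (norm x) *s y" by (rule unit_scale_cases[OF x0])
    have "1 = (of_real (norm x)) ^ d * eval_poly Q y"
      using x y(2) eval_poly_scale[OF Q(1)] by metis
    then have "1 = norm x ^ d * cmod (eval_poly Q y)"
      by (metis norm_mult norm_one norm_power norm_of_real abs_norm_cancel)
    also have "\<dots> \<le> norm x ^ d * M'" using M[OF y(1)] by (intro mult_left_mono) (auto simp: M'_def)
    finally have 1: "1 \<le> norm x ^ d * M'" .
    have "1 / M' \<le> norm x"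
    proof (rule ccontr)
      assume "\<not> ?thesis"
      then have lt: "norm x < 1 / M'" by simp
      also have "1 / M' \<le> 1" by (simp add: M'_def)
      finally have "norm x ^ d \<le> norm x ^ 1" using Q(2) by (intro power_decreasing) auto
      then have "norm x ^ d * M' \<le> norm x * M'" by (intro mult_right_mono) (auto simp: M'_def)
      also have "\<dots> < 1" using lt by (simp add: M'_def field_simps)
      finally show False using 1 by simp
    qed
    moreover have "0 < 1 / M'" by (simp add: M'_def)
    ultimately have "ln (1 / M') \<le> ln (norm x)" by (subst ln_le_cancel_iff) auto
    moreover have "ln (1 / M') = - ln M'"
      using \<open>0 < 1 / M'\<close> by (simp add: ln_div)
    ultimately show "- ln M' \<le> ln (norm x)" by simp
  qed
qed

lemma continuous_proj_mat_curve:
  assumes "reduced_rep F f"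
  shows "continuous_on S (\<lambda>z. proj_mat (f z))"
proof -
  have F: "\<And>i. (\<lambda>z. F z $ i) holomorphic_on UNIV" "\<And>z. F z \<noteq> 0" "\<And>z. f z = proj (F z)"
    using assms by (auto simp: reduced_rep_def)
  have e: "proj_mat (f z) = (\<chi> i j. F z $ i * cnj (F z $ j) / of_real ((norm (F z))\<^sup>2))" for z
    unfolding vec_eq_iff by (simp add: F(3) proj_mat_proj F(2))
  have "continuous_on UNIV (\<lambda>z. F z $ i)" for i by (rule holomorphic_on_imp_continuous_on[OF F(1)])
  then have "continuous_on UNIV (\<lambda>z. proj_mat (f z))"
    unfolding e using F(2) by (intro continuous_intros continuous_curve[OF F(1)]) auto
  then show ?thesis by (rule continuous_on_subset) simp
qed

text \<open>Where all normalised representations are large, every form is small on a unit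
  representative of \<open>f z\<close>, so \<open>f z\<close> is close to the finite intersection.
  The image of a connected set cannot jump between the disjoint balls around its points.\<close>

lemma small_oscillation_off_hypersurfaces:
  fixes V :: "'k::finite proj_space set" and D :: "nat \<Rightarrow> 'k polynomial"
  assumes V: "zariski_closed V" and D: "\<And>i. i \<in> I \<Longrightarrow> \<exists>d\<ge>1. homogeneous d (D i)" and I: "finite I"
    and fin: "finite (V \<inter> (\<Inter>i\<in>I. zeros (D i)))" and \<delta>: "\<delta> > 0"
  obtains T where "T \<ge> 0"
    "\<And>f G S z z'. holomorphic_curve f \<Longrightarrow> range f \<subseteq> V \<Longrightarrow> (\<And>i. i \<in> I \<Longrightarrow> reduced_rep (G i) f) \<Longrightarrow>
      (\<And>i z. i \<in> I \<Longrightarrow> eval_poly (D i) (G i z) = 1) \<Longrightarrow> connected S \<Longrightarrow>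
      (\<And>i z. i \<in> I \<Longrightarrow> z \<in> S \<Longrightarrow> T < ln (norm (G i z))) \<Longrightarrow> z \<in> S \<Longrightarrow> z' \<in> S \<Longrightarrow>
      dist (proj_mat (f z)) (proj_mat (f z')) \<le> \<delta>"
proof -
  let ?P = "V \<inter> (\<Inter>i\<in>I. zeros (D i))"
  define R where "R = (\<lambda>(p, q). dist (proj_mat p) (proj_mat q)) ` {(p, q) \<in> ?P \<times> ?P. p \<noteq> q}"
  have fR: "finite R" unfolding R_def by (rule finite_imageI, rule finite_subset[of _ "?P \<times> ?P"]) (use fin in auto)
  \<comment> \<open>At most half the smallest distance between two of the points, so the
    \<eta>-balls are disjoint; the inserted 1 covers the case of fewer than two points.\<close>
  define \<eta> where "\<eta> = min (\<delta> / 2) (Min (insert 1 R) / 2)"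
  have "0 < Min (insert 1 R)"
    using fR by (subst Min_gr_iff) (auto simp: R_def dest: inj_proj_mat)
  then have \<eta>: "\<eta> > 0" "\<eta> \<le> \<delta> / 2" using \<delta> by (auto simp: \<eta>_def)
  have sep: "2 * \<eta> \<le> dist (proj_mat p) (proj_mat q)" if "p \<in> ?P" "q \<in> ?P" "p \<noteq> q" for p q
  proof -
    have "dist (proj_mat p) (proj_mat q) \<in> R" using that by (auto simp: R_def intro!: image_eqI[of _ _ "(p, q)"])
    then have "Min (insert 1 R) \<le> dist (proj_mat p) (proj_mat q)" using fR by (intro Min_le) auto
    then show ?thesis by (simp add: \<eta>_def)
  qed
  obtain \<tau> where \<tau>: "\<tau> > 0" "\<And>x. norm x = 1 \<Longrightarrow> proj x \<in> V \<Longrightarrow> (\<And>i. i \<in> I \<Longrightarrow> cmod (eval_poly (D i) x) \<le> \<tau>) \<Longrightarrow>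
      \<exists>p\<in>?P. dist (proj_mat (proj x)) (proj_mat p) < \<eta>"
    using near_intersection[OF V _ I \<eta>(1), of D] D by metis
  \<comment> \<open>Besides making exp (- T) at most \<tau>, \<open>T\<close> is taken nonnegative:
    a scale above exp T is then at least 1, and its \<open>d\<close>-th power is still above exp
    T.\<close>
  define T where "T = max 0 (- ln \<tau>)"
  have T: "T \<ge> 0" "exp (- T) \<le> \<tau>"
  proof -
    have "- T \<le> ln \<tau>" by (simp add: T_def)
    then show "exp (- T) \<le> \<tau>" using \<tau>(1) by (metis exp_le_cancel_iff exp_ln)
  qed (simp add: T_def)
  show ?thesis
  proof (rule that[OF T(1)])
    fix f G S z z'
    assume f: "holomorphic_curve f" "range f \<subseteq> V" and G: "\<And>i. i \<in> I \<Longrightarrow> reduced_rep (G i) f"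
      "\<And>i z. i \<in> I \<Longrightarrow> eval_poly (D i) (G i z) = 1" and S: "connected S"
      and big: "\<And>i z. i \<in> I \<Longrightarrow> z \<in> S \<Longrightarrow> T < ln (norm (G i z))" and z: "z \<in> S" "z' \<in> S"
    have near: "\<exists>p\<in>?P. dist (proj_mat (f z)) (proj_mat p) < \<eta>" if zS: "z \<in> S" for z
    proof -
      obtain x where x: "norm x = 1" "f z = proj x" by (rule proj_unit_cases)
      have x0: "x \<noteq> 0" using x by auto
      have "cmod (eval_poly (D i) x) \<le> \<tau>" if i: "i \<in> I" for i
      proof -
        have g: "G i z \<noteq> 0" "f z = proj (G i z)" using G(1)[OF i] by (auto simp: reduced_rep_def)
        then obtain c where c: "G i z = c *s x" using x proj_eq_iff[OF x0 g(1)] by auto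
        have cn: "cmod c = norm (G i z)" using x(1) by (simp add: c norm_vec_scale)
        obtain d where d: "d \<ge> 1" "homogeneous d (D i)" using D[OF i] by blast
        have "c ^ d * eval_poly (D i) x = 1" using G(2)[OF i, of z] by (simp add: c eval_poly_scale[OF d(2)])
        then have e: "cmod c ^ d * cmod (eval_poly (D i) x) = 1" by (metis norm_mult norm_one norm_power)
        have "T < ln (cmod c)" using big[OF i zS] cn by simp
        then have "exp T < cmod c" using g(1) cn by (metis exp_less_cancel_iff exp_ln zero_less_norm_iff)
        moreover have "1 \<le> exp T" using T(1) by simp
        ultimately have "exp T \<le> cmod c ^ d"
          using d(1) by (metis less_imp_le order_trans power_increasing power_one_right)
        then have "exp T * cmod (eval_poly (D i) x) \<le> 1" using e mult_right_mono[OF _ norm_ge_zero] by metis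
        then have "cmod (eval_poly (D i) x) \<le> exp (- T)" by (simp add: exp_minus field_simps)
        then show ?thesis using T(2) by simp
      qed
      moreover have "proj x \<in> V" using f(2) x(2) by (metis rangeI subsetD)
      ultimately show ?thesis using \<tau>(2)[OF x(1)] x(2) by simp
    qed
    obtain p where p: "p \<in> ?P" "dist (proj_mat (f z)) (proj_mat p) < \<eta>" using near[OF z(1)] by blast
    obtain F where F: "reduced_rep F f" using f(1) by (auto simp: holomorphic_curve_def)
    define h where "h = (\<lambda>z. proj_mat (f z))"
    have conn: "connected (h ` S)"
      unfolding h_def by (intro connected_continuous_image continuous_proj_mat_curve[OF F] S)
    let ?W = "\<Union>q\<in>?P - {p}. ball (proj_mat q) \<eta>"
    have "ball (proj_mat p) \<eta> \<inter> ?W \<inter> h ` S = {}"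
    proof (rule ccontr)
      assume "\<not> ?thesis"
      then obtain w where w: "w \<in> ball (proj_mat p) \<eta>" "w \<in> ?W" by blast
      then obtain q where "q \<in> ?P - {p}" "w \<in> ball (proj_mat q) \<eta>" by blast
      then have q: "q \<in> ?P" "p \<noteq> q" "dist (proj_mat p) w < \<eta>" "dist (proj_mat q) w < \<eta>"
        using w(1) by auto
      then show False using sep[OF p(1) q(1,2)] dist_triangle_less_add[of "proj_mat p" w \<eta> "proj_mat q" \<eta>] by auto
    qed
    moreover have "h ` S \<subseteq> ball (proj_mat p) \<eta> \<union> ?W"
    proof
      fix w assume "w \<in> h ` S"
      then obtain y where y: "y \<in> S" "w = h y" by auto
      obtain q where q: "q \<in> ?P" "dist (proj_mat (f y)) (proj_mat q) < \<eta>" using near[OF y(1)] by blast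
      then have "w \<in> ball (proj_mat q) \<eta>" by (simp add: y h_def dist_commute)
      then show "w \<in> ball (proj_mat p) \<eta> \<union> ?W" using q(1) by (cases "q = p") blast+
    qed
    ultimately have "ball (proj_mat p) \<eta> \<inter> h ` S = {} \<or> ?W \<inter> h ` S = {}"
      by (intro connectedD[OF conn]) auto
    moreover have "h z \<in> ball (proj_mat p) \<eta> \<inter> h ` S" using p z by (simp add: h_def dist_commute)
    ultimately have "?W \<inter> h ` S = {}" by blast
    then have "h z' \<in> ball (proj_mat p) \<eta>"
      using \<open>h ` S \<subseteq> _\<close> z(2) by blast
    then have "dist (proj_mat (f z)) (proj_mat (f z')) < \<eta> + \<eta>"
      using p(2) by (intro dist_triangle_less_add[of _ "proj_mat p"]) (auto simp: h_def dist_commute)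
    then show "dist (proj_mat (f z)) (proj_mat (f z')) \<le> \<delta>" using \<eta>(2) by simp
  qed
qed

section \<open>Squares on which a Brody curve oscillates\<close>

definition square :: "real \<Rightarrow> real \<Rightarrow> real \<Rightarrow> nat \<times> nat \<Rightarrow> complex set" where
  "square X Y L g = {z. (Re z, Im z) \<in> grid_square X Y L g}"

lemma connected_square: "connected (square X Y L g)"
proof -
  obtain a b where g: "g = (a, b)" by (cases g)
  have "square X Y L g = cbox (Complex (X + real a * L) (Y + real b * L)) (Complex (X + real (Suc a) * L) (Y + real (Suc b) * L))"
    by (auto simp: square_def grid_square_def g in_cbox_complex_iff simp del: of_nat_Suc)
  then show ?thesis by (simp add: convex_connected)
qed

text \<open>Oscillation is measured entry by entry in the projector, the same real data that later
  form the coordinates of the map to a complex.\<close>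

definition bad_squares ::
  "(complex \<Rightarrow> 'k::finite proj_space) \<Rightarrow> real \<Rightarrow> real \<Rightarrow> real \<Rightarrow> real \<Rightarrow> nat \<Rightarrow> (nat \<times> nat) set" where
  "bad_squares f \<delta> X Y L s = {g \<in> {..<s} \<times> {..<s}. \<exists>z\<in>square X Y L g. \<exists>z'\<in>square X Y L g. \<exists>i j.
     \<delta> < cmod (proj_mat (f z) $ i $ j - proj_mat (f z') $ i $ j)}"

lemma brody_space_energy:
  assumes "f \<in> brody_space U" "reduced_rep F f"
  shows "curve_energy F z \<le> 1"
proof -
  have "sqrt (curve_energy F z) \<le> 1"
    using assms by (simp add: brody_space_def fs_derivative_eq fs_derivative_rep_eq flip: fs_derivative_rep_eq)
  then show ?thesis by simp
qed

text \<open>\<open>square_energy\<close> applied to one projector entry, with \<open>m\<close> the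
  Fubini-Study derivative: \<open>proj_mat_deriv_along\<close> bounds the partial derivatives by
  \<open>2 * m\<close>, and the Brody condition gives \<open>m\<close> at most 1.\<close>

lemma bad_square_energy:
  fixes f :: "complex \<Rightarrow> 'k::{finite, linorder} proj_space"
  assumes f: "f \<in> brody_space U" and F: "reduced_rep F f" and L: "L > 0" and \<delta>: "\<delta> > 0"
    and g: "g \<in> bad_squares f \<delta> X Y L s"
  shows "min (\<delta> / 16) (L / 2) * ((\<delta> / 8)\<^sup>2 / L) \<le> integral (grid_square X Y L g) (\<lambda>(x, y). curve_energy F (Complex x y))"
proof -
  obtain z z' i j where z: "z \<in> square X Y L g" "z' \<in> square X Y L g"
    "\<delta> < cmod (proj_mat (f z) $ i $ j - proj_mat (f z') $ i $ j)"
    using g by (auto simp: bad_squares_def)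
  obtain a b where ab: "g = (a, b)" by (cases g)
  have rep: "\<And>i. (\<lambda>z. F z $ i) holomorphic_on UNIV" "\<And>z. F z \<noteq> 0" "\<And>z. f z = proj (F z)"
    using F by (auto simp: reduced_rep_def)
  define e where "e z = proj_mat (f z) $ i $ j" for z
  define m where "m x y = sqrt (curve_energy F (Complex x y))" for x y
  have "\<exists>D. ((\<lambda>x. e (Complex x y)) has_vector_derivative D) (at x) \<and> norm D \<le> 2 * m x y" for x y
    unfolding e_def rep(3) m_def Complex_lines(1) by (rule proj_mat_deriv_along[OF rep(1,2), of 1]) auto
  then obtain ex where ex: "\<And>x y. ((\<lambda>x. e (Complex x y)) has_vector_derivative ex x y) (at x)"
    "\<And>x y. norm (ex x y) \<le> 2 * m x y" by metis
  have "\<exists>D. ((\<lambda>y. e (Complex x y)) has_vector_derivative D) (at y) \<and> norm D \<le> 2 * m x y" for x y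
    unfolding e_def rep(3) m_def Complex_lines(2) by (rule proj_mat_deriv_along[OF rep(1,2), of \<i>]) auto
  then obtain ey where ey: "\<And>x y. ((\<lambda>y. e (Complex x y)) has_vector_derivative ey x y) (at y)"
    "\<And>x y. norm (ey x y) \<le> 2 * m x y" by metis
  have m: "continuous_on UNIV (\<lambda>(x, y). m x y)"
    unfolding m_def using continuous_on_Complex[OF continuous_on_real_sqrt[OF continuous_curve_quantities(4)[OF rep(1,2)]]] .
  have m01: "0 \<le> m x y" "m x y \<le> 1" for x y
    using brody_space_energy[OF f F] by (auto simp: m_def curve_energy_nonneg)
  have sq: "grid_square X Y L g = cbox (X + a * L, Y + b * L) (X + a * L + L, Y + b * L + L)"
    by (simp add: grid_square_def ab algebra_simps)
  have "min (\<delta> / 16) (L / 2) * ((\<delta> / 8)\<^sup>2 / L) \<le> integral (grid_square X Y L g) (\<lambda>(x, y). (m x y)\<^sup>2)"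
    unfolding sq
  proof (rule square_energy[OF ex ey m m01 L \<delta>])
    show "(Re z', Im z') \<in> cbox (X + a * L, Y + b * L) (X + a * L + L, Y + b * L + L)"
      "(Re z, Im z) \<in> cbox (X + a * L, Y + b * L) (X + a * L + L, Y + b * L + L)"
      using z by (auto simp: square_def sq)
    show "\<delta> < norm (e (Complex (Re z) (Im z)) - e (Complex (Re z') (Im z')))"
      using z(3) by (simp add: e_def)
  qed
  then show ?thesis by (simp add: m_def curve_energy_nonneg)
qed

text \<open>If all logarithms exceeded \<open>T\<close> throughout a square, the curve would not
  oscillate there. So each bad square is charged to an \<open>i\<close> whose logarithm is at most
  \<open>T\<close> somewhere in it, and the density bound is applied to each \<open>i\<close>
  separately.\<close>

lemma few_bad_squares:
  fixes V :: "'k::{finite, linorder} proj_space set" and D :: "nat \<Rightarrow> 'k polynomial"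
  assumes V: "zariski_closed V" and D: "\<And>i. i \<in> I \<Longrightarrow> \<exists>d\<ge>1. homogeneous d (D i)" and I: "finite I"
    and fin: "finite (V \<inter> (\<Inter>i\<in>I. zeros (D i)))" and L: "L > 0" and \<delta>: "\<delta> > 0" and \<beta>: "\<beta> > 0"
  obtains \<kappa> b0 :: nat where "\<kappa> > 0"
    "\<And>f X Y b. f \<in> brody_space (V - (\<Union>i\<in>I. zeros (D i))) \<Longrightarrow> b0 \<le> b \<Longrightarrow>
      real (card (bad_squares f \<delta> X Y L (b * \<kappa>))) \<le> \<beta> * (real (b * \<kappa>))\<^sup>2"
proof -
  show ?thesis
  proof (rule small_oscillation_off_hypersurfaces[OF V D I fin \<delta>])
    fix T :: real
    assume T: "T \<ge> 0"
      "\<And>f G S z z'. holomorphic_curve f \<Longrightarrow> range f \<subseteq> V \<Longrightarrow> (\<And>i. i \<in> I \<Longrightarrow> reduced_rep (G i) f) \<Longrightarrow>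
        (\<And>i z. i \<in> I \<Longrightarrow> eval_poly (D i) (G i z) = 1) \<Longrightarrow> connected S \<Longrightarrow>
        (\<And>i z. i \<in> I \<Longrightarrow> z \<in> S \<Longrightarrow> T < ln (norm (G i z))) \<Longrightarrow> z \<in> S \<Longrightarrow> z' \<in> S \<Longrightarrow>
        dist (proj_mat (f z)) (proj_mat (f z')) \<le> \<delta>"
    have "\<exists>C\<ge>0. \<forall>x. eval_poly (D i) x = 1 \<longrightarrow> - C \<le> ln (norm x)" if "i \<in> I" for i
    proof -
      obtain d where "d \<ge> 1" "homogeneous d (D i)" using D[OF \<open>i \<in> I\<close>] by blast
      from homogeneous_eval_bound[OF this(2,1)] show ?thesis by metis
    qed
    then obtain C where C: "\<And>i. i \<in> I \<Longrightarrow> C i \<ge> 0" "\<And>i x. i \<in> I \<Longrightarrow> eval_poly (D i) x = 1 \<Longrightarrow> - C i \<le> ln (norm x)"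
      by metis
    \<comment> \<open>One shift making every logarithm nonnegative; it raises the threshold to
      \<open>T + c\<close>.\<close>
    define c where "c = (\<Sum>i\<in>I. C i)"
    have c: "c \<ge> 0" "\<And>i. i \<in> I \<Longrightarrow> C i \<le> c"
      using C(1) I by (auto simp: c_def intro: sum_nonneg member_le_sum)
    define e where "e = min (\<delta> / 16) (L / 2) * ((\<delta> / 8)\<^sup>2 / L)"
    have e: "e > 0" using L \<delta> by (simp add: e_def)
    \<comment> \<open>The families of bad squares for the indices \<open>i\<close> share \<beta>;
      the added 1 keeps the quotient meaningful for empty \<open>I\<close>.\<close>
    define \<beta>' where "\<beta>' = \<beta> / (real (card I) + 1)"
    have \<beta>': "\<beta>' > 0" using \<beta> by (simp add: \<beta>'_def)
    have Tc: "T + c \<ge> 0" using T(1) c(1) by simp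
    show ?thesis
    proof (rule few_energetic_squares[OF L e \<beta>' Tc])
      fix \<kappa> b0 :: nat
      assume \<kappa>: "\<kappa> > 0" and few:
        "\<And>w wx wy wxx wyy q X Y G b. plane_C2 w wx wy wxx wyy \<Longrightarrow> (\<And>x y. 0 \<le> w x y) \<Longrightarrow>
           continuous_on UNIV (\<lambda>(x, y). q x y) \<Longrightarrow> (\<And>x y. 0 \<le> q x y) \<Longrightarrow> (\<And>x y. q x y \<le> 1) \<Longrightarrow>
           (\<And>x y. wxx x y + wyy x y = 2 * q x y) \<Longrightarrow> b0 \<le> b \<Longrightarrow> G \<subseteq> {..<b * \<kappa>} \<times> {..<b * \<kappa>} \<Longrightarrow>
           (\<And>g. g \<in> G \<Longrightarrow> e \<le> integral (grid_square X Y L g) (\<lambda>(x, y). q x y)) \<Longrightarrow>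
           (\<And>g. g \<in> G \<Longrightarrow> \<exists>x y. (x, y) \<in> grid_square X Y L g \<and> w x y \<le> T + c) \<Longrightarrow>
           real (card G) \<le> \<beta>' * (real (b * \<kappa>))\<^sup>2"
      show ?thesis
      proof (rule that[OF \<kappa>])
        fix f :: "complex \<Rightarrow> 'k proj_space" and X Y :: real and b
        assume f: "f \<in> brody_space (V - (\<Union>i\<in>I. zeros (D i)))" and b: "b0 \<le> b"
        define s where "s = b * \<kappa>"
        let ?bad = "bad_squares f \<delta> X Y L s"
        have f': "holomorphic_curve f" "range f \<subseteq> V" "\<And>i z. i \<in> I \<Longrightarrow> f z \<notin> zeros (D i)"
          using f by (auto simp: brody_space_def)
        have "\<exists>G. reduced_rep G f \<and> (\<forall>z. eval_poly (D i) (G z) = 1)" if "i \<in> I" for i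
        proof -
          obtain d where "d \<ge> 1" "homogeneous d (D i)" using D[OF \<open>i \<in> I\<close>] by blast
          from normalised_rep[OF f'(1) this(2,1) f'(3)[OF that]] show ?thesis by metis
        qed
        then obtain G where G: "\<And>i. i \<in> I \<Longrightarrow> reduced_rep (G i) f" "\<And>i z. i \<in> I \<Longrightarrow> eval_poly (D i) (G i z) = 1"
          by metis
        define B where "B i = {g \<in> ?bad. \<exists>z\<in>square X Y L g. ln (norm (G i z)) \<le> T}" for i
        have cB: "real (card (B i)) \<le> \<beta>' * (real s)\<^sup>2" if i: "i \<in> I" for i
        proof -
          have rep: "\<And>j. (\<lambda>z. G i z $ j) holomorphic_on UNIV" "\<And>z. G i z \<noteq> 0"
            using G(1)[OF i] by (auto simp: reduced_rep_def)
          show ?thesis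
            unfolding s_def
          proof (rule few[OF plane_C2_ln_norm[OF rep, of c], where q = "\<lambda>x y. curve_energy (G i) (Complex x y)"])
            show "0 \<le> ln (norm (G i (Complex x y))) + c" for x y
              using C(2)[OF i G(2)[OF i], of "Complex x y"] c(2)[OF i] by linarith
            show "continuous_on UNIV (\<lambda>(x, y). curve_energy (G i) (Complex x y))"
              by (rule continuous_on_Complex[OF continuous_curve_quantities(4)[OF rep]])
            show "log_hessian (G i) 1 (Complex x y) + log_hessian (G i) \<i> (Complex x y) = 2 * curve_energy (G i) (Complex x y)" for x y
              by (rule log_hessian_sum[OF rep(2)])
            show "B i \<subseteq> {..<b * \<kappa>} \<times> {..<b * \<kappa>}" by (auto simp: B_def bad_squares_def s_def)
            fix g assume g: "g \<in> B i"
            show "e \<le> integral (grid_square X Y L g) (\<lambda>(x, y). curve_energy (G i) (Complex x y))"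
              unfolding e_def using g by (intro bad_square_energy[OF f G(1)[OF i] L \<delta>]) (auto simp: B_def)
            obtain z where z: "z \<in> square X Y L g" "ln (norm (G i z)) \<le> T" using g by (auto simp: B_def)
            then show "\<exists>x y. (x, y) \<in> grid_square X Y L g \<and> ln (norm (G i (Complex x y))) + c \<le> T + c"
              by (intro exI[of _ "Re z"] exI[of _ "Im z"]) (auto simp: square_def)
          qed (use b brody_space_energy[OF f G(1)[OF i]] in \<open>auto simp: curve_energy_nonneg\<close>)
        qed
        have "?bad \<subseteq> (\<Union>i\<in>I. B i)"
        proof
          fix g assume g: "g \<in> ?bad"
          then obtain z z' i j where z: "z \<in> square X Y L g" "z' \<in> square X Y L g"
            "\<delta> < cmod (proj_mat (f z) $ i $ j - proj_mat (f z') $ i $ j)" by (auto simp: bad_squares_def)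
          have "\<delta> < dist (proj_mat (f z)) (proj_mat (f z'))"
            using z(3) proj_mat_component_le[of "proj_mat (f z) - proj_mat (f z')" i j] by (simp add: dist_norm)
          have "\<exists>i\<in>I. \<exists>z\<in>square X Y L g. ln (norm (G i z)) \<le> T"
          proof (rule ccontr)
            assume "\<not> ?thesis"
            then have "T < ln (norm (G i w))" if "i \<in> I" "w \<in> square X Y L g" for i w using that by force
            from T(2)[OF f'(1,2) G connected_square this z(1,2)]
            have "dist (proj_mat (f z)) (proj_mat (f z')) \<le> \<delta>" by blast
            then show False using \<open>\<delta> < dist _ _\<close> by simp
          qed
          then show "g \<in> (\<Union>i\<in>I. B i)" using g by (auto simp: B_def)
        qed
        moreover have "finite (\<Union>i\<in>I. B i)"
          using I by (auto simp: B_def bad_squares_def)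
        ultimately have "card ?bad \<le> card (\<Union>i\<in>I. B i)" by (intro card_mono)
        also have "\<dots> \<le> (\<Sum>i\<in>I. card (B i))" by (rule card_UN_le[OF I])
        finally have "real (card ?bad) \<le> real (\<Sum>i\<in>I. card (B i))" by (rule of_nat_mono)
        also have "\<dots> = (\<Sum>i\<in>I. real (card (B i)))" by (rule of_nat_sum)
        also have "\<dots> \<le> (\<Sum>i\<in>I. \<beta>' * (real s)\<^sup>2)" by (rule sum_mono) (rule cB)
        also have "\<dots> = real (card I) * \<beta>' * (real s)\<^sup>2" by simp
        also have "\<dots> \<le> \<beta> * (real s)\<^sup>2"
          using \<beta> by (intro mult_right_mono) (auto simp: \<beta>'_def field_simps)
        finally show "real (card (bad_squares f \<delta> X Y L (b * \<kappa>))) \<le> \<beta> * (real (b * \<kappa>))\<^sup>2"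
          by (simp add: s_def)
      qed
    qed
  qed
qed

lemma proj_mat_lipschitz:
  fixes f :: "complex \<Rightarrow> 'k::{finite, linorder} proj_space"
  assumes f: "f \<in> brody_space U"
  shows "cmod (proj_mat (f z) $ i $ j - proj_mat (f z') $ i $ j) \<le> 2 * cmod (z - z')"
proof (cases "z = z'")
  case False
  obtain F where F: "reduced_rep F f" using f by (auto simp: brody_space_def holomorphic_curve_def)
  have rep: "\<And>i. (\<lambda>z. F z $ i) holomorphic_on UNIV" "\<And>z. F z \<noteq> 0" "\<And>z. f z = proj (F z)"
    using F by (auto simp: reduced_rep_def)
  define r where "r = cmod (z - z')"
  define v where "v = (z - z') / of_real r"
  have r: "r > 0" using False by (simp add: r_def)
  then have v: "cmod v = 1" by (simp add: v_def norm_divide r_def)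
  define e where "e t = proj_mat (f (z' + of_real t * v)) $ i $ j" for t
  have "\<exists>D. (e has_vector_derivative D) (at t) \<and> norm D \<le> 2" for t
  proof -
    obtain D where "((\<lambda>t. proj_mat (proj (F (z' + of_real t * v))) $ i $ j) has_vector_derivative D) (at t)"
      "norm D \<le> 2 * sqrt (curve_energy F (z' + of_real t * v))"
      by (rule proj_mat_deriv_along[OF rep(1,2) v])
    moreover have "sqrt (curve_energy F (z' + of_real t * v)) \<le> 1"
      using brody_space_energy[OF f F] by simp
    ultimately show ?thesis unfolding e_def rep(3)
      by (intro exI[of _ D] conjI) (assumption, linarith)
  qed
  then obtain D where D: "\<And>t. (e has_vector_derivative D t) (at t)" "\<And>t. norm (D t) \<le> 2" by metis
  have "norm (e r - e 0) \<le> integral {0..r} (\<lambda>_. 2)"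
    by (rule norm_diff_le_integral[OF D]) (use r in auto)
  moreover have "z' + of_real r * v = z" using r by (simp add: v_def)
  ultimately show ?thesis using r by (simp add: e_def r_def)
qed simp

section \<open>Mean dimension of the space of Brody curves\<close>

text \<open>A continuous way of discarding small values: it vanishes exactly from - \<delta> to
  \<delta> and moves no value by more than \<delta>. Small differences thus become the integer
  0.\<close>

definition soft_threshold :: "real \<Rightarrow> real \<Rightarrow> real" where
  "soft_threshold \<delta> t = t - max (- \<delta>) (min \<delta> t)"

lemma soft_threshold_facts:
  assumes "\<delta> \<ge> 0"
  shows "\<bar>soft_threshold \<delta> t - t\<bar> \<le> \<delta>" "\<bar>t\<bar> \<le> \<delta> \<Longrightarrow> soft_threshold \<delta> t = 0"
    "\<bar>soft_threshold \<delta> t - soft_threshold \<delta> u\<bar> \<le> \<bar>t - u\<bar>" "\<bar>soft_threshold \<delta> t\<bar> \<le> \<bar>t\<bar>"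
  using assms by (auto simp: soft_threshold_def max_def min_def)

lemma proj_mat_component_le_1: "cmod (proj_mat p $ i $ j) \<le> 1"
proof -
  obtain x where x: "norm x = 1" "p = proj x" by (rule proj_unit_cases)
  have "cmod (x $ i) * cmod (x $ j) \<le> 1 * 1"
    using Finite_Cartesian_Product.norm_nth_le[of x i] Finite_Cartesian_Product.norm_nth_le[of x j] x
    by (intro mult_mono) auto
  then show ?thesis by (simp add: x(2) proj_mat_unit[OF x(1)] norm_mult)
qed

definition part :: "bool \<Rightarrow> complex \<Rightarrow> real" where "part r w = (if r then Re w else Im w)"

lemma part_facts: "part r (v - w) = part r v - part r w" "\<bar>part r w\<bar> \<le> cmod w"
  "(\<And>r. \<bar>part r w\<bar> \<le> c) \<Longrightarrow> cmod w \<le> 2 * c"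
proof -
  show "part r (v - w) = part r v - part r w" "\<bar>part r w\<bar> \<le> cmod w"
    by (auto simp: part_def abs_Re_le_cmod abs_Im_le_cmod)
  assume "\<And>r. \<bar>part r w\<bar> \<le> c"
  from this[of True] this[of False] show "cmod w \<le> 2 * c"
    using cmod_le[of w] by (simp add: part_def)
qed

lemma dist_in_square:
  assumes "z \<in> square X Y L g" "z' \<in> square X Y L g"
  shows "cmod (z - z') \<le> 2 * L"
proof -
  obtain a b where g: "g = (a, b)" by (cases g)
  have "\<bar>Re (z - z')\<bar> \<le> L" "\<bar>Im (z - z')\<bar> \<le> L"
    using assms by (auto simp: square_def grid_square_def g algebra_simps)
  then show ?thesis using cmod_le[of "z - z'"] by simp
qed

text \<open>A coordinate with \<open>None\<close> is the value at the reference point of a square,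
  one with \<open>Some u\<close> the thresholded difference at a cell of side \<open>L / m\<close>.
  The former number 2 CARD('k)^2 s^2; the latter are nonzero only in bad squares, whose cells number
  at most s^2 in all, which adds the same amount.\<close>

lemma widim_brody_space_le:
  fixes U :: "'k::{finite, linorder} proj_space set"
  assumes inf: "infinite (UNIV :: (complex \<Rightarrow> 'k proj_space) set)"
    and R: "R > 0" and L: "L > 0" and \<delta>: "\<delta> > 0" and m: "m > 0" "L / real m \<le> \<delta>"
    and s: "2 * R \<le> real s * L" "s > 0"
    and small: "\<And>p q :: 'k proj_space. (\<And>i j. cmod (proj_mat p $ i $ j - proj_mat q $ i $ j) \<le> 20 * \<delta>) \<Longrightarrow> fs_dist p q \<le> \<epsilon>"
    and bad: "\<And>f. f \<in> brody_space U \<Longrightarrow> real (card (bad_squares f \<delta> (- R) (- R) L s)) \<le> (real s)\<^sup>2 / (real m)\<^sup>2"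
  shows "widim \<epsilon> (brody_space U) (disc_dist R) \<le> enat (4 * CARD('k)\<^sup>2 * s\<^sup>2)"
proof -
  define M where "M = brody_space U"
  define S where "S = square (- R) (- R) L"
  define cell where "cell = (\<lambda>(a, b). square (- R + real a * L) (- R + real b * L) (L / real m))"
  have Lm: "L / real m > 0" using L m by simp
  have cell_S: "cell g u \<subseteq> S g" if u: "u \<in> {..<m} \<times> {..<m}" for g u
  proof -
    obtain a b where g: "g = (a, b)" by (cases g)
    have "{u} \<subseteq> {..<m} \<times> {..<m}" using u by simp
    from grid_union(1)[OF Lm m(1) this, of "- R + real a * L" "- R + real b * L"]
    have "grid_square (- R + real a * L) (- R + real b * L) (L / real m) u \<subseteq> grid_square (- R) (- R) L g"
      using m(1) unfolding grid_square_def g by (simp add: algebra_simps)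
    then show ?thesis by (auto simp: cell_def S_def square_def g)
  qed
  have cover: "\<exists>g\<in>{..<s} \<times> {..<s}. \<exists>u\<in>{..<m} \<times> {..<m}. z \<in> cell g u" if z: "z \<in> cball 0 R" for z
  proof -
    have "\<bar>Re z\<bar> \<le> R" "\<bar>Im z\<bar> \<le> R" using z abs_Re_le_cmod[of z] abs_Im_le_cmod[of z] by auto
    then have "(Re z, Im z) \<in> cbox (- R, - R) (- R + real s * L, - R + real s * L)" using s by auto
    then obtain g where g: "g \<in> {..<s} \<times> {..<s}" "(Re z, Im z) \<in> grid_square (- R) (- R) L g"
      using grid_union(2)[OF L s(2), of "- R" "- R"] unfolding grid_square_def by blast
    obtain a b where ab: "g = (a, b)" by (cases g)
    have "(Re z, Im z) \<in> cbox (- R + real a * L, - R + real b * L)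
        (- R + real a * L + real m * (L / real m), - R + real b * L + real m * (L / real m))"
      using g(2) m(1) by (auto simp: grid_square_def ab algebra_simps)
    then obtain u where "u \<in> {..<m} \<times> {..<m}" "(Re z, Im z) \<in> grid_square (- R + real a * L) (- R + real b * L) (L / real m) u"
      using grid_union(2)[OF Lm m(1), of "- R + real a * L" "- R + real b * L"] unfolding grid_square_def by blast
    then show ?thesis using g(1) by (auto simp: cell_def ab square_def intro!: bexI[of _ g] bexI[of _ u])
  qed
  \<comment> \<open>Sample points lie in the disc, where \<open>disc_dist R\<close> controls the
    curves. A square missing the disc gets the default 0, and a cell missing it gets
    \<open>cen g\<close>, so that its difference is 0.\<close>
  define cen where "cen g = (if S g \<inter> cball 0 R = {} then 0 else SOME z. z \<in> S g \<inter> cball 0 R)" for g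
  define pt where "pt g u = (if cell g u \<inter> cball 0 R = {} then cen g else SOME z. z \<in> cell g u \<inter> cball 0 R)" for g u
  have cenS: "cen g \<in> S g \<inter> cball 0 R" if "S g \<inter> cball 0 R \<noteq> {}" for g
  proof -
    have "\<exists>z. z \<in> S g \<inter> cball 0 R" using that by blast
    then have "(SOME z. z \<in> S g \<inter> cball 0 R) \<in> S g \<inter> cball 0 R" by (rule someI_ex)
    then show ?thesis unfolding cen_def if_not_P[OF that] .
  qed
  have ptc: "pt g u \<in> cell g u \<inter> cball 0 R" if "cell g u \<inter> cball 0 R \<noteq> {}" for g u
  proof -
    have "\<exists>z. z \<in> cell g u \<inter> cball 0 R" using that by blast
    then have "(SOME z. z \<in> cell g u \<inter> cball 0 R) \<in> cell g u \<inter> cball 0 R" by (rule someI_ex)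
    then show ?thesis unfolding pt_def if_not_P[OF that] .
  qed
  have cenR: "cen g \<in> cball 0 R" for g
    using cenS[of g] R by (cases "S g \<inter> cball 0 R = {}") (auto simp: cen_def)
  have ptR: "pt g u \<in> cball 0 R" for g u
    using ptc[of g u] cenR[of g] by (cases "cell g u \<inter> cball 0 R = {}") (auto simp: pt_def)
  define E where "E f z i j = proj_mat (f z) $ i $ j" for f :: "complex \<Rightarrow> 'k proj_space" and z i j
  \<comment> \<open>The factor 2 / \<delta> turns the tolerance 2 of \<open>widim_le\<close> into
    \<delta>.\<close>
  define \<psi> where "\<psi> f = (\<lambda>(g, u, (i, j), r). (2 / \<delta>) * (case u of None \<Rightarrow> part r (E f (cen g) i j)
      | Some u \<Rightarrow> soft_threshold \<delta> (part r (E f (pt g u) i j - E f (cen g) i j))))" for f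
  define I where "I = ({..<s} \<times> {..<s}) \<times> insert None (Some ` ({..<m} \<times> {..<m})) \<times> (UNIV :: ('k \<times> 'k) set) \<times> (UNIV :: bool set)"
  have soft: "\<delta> \<ge> 0" using \<delta> by simp
  have Eclose: "cmod (E f z i j - E h z i j) \<le> 2 * disc_dist R f h" if "z \<in> cball 0 R" for f h z i j
    using proj_mat_close[of "f z" i j "h z"] fs_dist_le_disc_dist[OF that, of f h] by (simp add: E_def)
  have part_lip: "\<bar>part r v - part r w\<bar> \<le> cmod (v - w)" for r v w
    using part_facts(2)[of r "v - w"] by (simp add: part_facts(1))
  have \<psi>_lip: "\<bar>\<psi> f x - \<psi> h x\<bar> \<le> (2 / \<delta>) * (4 * disc_dist R f h)" for f h x
  proof -
    obtain g u i j r where x: "x = (g, u, (i, j), r)" by (metis prod.exhaust)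
    have d0: "0 \<le> disc_dist R f h"
      using fs_dist_le_disc_dist[OF cenR[of g], of f h] fs_dist_bounds(1)[of "f (cen g)" "h (cen g)"] by linarith
    have "\<bar>(case u of None \<Rightarrow> part r (E f (cen g) i j)
        | Some u \<Rightarrow> soft_threshold \<delta> (part r (E f (pt g u) i j - E f (cen g) i j))) -
       (case u of None \<Rightarrow> part r (E h (cen g) i j)
        | Some u \<Rightarrow> soft_threshold \<delta> (part r (E h (pt g u) i j - E h (cen g) i j)))\<bar> \<le> 4 * disc_dist R f h"
    proof (cases u)
      case None
      then show ?thesis
        using part_lip[of r "E f (cen g) i j" "E h (cen g) i j"] Eclose[OF cenR[of g], of f i j h] d0 by simp
    next
      case (Some u)
      have "\<bar>part r (E f (pt g u) i j - E f (cen g) i j) - part r (E h (pt g u) i j - E h (cen g) i j)\<bar> \<le> 4 * disc_dist R f h"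
        using part_lip[of r "E f (cen g) i j" "E h (cen g) i j"] Eclose[OF cenR[of g], of f i j h]
          part_lip[of r "E f (pt g u) i j" "E h (pt g u) i j"] Eclose[OF ptR[of g u], of f i j h]
        unfolding part_facts(1) by linarith
      then show ?thesis
        using soft_threshold_facts(3)[OF soft, of "part r (E f (pt g u) i j - E f (cen g) i j)" "part r (E h (pt g u) i j - E h (cen g) i j)"]
        by (simp add: Some)
    qed
    from mult_left_mono[OF this, of "2 / \<delta>"] \<delta> show ?thesis
      by (simp add: \<psi>_def x abs_mult right_diff_distrib[symmetric] del: times_divide_eq_left)
  qed
  show ?thesis
    unfolding M_def[symmetric]
  proof (rule widim_le[where I = I and \<psi> = \<psi> and B = "4 / \<delta>"])
    show "Metric_space M (disc_dist R)"
      by (rule Metric_space_disc_dist[OF R]) (auto simp: M_def brody_space_def)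
    show "infinite (UNIV :: (complex \<Rightarrow> 'k proj_space) set)" by fact
    show "finite I" by (auto simp: I_def)
    show "\<exists>r>0. \<forall>y\<in>M. disc_dist R x y < r \<longrightarrow> \<bar>\<psi> x i - \<psi> y i\<bar> < e" if "e > 0" for i x e
    proof (intro exI[of _ "e * \<delta> / 8"] conjI ballI impI)
      show "e * \<delta> / 8 > 0" using that \<delta> by simp
      fix y assume "disc_dist R x y < e * \<delta> / 8"
      then have "(2 / \<delta>) * (4 * disc_dist R x y) < (2 / \<delta>) * (4 * (e * \<delta> / 8))"
        using \<delta> by (intro mult_strict_left_mono) auto
      also have "\<dots> = e" using \<delta> by simp
      finally show "\<bar>\<psi> x i - \<psi> y i\<bar> < e" using \<psi>_lip[of x i y] by linarith
    qed
    show "\<bar>\<psi> x i\<bar> \<le> 4 / \<delta>" for i x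
    proof -
      obtain g u k j r where i: "i = (g, u, (k, j), r)" by (metis prod.exhaust)
      have b: "\<bar>part r (E x z k j)\<bar> \<le> 1" for z
        using part_facts(2)[of r "E x z k j"] proj_mat_component_le_1[of "x z" k j] by (simp add: E_def)
      have "\<bar>case u of None \<Rightarrow> part r (E x (cen g) k j)
        | Some u \<Rightarrow> soft_threshold \<delta> (part r (E x (pt g u) k j - E x (cen g) k j))\<bar> \<le> 2"
      proof (cases u)
        case None
        then show ?thesis using b[of "cen g"] by simp
      next
        case (Some u)
        then show ?thesis
          using b[of "cen g"] b[of "pt g u"] soft_threshold_facts(4)[OF soft, of "part r (E x (pt g u) k j - E x (cen g) k j)"]
          by (simp add: part_facts(1))
      qed
      from mult_left_mono[OF this, of "2 / \<delta>"] \<delta> show ?thesis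
        by (simp add: \<psi>_def i abs_mult)
    qed
    show "card {i \<in> I. \<psi> x i \<notin> \<int>} \<le> 4 * CARD('k)\<^sup>2 * s\<^sup>2" if x: "x \<in> M" for x
    proof -
      let ?B = "bad_squares x \<delta> (- R) (- R) L s"
      let ?A = "({..<s} \<times> {..<s}) \<times> {None :: (nat \<times> nat) option} \<times> (UNIV :: ('k \<times> 'k) set) \<times> (UNIV :: bool set)"
      let ?C = "?B \<times> Some ` ({..<m} \<times> {..<m}) \<times> (UNIV :: ('k \<times> 'k) set) \<times> (UNIV :: bool set)"
      have fB: "finite ?B" by (auto simp: bad_squares_def)
      have "{i \<in> I. \<psi> x i \<notin> \<int>} \<subseteq> ?A \<union> ?C"
      proof
        fix y assume y: "y \<in> {i \<in> I. \<psi> x i \<notin> \<int>}"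
        obtain g u i j r where yy: "y = (g, u, (i, j), r)" by (metis prod.exhaust)
        show "y \<in> ?A \<union> ?C"
        proof (cases u)
          case None
          then show ?thesis using y by (auto simp: yy I_def)
        next
          case (Some u')
          have g: "g \<in> {..<s} \<times> {..<s}" "u' \<in> {..<m} \<times> {..<m}" using y by (auto simp: yy I_def Some)
          have "soft_threshold \<delta> (part r (E x (pt g u') i j - E x (cen g) i j)) \<noteq> 0"
            using y by (auto simp: \<psi>_def yy Some)
          then have "\<delta> < \<bar>part r (E x (pt g u') i j - E x (cen g) i j)\<bar>"
            using soft_threshold_facts(2)[OF soft] by (meson not_le)
          then have lt: "\<delta> < cmod (E x (pt g u') i j - E x (cen g) i j)"
            using part_facts(2)[of r "E x (pt g u') i j - E x (cen g) i j"] by linarith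
          have "cell g u' \<inter> cball 0 R \<noteq> {}"
          proof
            assume "cell g u' \<inter> cball 0 R = {}"
            then have "pt g u' = cen g" by (simp add: pt_def)
            then show False using lt \<delta> by simp
          qed
          then have "pt g u' \<in> S g" "cen g \<in> S g"
            using ptc[of g u'] cenS[of g] cell_S[OF g(2), of g] by blast+
          then have "g \<in> ?B" using g(1) lt unfolding bad_squares_def E_def S_def by blast
          then show ?thesis using g(2) by (auto simp: yy Some)
        qed
      qed
      then have "card {i \<in> I. \<psi> x i \<notin> \<int>} \<le> card (?A \<union> ?C)"
        by (rule card_mono[rotated]) (use fB in auto)
      also have "\<dots> \<le> card ?A + card ?C" by (rule card_Un_le)
      also have "card ?A = 2 * CARD('k)\<^sup>2 * s\<^sup>2"
        by (simp add: card_cartesian_product power2_eq_square mult_ac)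
      also have "card ?C = card ?B * m\<^sup>2 * (2 * CARD('k)\<^sup>2)"
        by (simp add: card_cartesian_product card_image power2_eq_square mult_ac)
      \<comment> \<open>The assumed density 1 / m^2 of bad squares exactly compensates their m^2
        cells.\<close>
      also have "card ?B * m\<^sup>2 * (2 * CARD('k)\<^sup>2) \<le> s\<^sup>2 * (2 * CARD('k)\<^sup>2)"
      proof (rule mult_right_mono)
        have "real (card ?B) * (real m)\<^sup>2 \<le> (real s)\<^sup>2"
          using bad[of x] x m(1) by (simp add: M_def field_simps)
        then have "real (card ?B * m\<^sup>2) \<le> real (s\<^sup>2)" by simp
        then show "card ?B * m\<^sup>2 \<le> s\<^sup>2" by (simp only: of_nat_le_iff)
      qed simp
      finally show ?thesis by (simp add: mult_ac)
    qed
    fix f h assume f: "f \<in> M" and h: "h \<in> M" and close: "\<And>i. i \<in> I \<Longrightarrow> \<bar>\<psi> f i - \<psi> h i\<bar> \<le> 2"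
    show "disc_dist R f h \<le> \<epsilon>"
    proof (rule disc_dist_le)
      fix z :: complex assume z: "z \<in> cball 0 R"
      obtain g u where g: "g \<in> {..<s} \<times> {..<s}" and u: "u \<in> {..<m} \<times> {..<m}" and zc: "z \<in> cell g u"
        using cover[OF z] by blast
      have ne: "cell g u \<inter> cball 0 R \<noteq> {}" using z zc by blast
      have zp: "cmod (z - pt g u) \<le> 2 * \<delta>"
      proof -
        obtain a b where "cell g u = square (- R + real a * L) (- R + real b * L) (L / real m) u"
          by (cases g) (simp add: cell_def)
        then have "cmod (z - pt g u) \<le> 2 * (L / real m)"
          using ptc[OF ne] zc dist_in_square by blast
        then show ?thesis using m(2) by linarith
      qed
      show "fs_dist (f z) (h z) \<le> \<epsilon>"
      proof (rule small)
        fix i j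
        have p: "\<bar>part r (E f (pt g u) i j - E h (pt g u) i j)\<bar> \<le> 4 * \<delta>" for r
        proof -
          have un: "\<bar>a - b\<bar> \<le> \<delta>" if "\<bar>2 / \<delta> * a - 2 / \<delta> * b\<bar> \<le> 2" for a b
          proof -
            have "\<bar>2 / \<delta> * a - 2 / \<delta> * b\<bar> = 2 / \<delta> * \<bar>a - b\<bar>"
              using \<delta> by (simp add: right_diff_distrib[symmetric] abs_mult del: times_divide_eq_left)
            then show ?thesis using that \<delta> by (simp add: field_simps)
          qed
          have "(g, None, (i, j), r) \<in> I" "(g, Some u, (i, j), r) \<in> I" using g u by (auto simp: I_def)
          then have 1: "\<bar>part r (E f (cen g) i j) - part r (E h (cen g) i j)\<bar> \<le> \<delta>"
            and 2: "\<bar>soft_threshold \<delta> (part r (E f (pt g u) i j - E f (cen g) i j)) -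
              soft_threshold \<delta> (part r (E h (pt g u) i j - E h (cen g) i j))\<bar> \<le> \<delta>"
            using close[of "(g, None, (i, j), r)"] close[of "(g, Some u, (i, j), r)"]
            by (auto simp: \<psi>_def intro!: un simp del: times_divide_eq_left)
          show ?thesis
            using 1 2 soft_threshold_facts(1)[OF soft, of "part r (E f (pt g u) i j - E f (cen g) i j)"]
              soft_threshold_facts(1)[OF soft, of "part r (E h (pt g u) i j - E h (cen g) i j)"]
            unfolding part_facts(1) by linarith
        qed
        \<comment> \<open>Each real part is off by 4 \<delta>: once for the reference value, once
          for the thresholded difference, and once per curve for thresholding. Passing from
          \<open>pt g u\<close> to \<open>z\<close> adds 4 \<delta> for each curve, which gives 16
          \<delta> in all.\<close>
        have "cmod (E f (pt g u) i j - E h (pt g u) i j) \<le> 8 * \<delta>"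
          using part_facts(3)[OF p] by simp
        moreover have "cmod (E f z i j - E f (pt g u) i j) \<le> 4 * \<delta>" "cmod (E h z i j - E h (pt g u) i j) \<le> 4 * \<delta>"
          using proj_mat_lipschitz[of f U z i j "pt g u"] proj_mat_lipschitz[of h U z i j "pt g u"] f h zp
          by (auto simp: M_def E_def)
        moreover have "cmod (E f z i j - E h z i j) \<le> cmod (E f z i j - E f (pt g u) i j) +
            cmod (E f (pt g u) i j - E h (pt g u) i j) + cmod (E h z i j - E h (pt g u) i j)"
          using norm_triangle_ineq4[of "E f z i j - E f (pt g u) i j + (E f (pt g u) i j - E h (pt g u) i j)" "E h z i j - E h (pt g u) i j"]
            norm_triangle_ineq[of "E f z i j - E f (pt g u) i j" "E f (pt g u) i j - E h (pt g u) i j"] by simp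
        ultimately show "cmod (proj_mat (f z) $ i $ j - proj_mat (h z) $ i $ j) \<le> 20 * \<delta>"
          using \<delta> unfolding E_def by linarith
      qed
    qed (use R in simp)
  qed
qed

lemma widim_growth_le:
  fixes V :: "'k::{finite, linorder} proj_space set" and D :: "nat \<Rightarrow> 'k polynomial"
  assumes V: "zariski_closed V" and D: "\<And>i. i \<in> I \<Longrightarrow> \<exists>d\<ge>1. homogeneous d (D i)" and I: "finite I"
    and fin: "finite (V \<inter> (\<Inter>i\<in>I. zeros (D i)))" and \<epsilon>: "\<epsilon> > 0" and \<tau>: "\<tau> > 0"
    and inf: "infinite (UNIV :: (complex \<Rightarrow> 'k proj_space) set)"
  shows "widim_growth (brody_space (V - (\<Union>i\<in>I. zeros (D i)))) \<epsilon> \<le> ereal \<tau>"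
proof -
  define U where "U = V - (\<Union>i\<in>I. zeros (D i))"
  define N where "N = real CARD('k)"
  have N: "N > 0" by (simp add: N_def)
  \<comment> \<open>With \<open>s * L\<close> at most \<open>3 * R\<close> the dimension 4 N^2 s^2
    is at most 36 N^2 R^2 / L^2, which this choice makes equal to \<tau> R^2.\<close>
  define L where "L = 6 * N / sqrt \<tau>"
  have L: "L > 0" using N \<tau> by (simp add: L_def)
  obtain \<delta>' where \<delta>': "\<delta>' > 0"
    "\<And>p q :: 'k proj_space. (\<And>i j. cmod (proj_mat p $ i $ j - proj_mat q $ i $ j) \<le> \<delta>') \<Longrightarrow> fs_dist p q \<le> \<epsilon>"
    using fs_dist_small[OF \<epsilon>] by blast
  define \<delta> where "\<delta> = \<delta>' / 20"
  have \<delta>: "\<delta> > 0" "20 * \<delta> = \<delta>'" using \<delta>'(1) by (auto simp: \<delta>_def)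
  obtain m :: nat where m: "real m > L / \<delta>" using reals_Archimedean2 by blast
  have "0 < L / \<delta>" using L \<delta> by simp
  then have m0: "m > 0" using m by (cases m) auto
  have Lm: "L / real m \<le> \<delta>" using m m0 \<delta>(1) by (simp add: field_simps)
  have m2: "1 / (real m)\<^sup>2 > 0" using m0 by simp
  show ?thesis
  proof (rule few_bad_squares[OF V D I fin L \<delta>(1) m2])
    fix \<kappa> b0 :: nat
    assume \<kappa>: "\<kappa> > 0" and few: "\<And>f X Y b. f \<in> brody_space (V - (\<Union>i\<in>I. zeros (D i))) \<Longrightarrow> b0 \<le> b \<Longrightarrow>
      real (card (bad_squares f \<delta> X Y L (b * \<kappa>))) \<le> 1 / (real m)\<^sup>2 * (real (b * \<kappa>))\<^sup>2"
    have step: "ereal_of_enat (widim \<epsilon> (brody_space U) (disc_dist R)) / ereal (pi * R\<^sup>2) \<le> ereal \<tau>"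
      if R1: "R \<ge> L * \<kappa>" and R2: "R \<ge> L * \<kappa> * b0" for R
    proof -
      have R: "R > 0" using R1 L \<kappa> by (smt (verit) mult_pos_pos of_nat_0_less_iff)
      \<comment> \<open>The number \<open>s\<close> of squares per side must be a multiple of
        \<kappa>. Rounding up covers the diameter \<open>2 * R\<close> and overshoots by less than L
        \<kappa>, hence by less than \<open>R\<close>.\<close>
      define b where "b = nat \<lceil>2 * R / (L * \<kappa>)\<rceil>"
      define s where "s = b * \<kappa>"
      have Lk: "L * \<kappa> > 0" using L \<kappa> by simp
      have q0: "2 * R / (L * \<kappa>) > 0" using R Lk by simp
      have b: "2 * R / (L * \<kappa>) \<le> real b" "real b < 2 * R / (L * \<kappa>) + 1" using q0 unfolding b_def by linarith+
      have "real b0 \<le> R / (L * \<kappa>)" using R2 Lk by (simp add: field_simps)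
      also have "\<dots> \<le> 2 * R / (L * \<kappa>)" using R Lk by (simp add: divide_right_mono)
      finally have b0: "b0 \<le> b" using b(1) by linarith
      have s1: "2 * R \<le> real s * L" using b(1) Lk by (simp add: s_def field_simps)
      have s0: "s > 0" using b(1) q0 \<kappa> by (cases b) (auto simp: s_def)
      have "real s * L < (2 * R / (L * \<kappa>) + 1) * (L * \<kappa>)"
        using mult_strict_right_mono[OF b(2) Lk] by (simp add: s_def mult_ac)
      also have "\<dots> = 2 * R + L * \<kappa>" using Lk L \<kappa> by (simp add: distrib_right)
      finally have s2: "real s * L \<le> 3 * R" using R1 by simp
      have "widim \<epsilon> (brody_space U) (disc_dist R) \<le> enat (4 * CARD('k)\<^sup>2 * s\<^sup>2)"
      proof (rule widim_brody_space_le[OF inf R L \<delta>(1) m0 Lm s1 s0])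
        show "fs_dist p q \<le> \<epsilon>" if "\<And>i j. cmod (proj_mat p $ i $ j - proj_mat q $ i $ j) \<le> 20 * \<delta>" for p q :: "'k proj_space"
          using \<delta>'(2) that unfolding \<delta>(2) by blast
        show "real (card (bad_squares f \<delta> (- R) (- R) L s)) \<le> (real s)\<^sup>2 / (real m)\<^sup>2" if "f \<in> brody_space U" for f
          using few[of f b "- R" "- R"] that b0 by (simp add: U_def s_def)
      qed
      then have "ereal_of_enat (widim \<epsilon> (brody_space U) (disc_dist R)) \<le> ereal_of_enat (enat (4 * CARD('k)\<^sup>2 * s\<^sup>2))"
        by (simp only: ereal_of_enat_le_iff)
      also have "\<dots> = ereal (4 * N\<^sup>2 * (real s)\<^sup>2)" by (simp add: N_def)
      finally have "ereal_of_enat (widim \<epsilon> (brody_space U) (disc_dist R)) / ereal (pi * R\<^sup>2) \<le>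
          ereal (4 * N\<^sup>2 * (real s)\<^sup>2) / ereal (pi * R\<^sup>2)"
        using R by (intro ereal_divide_right_mono) auto
      also have "\<dots> = ereal (4 * N\<^sup>2 * (real s)\<^sup>2 / (pi * R\<^sup>2))" using R by simp
      also have "\<dots> \<le> ereal \<tau>"
      proof -
        have "(real s * L)\<^sup>2 \<le> (3 * R)\<^sup>2" using s2 L by (intro power_mono) auto
        then have "(real s)\<^sup>2 * (36 * N\<^sup>2) \<le> 9 * R\<^sup>2 * \<tau>"
          using \<tau> by (simp add: L_def power_mult_distrib power_divide field_simps)
        then have "4 * N\<^sup>2 * (real s)\<^sup>2 \<le> \<tau> * R\<^sup>2" by (simp add: mult_ac)
        also have "\<dots> \<le> \<tau> * (pi * R\<^sup>2)"
          using \<tau> pi_ge_two by (intro mult_left_mono) (auto simp: mult_le_cancel_right1)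
        finally show ?thesis using R by (simp add: field_simps)
      qed
      finally show ?thesis .
    qed
    show "widim_growth (brody_space (V - (\<Union>i\<in>I. zeros (D i)))) \<epsilon> \<le> ereal \<tau>"
      unfolding widim_growth_def U_def[symmetric]
    proof (rule Limsup_bounded)
      show "\<forall>\<^sub>F R in at_top. ereal_of_enat (widim \<epsilon> (brody_space U) (disc_dist R)) / ereal (pi * R\<^sup>2) \<le> ereal \<tau>"
        using eventually_ge_at_top[of "L * \<kappa>"] eventually_ge_at_top[of "L * \<kappa> * b0"]
        by eventually_elim (rule step)
    qed
  qed
qed

lemma widim_growth_nonneg: "0 \<le> widim_growth M \<epsilon>"
  unfolding widim_growth_def
proof (rule le_Limsup)
  show "\<forall>\<^sub>F R in at_top. 0 \<le> ereal_of_enat (widim \<epsilon> M (disc_dist R)) / ereal (pi * R\<^sup>2)"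
    using eventually_gt_at_top[of "0::real"]
    by eventually_elim (auto intro!: zero_le_divide_ereal)
qed simp

lemma mean_dimension_eq_0I:
  assumes "\<And>\<epsilon>. \<epsilon> > 0 \<Longrightarrow> widim_growth M \<epsilon> = 0"
  shows "mean_dimension M = 0"
proof -
  have "(widim_growth M \<longlongrightarrow> 0) (at_right 0)"
    by (rule tendsto_eventually) (auto simp: eventually_at_right_field assms intro!: exI[of _ 1])
  then show ?thesis
    using tendsto_unique[OF trivial_limit_at_right_real tendsto_mean_dimension] by blast
qed

text \<open>Two distinct points would already give infinitely many functions from the plane, one for
  each point of it. So here the projective space is a single point, all curves agree, and
  \<open>widim_le\<close> with its infinite supply of vertices is replaced by a constant
  map.\<close>

lemma widim_growth_finite_type:
  fixes M :: "(complex \<Rightarrow> 'k::finite proj_space) set"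
  assumes fin: "finite (UNIV :: (complex \<Rightarrow> 'k proj_space) set)" and \<epsilon>: "\<epsilon> > 0"
  shows "widim_growth M \<epsilon> = 0"
proof -
  have one: "p = q" for p q :: "'k proj_space"
  proof (rule ccontr)
    assume "p \<noteq> q"
    then have "inj (\<lambda>c :: complex. \<lambda>z. if z = c then p else q)"
      by (auto simp: inj_def fun_eq_iff split: if_splits)
    then have "finite (UNIV :: complex set)"
      using fin finite_subset[OF subset_UNIV] by (metis finite_imageD)
    then show False using infinite_UNIV_char_0 by blast
  qed
  have "widim \<epsilon> M (disc_dist R) = 0" if "R > 0" for R
  proof (rule widim_0)
    fix f g :: "complex \<Rightarrow> 'k proj_space"
    have "fs_dist (f z) (g z) \<le> \<epsilon>" for z
      using one[of "f z" "g z"] fs_dist_eq_0_iff[of "f z" "g z"] \<epsilon> by simp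
    then show "disc_dist R f g \<le> \<epsilon>" using that by (intro disc_dist_le) auto
  qed
  then have "widim_growth M \<epsilon> \<le> 0"
    unfolding widim_growth_def
    by (intro Limsup_bounded eventually_mono[OF eventually_gt_at_top[of "0::real"]]) auto
  then show ?thesis using widim_growth_nonneg[of M \<epsilon>] by simp
qed

theorem corollary2:
  fixes V :: "'k::{finite,linorder} proj_space set"
    and D :: "nat \<Rightarrow> 'k polynomial"
    and n :: nat
  assumes "projective_variety V"
    and "proj_dim V = ereal (real n)"
    and "\<forall>i\<in>{1..n}. hypersurface (D i)"
    and "general_position V n D"
  shows "mean_dimension (brody_space (V - (\<Union>i\<in>{1..n}. zeros (D i)))) = 0"
proof (rule mean_dimension_eq_0I)
  fix \<epsilon> :: real assume \<epsilon>: "\<epsilon> > 0"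
  let ?M = "brody_space (V - (\<Union>i\<in>{1..n}. zeros (D i)))"
  show "widim_growth ?M \<epsilon> = 0"
  proof (cases "finite (UNIV :: (complex \<Rightarrow> 'k proj_space) set)")
    case True
    then show ?thesis using \<epsilon> by (rule widim_growth_finite_type)
  next
    case False
    have V: "zariski_closed V" using assms(1) by (simp add: projective_variety_def)
    have D: "\<exists>d\<ge>1. homogeneous d (D i)" if "i \<in> {1..n}" for i
      using assms(3) that by (auto simp: hypersurface_def)
    have le: "widim_growth ?M \<epsilon> \<le> ereal \<tau>" if "\<tau> > 0" for \<tau>
      by (rule widim_growth_le[OF V D _ finite_intersection_general_position[OF assms] \<epsilon> that False]) auto
    have "widim_growth ?M \<epsilon> \<le> 0"
      by (rule ereal_le_epsilon2) (use le in simp)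
    then show ?thesis using widim_growth_nonneg[of ?M \<epsilon>] by simp
  qed
qed

end
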